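(* Let $c+1>0$, let $0\le V\in L^1_{loc}(\mathbb{R}^+,y^c\,dy)$, and assume that (i) $c<3$ and $V\in L^2_{loc}(\mathbb{R}^+,y^c\,dy)$, or (ii) $c=3$ and $V|\log y|^{\frac12}\in L^2_{loc}(\mathbb{R}^+,y^c\,dy)$, or (iii) $c>3$ and $Vy^{\frac{3-c}{2}}\in L^2_{loc}(\mathbb{R}^+,y^c\,dy)$. For $r>0$ let $\mathcal{C}_r:=\{u\in L^2_c:\ \mathrm{supp}\,u\subseteq[0,r]\}$. Then $D(B^n-V)\cap\mathcal{C}_r=D(B^n)\cap\mathcal{C}_r$ with equivalence of (graph) norms $$\|u\|_{D(B^n-V)}\simeq\|u\|_{D(B^n)},\qquad\forall u\in D(B^n)\cap\mathcal{C}_r.$$ Finally, $$\mathcal{D}=\left\{u\in C_c^\infty([0,\infty)):\ u\ \text{constant in a neighborhood of } 0\right\}$$ is a core for $B^n-V$.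
   Context: $\mathbb{R}_+=(0,\infty)$; $L^2_c=L^2(\mathbb{R}_+,y^c\,dy)$. $W\in L^q_{loc}(\mathbb{R}^+,y^c\,dy)$ means $W\in L^q([0,b],y^c\,dy)$ for every $0<b<\infty$. For $0\le V\in L^1_{loc}(\mathbb{R}^+,y^c\,dy)$, $B^n-V$ (formally $D_{yy}+\frac cyD_y-V$) is the operator in $L^2_c$ associated with the form $$\mathfrak{a}_V(u,v)=\int_0^\infty\left(D_yu\,D_y\overline v+Vu\overline v\right)y^c\,dy,\qquad D(\mathfrak{a}_V)=\{u\in L^2_c:u'\in L^2_c,\ V^{1/2}u\in L^2_c\},$$ i.e. $u\in D(B^n-V)$ and $B^nu-Vu=-f$ iff $u\in D(\mathfrak a_V)$, $f\in L^2_c$ and $\mathfrak{a}_V(u,v)=\int_0^\infty f\overline v\,y^cdy$ for all $v\in D(\mathfrak{a}_V)$. $B^n$ is the case $V=0$. $\|\cdot\|_{D(A)}$ is the graph norm; $\simeq$ means that each side is bounded by a constant (independent of $u$) times the other.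
   Formalization: In case (ii), c = 3, the formal statement additionally assumes V ∈ L²_loc(y^c dy), because |log y|^{1/2} vanishes at y = 1 and the claim fails otherwise, e.g. for V = |y−1|^{-1/2} near 1; the added condition is necessary for the full conclusion. *)

theory Defs
  imports "HOL-Analysis.Analysis"
begin

text \<open>Functions on the half line are represented by functions on \<open>real\<close> whose values outside
  \<open>(0,\<infinity>)\<close> (outside \<open>[0,\<infinity>)\<close> for the class \<open>Cc_infty {0..}\<close>) are irrelevant.  The spaces consist
  of functions rather than of equivalence classes; all of \<open>Lq\<close>, \<open>form_dom\<close>, \<open>dom_BV\<close> and
  \<open>supported_in\<close> are closed under almost-everywhere equality of
  Borel functions on \<open>(0,\<infinity>)\<close>.\<close>

definition weighted :: "real \<Rightarrow> real measure" where
  "weighted c = density (restrict_space lborel {0<..}) (\<lambda>y. ennreal (y powr c))"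

definition Lq :: "real \<Rightarrow> 'a measure \<Rightarrow> ('a \<Rightarrow> 'b::real_normed_vector) set" where
  "Lq q M = {f \<in> borel_measurable M. integrable M (\<lambda>x. norm (f x) powr q)}"

text \<open>Integrability up to the endpoint \<open>0\<close> is required.\<close>

definition Lq_loc :: "real \<Rightarrow> real \<Rightarrow> (real \<Rightarrow> 'b::real_normed_vector) set" where
  "Lq_loc q c = {f. \<forall>b>0. f \<in> Lq q (restrict_space (weighted c) {0..b})}"

abbreviation L2 :: "real \<Rightarrow> (real \<Rightarrow> complex) set" where
  "L2 c \<equiv> Lq 2 (weighted c)"

definition L2_norm :: "real \<Rightarrow> (real \<Rightarrow> complex) \<Rightarrow> real" where
  "L2_norm c u = sqrt (\<integral>y. (norm (u y))\<^sup>2 \<partial>weighted c)"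

text \<open>For \<open>S\<close> not open, derivatives are taken relative to \<open>S\<close>, so that elements of
  \<open>Cc_infty {0..}\<close> are smooth up to the boundary and need not vanish at \<open>0\<close>.\<close>

definition Cc_infty :: "real set \<Rightarrow> (real \<Rightarrow> complex) set" where
  "Cc_infty S = {f.
     (\<exists>F :: nat \<Rightarrow> real \<Rightarrow> complex. F 0 = f \<and>
        (\<forall>n. \<forall>x\<in>S. (F n has_vector_derivative F (Suc n) x) (at x within S))) \<and>
     (\<exists>K. compact K \<and> K \<subseteq> S \<and> (\<forall>x\<in>S - K. f x = 0))}"

definition locally_integrable :: "(real \<Rightarrow> complex) \<Rightarrow> bool" where
  "locally_integrable u \<longleftrightarrow> (\<forall>a b. 0 < a \<longrightarrow> a < b \<longrightarrow> set_integrable lborel {a..b} u)"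

definition has_weak_derivative :: "(real \<Rightarrow> complex) \<Rightarrow> (real \<Rightarrow> complex) \<Rightarrow> bool" where
  "has_weak_derivative u g \<longleftrightarrow> locally_integrable u \<and> locally_integrable g \<and>
     (\<forall>\<phi>\<in>Cc_infty {0<..}.
        (\<integral>x\<in>{0<..}. u x * vector_derivative \<phi> (at x) \<partial>lborel) = - (\<integral>x\<in>{0<..}. g x * \<phi> x \<partial>lborel))"

text \<open>Weak derivatives are unique only up to null sets; nothing below depends on the choice.\<close>

definition weak_deriv :: "(real \<Rightarrow> complex) \<Rightarrow> real \<Rightarrow> complex" where
  "weak_deriv u = (SOME g. has_weak_derivative u g)"

definition form_dom :: "real \<Rightarrow> (real \<Rightarrow> real) \<Rightarrow> (real \<Rightarrow> complex) set" where
  "form_dom c V = {u \<in> L2 c. (\<exists>g\<in>L2 c. has_weak_derivative u g) \<and>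
     (\<lambda>y. complex_of_real (sqrt (V y)) * u y) \<in> L2 c}"

definition form_V :: "real \<Rightarrow> (real \<Rightarrow> real) \<Rightarrow> (real \<Rightarrow> complex) \<Rightarrow> (real \<Rightarrow> complex) \<Rightarrow> complex" where
  "form_V c V u v =
     (\<integral>y. weak_deriv u y * cnj (weak_deriv v y) + complex_of_real (V y) * u y * cnj (v y) \<partial>weighted c)"

text \<open>\<open>is_BV c V u g\<close> expresses \<open>u \<in> D(B\<^sup>n - V)\<close> and \<open>B\<^sup>n u - V u = g\<close>.  The operator is minus the
  one associated with the form, hence the sign.\<close>

definition is_BV :: "real \<Rightarrow> (real \<Rightarrow> real) \<Rightarrow> (real \<Rightarrow> complex) \<Rightarrow> (real \<Rightarrow> complex) \<Rightarrow> bool" where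
  "is_BV c V u g \<longleftrightarrow> u \<in> form_dom c V \<and> g \<in> L2 c \<and>
     (\<forall>v\<in>form_dom c V. form_V c V u v = (\<integral>y. (- g y) * cnj (v y) \<partial>weighted c))"

definition dom_BV :: "real \<Rightarrow> (real \<Rightarrow> real) \<Rightarrow> (real \<Rightarrow> complex) set" where
  "dom_BV c V = {u. \<exists>g. is_BV c V u g}"

text \<open>For \<open>0 \<le> V\<close> locally integrable the form domain is dense in \<open>L2 c\<close>, so that the value is
  determined up to null sets.\<close>

definition op_BV :: "real \<Rightarrow> (real \<Rightarrow> real) \<Rightarrow> (real \<Rightarrow> complex) \<Rightarrow> real \<Rightarrow> complex" where
  "op_BV c V u = (SOME g. is_BV c V u g)"

definition graph_norm :: "real \<Rightarrow> (real \<Rightarrow> real) \<Rightarrow> (real \<Rightarrow> complex) \<Rightarrow> real" where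
  "graph_norm c V u = L2_norm c u + L2_norm c (op_BV c V u)"

definition is_core_BV :: "real \<Rightarrow> (real \<Rightarrow> real) \<Rightarrow> (real \<Rightarrow> complex) set \<Rightarrow> bool" where
  "is_core_BV c V E \<longleftrightarrow> E \<subseteq> dom_BV c V \<and>
     (\<forall>u\<in>dom_BV c V. \<forall>\<epsilon>>0. \<exists>v\<in>E. graph_norm c V (\<lambda>y. u y - v y) < \<epsilon>)"

text \<open>The support of an almost-everywhere equivalence class, relative to \<open>[0,\<infinity>)\<close>.\<close>

definition ess_supp :: "real \<Rightarrow> (real \<Rightarrow> complex) \<Rightarrow> real set" where
  "ess_supp c u =
     {x. 0 \<le> x \<and> (\<forall>U. open U \<longrightarrow> x \<in> U \<longrightarrow> \<not> (AE y in weighted c. y \<in> U \<longrightarrow> u y = 0))}"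

definition supported_in :: "real \<Rightarrow> real \<Rightarrow> (real \<Rightarrow> complex) set" where
  "supported_in c r = {u \<in> L2 c. ess_supp c u \<subseteq> {0..r}}"

definition core_functions :: "(real \<Rightarrow> complex) set" where
  "core_functions = {u \<in> Cc_infty {0..}. \<exists>\<delta>>0. \<forall>y\<in>{0..<\<delta>}. u y = u 0}"

end

theory Submission
  imports Defs
begin

text \<open>
  Write \<open>B\<close> for the operator without potential.  The proof rests on one pointwise estimate whose
  constant does not depend on the potential.  Let \<open>u\<close> be in the domain of \<open>B - V\<close>, let \<open>g = Bu - Vu\<close>,
  and let \<open>u\<close> vanish beyond \<open>r\<close>.  Then, for almost every \<open>y\<close> in \<open>(0,r)\<close>,
  \<open>\<bar>u(y)\<bar> \<le> \<integral> \<bar>g(s)\<bar> G(y,s) s\<^sup>c ds\<close>, where \<open>G(y,s)\<close> is the integral of \<open>t\<^sup>-\<^sup>c\<close> from \<open>max y s\<close> to \<open>r\<close>: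
  the Green function of \<open>-B\<close> on \<open>(0,r)\<close> with the Neumann condition at \<open>0\<close> and the Dirichlet condition
  at \<open>r\<close>.  This is Kato's inequality.  Because \<open>V \<ge> 0\<close>, the regularized modulus
  \<open>f = sqrt(\<bar>u\<bar>\<^sup>2 + \<epsilon>\<^sup>2)\<close> satisfies \<open>Bf \<ge> -\<bar>g\<bar>\<close>, and inserting the single test function \<open>(u/f) G(y,\<cdot>)\<close> into the
  form gives the integrated version at once (\<open>kato_estimate\<close>).

  By Cauchy-Schwarz \<open>\<bar>u(y)\<bar>\<close> is at most the norm of \<open>g\<close> times that of \<open>G(y,\<cdot>)\<close>, and the square of the latter
  is at most of the order \<open>1\<close>, \<open>1 + \<bar>ln y\<bar>\<close> or \<open>y\<^sup>3\<^sup>-\<^sup>c\<close> for \<open>c < 3\<close>, \<open>c = 3\<close> or \<open>c > 3\<close> (\<open>green_norm_estimate\<close>).  These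
  are the weights with which \<open>V\<^sup>2\<close> is locally integrable by hypothesis.  Hence the norm of \<open>Vu\<close> is at most
  a constant times the norm of \<open>g\<close> (\<open>multiplier_bound\<close>), and this holds for solutions of the equation
  with potential \<open>V\<close> and for those of the equation with potential \<open>0\<close>.  So \<open>Vu\<close> may be moved from one side of
  the equation to the other, which gives the equality of domains and of norms.

  Moving \<open>V\<close> into the right hand side has one more difficulty: the form domain for the potential \<open>0\<close> is
  larger, so that the equation has to be verified for more test functions \<open>v\<close>.  It follows from
  \<open>y\<^sup>c u'(y) = \<integral>\<^sub>0\<^sup>y f(s) s\<^sup>c ds\<close> with \<open>f = g + Vu\<close> by an integration by parts against \<open>v\<close>, which is an application
  of Fubini's theorem; the double integral converges absolutely since the right hand side is at most the norm of \<open>f\<close>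
  times a multiple of the square root of \<open>y\<^sup>c\<^sup>+\<^sup>1\<close> (\<open>weak_identity\<close>, \<open>remove_potential\<close>).

  For the core, multiplication with cutoff functions reduces the claim to \<open>u\<close> with bounded support
  (\<open>cutoff_dense\<close>).  For these the graph norm of \<open>B - V\<close> is controlled by the norm of \<open>f = Bu\<close> alone: use the
  estimate above for the multipliers \<open>V\<close> and \<open>1\<close>.  Since \<open>f\<close> has mean zero with respect to \<open>y\<^sup>c dy\<close>, it
  is a limit of test functions \<open>\<phi>\<close> on \<open>(0,\<infinity>)\<close> with mean zero (\<open>mean_zero_approximation\<close>).  The solution
  of \<open>BU = \<phi>\<close> has the derivative \<open>U'(y) = y\<^sup>-\<^sup>c \<integral>\<^sub>0\<^sup>y \<phi>(s) s\<^sup>c ds\<close>, which is again a test function, so that \<open>U\<close> is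
  constant near \<open>0\<close> and can be taken to vanish far out (\<open>core_function_with_source\<close>).
\<close>

section \<open>Smooth functions\<close>

definition smooth_on :: "real set \<Rightarrow> (real \<Rightarrow> complex) \<Rightarrow> bool" where
  "smooth_on S f \<longleftrightarrow> (\<exists>F :: nat \<Rightarrow> real \<Rightarrow> complex. F 0 = f \<and>
     (\<forall>n. \<forall>x\<in>S. (F n has_vector_derivative F (Suc n) x) (at x within S)))"

lemma Cc_infty_iff:
  "f \<in> Cc_infty S \<longleftrightarrow> smooth_on S f \<and> (\<exists>K. compact K \<and> K \<subseteq> S \<and> (\<forall>x\<in>S - K. f x = 0))"
  by (auto simp: Cc_infty_def smooth_on_def)

text \<open>To prove smoothness it suffices to find a class of functions that contains \<open>f\<close> and is closed under
  differentiation: iterate the choice of a derivative.  Products, powers, extensions and the functions below are treated by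
  exhibiting such a class.\<close>

lemma smooth_on_coinduct:
  assumes "X f"
    and step: "\<And>f. X f \<Longrightarrow> \<exists>f'. X f' \<and> (\<forall>x\<in>S. (f has_vector_derivative f' x) (at x within S))"
  shows "smooth_on S f"
proof -
  obtain D where D: "\<And>f. X f \<Longrightarrow> X (D f) \<and> (\<forall>x\<in>S. (f has_vector_derivative D f x) (at x within S))"
    using step by metis
  have "X ((D ^^ n) f)" for n
    by (induction n) (use assms(1) D in auto)
  then show ?thesis
    unfolding smooth_on_def using D by (intro exI[of _ "\<lambda>n. (D ^^ n) f"]) auto
qed

lemma smooth_on_derivative:
  assumes "smooth_on S f"
  obtains f' where "smooth_on S f'" "\<And>x. x \<in> S \<Longrightarrow> (f has_vector_derivative f' x) (at x within S)"
proof -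
  from assms obtain F where F: "F 0 = f" "\<And>n x. x \<in> S \<Longrightarrow> (F n has_vector_derivative F (Suc n) x) (at x within S)"
    unfolding smooth_on_def by blast
  have "smooth_on S (F 1)"
    unfolding smooth_on_def by (intro exI[of _ "\<lambda>n. F (Suc n)"]) (use F in auto)
  with that[of "F 1"] F show ?thesis by (metis One_nat_def)
qed

lemma smooth_on_primitive:
  assumes "smooth_on S f'" "\<And>x. x \<in> S \<Longrightarrow> (f has_vector_derivative f' x) (at x within S)"
  shows "smooth_on S f"
proof (rule smooth_on_coinduct[where X = "\<lambda>g. smooth_on S g \<or> g = f"])
  fix g assume "smooth_on S g \<or> g = f"
  then show "\<exists>f'. (smooth_on S f' \<or> f' = f) \<and> (\<forall>x\<in>S. (g has_vector_derivative f' x) (at x within S))"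
    using assms smooth_on_derivative by metis
qed simp

lemma smooth_on_subset:
  assumes "smooth_on S f" "T \<subseteq> S"
  shows "smooth_on T f"
proof -
  from assms(1) obtain F where "F 0 = f"
    "\<And>n x. x \<in> S \<Longrightarrow> (F n has_vector_derivative F (Suc n) x) (at x within S)"
    unfolding smooth_on_def by blast
  with assms(2) show ?thesis
    unfolding smooth_on_def using has_vector_derivative_within_subset by (intro exI[of _ F]) blast
qed

lemma smooth_on_continuous: "smooth_on S f \<Longrightarrow> continuous_on S f"
  by (metis smooth_on_derivative continuous_on_vector_derivative)

lemma smooth_on_const [intro]: "smooth_on S (\<lambda>_. a)"
  by (rule smooth_on_coinduct[where X = "\<lambda>f. \<exists>a. f = (\<lambda>_. a)"]) (auto intro!: exI[of _ "\<lambda>_. 0"])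

lemma smooth_on_scaled: 
  assumes "smooth_on UNIV f"
  shows "smooth_on S (\<lambda>x. f (a * x + b))"
proof (rule smooth_on_subset[of UNIV])
  show "smooth_on UNIV (\<lambda>x. f (a * x + b))"
  proof (rule smooth_on_coinduct[where X = "\<lambda>g. \<exists>k f. smooth_on UNIV f \<and> g = (\<lambda>x. complex_of_real k * f (a * x + b))"])
    show "\<exists>k fa. smooth_on UNIV fa \<and> (\<lambda>x. f (a * x + b)) = (\<lambda>x. complex_of_real k * fa (a * x + b))"
      using assms by (intro exI[of _ 1] exI[of _ f]) auto
  next
    fix g assume "\<exists>k f. smooth_on UNIV f \<and> g = (\<lambda>x. complex_of_real k * f (a * x + b))"
    then obtain k f where f: "smooth_on UNIV f" and g: "g = (\<lambda>x. complex_of_real k * f (a * x + b))" by blast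
    obtain f' where f': "smooth_on UNIV f'" "\<And>x. (f has_vector_derivative f' x) (at x)"
      using smooth_on_derivative[OF f] by auto
    have "(g has_vector_derivative complex_of_real (k * a) * f' (a * x + b)) (at x)" for x
    proof -
      have "((\<lambda>x. a * x + b) has_vector_derivative a) (at x)"
        by (auto intro!: derivative_eq_intros simp flip: has_real_derivative_iff_has_vector_derivative)
      from vector_diff_chain_at[OF this f'(2)] 
      have "((\<lambda>x. f (a * x + b)) has_vector_derivative a *\<^sub>R f' (a * x + b)) (at x)"
        by (simp add: o_def)
      from has_vector_derivative_mult_right[OF this, of "complex_of_real k"] show ?thesis
        unfolding g by (simp add: scaleR_conv_of_real mult.assoc)
    qed
    with f' show "\<exists>f'. (\<exists>k fa. smooth_on UNIV fa \<and> f' = (\<lambda>x. complex_of_real k * fa (a * x + b))) \<and>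
           (\<forall>x\<in>UNIV. (g has_vector_derivative f' x) (at x))" by blast
  qed
qed simp

lemma smooth_on_add [intro]:
  assumes "smooth_on S f" "smooth_on S g"
  shows "smooth_on S (\<lambda>x. f x + g x)"
proof (rule smooth_on_coinduct[where X = "\<lambda>h. \<exists>f g. smooth_on S f \<and> smooth_on S g \<and> h = (\<lambda>x. f x + g x)"])
  fix h assume "\<exists>f g. smooth_on S f \<and> smooth_on S g \<and> h = (\<lambda>x. f x + g x)"
  then obtain f g where fg: "smooth_on S f" "smooth_on S g" and h: "h = (\<lambda>x. f x + g x)" by blast
  obtain f' where f': "smooth_on S f'" "\<And>x. x \<in> S \<Longrightarrow> (f has_vector_derivative f' x) (at x within S)"
    using smooth_on_derivative[OF fg(1)] by metis
  obtain g' where g': "smooth_on S g'" "\<And>x. x \<in> S \<Longrightarrow> (g has_vector_derivative g' x) (at x within S)"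
    using smooth_on_derivative[OF fg(2)] by metis
  show "\<exists>h'. (\<exists>f g. smooth_on S f \<and> smooth_on S g \<and> h' = (\<lambda>x. f x + g x)) \<and>
     (\<forall>x\<in>S. (h has_vector_derivative h' x) (at x within S))"
    unfolding h using f' g' by (intro exI[of _ "\<lambda>x. f' x + g' x"]) (auto intro!: derivative_intros)
qed (use assms in blast)

text \<open>The derivative of a product is a sum of two products, so that the class preserved by
  differentiation consists of finite sums of products.\<close>

lemma smooth_on_mult [intro]:
  assumes "smooth_on S f" "smooth_on S g"
  shows "smooth_on S (\<lambda>x. f x * g x)"
proof -
  define X where "X h \<longleftrightarrow> (\<exists>ps. (\<forall>(f,g)\<in>set ps. smooth_on S f \<and> smooth_on S g) \<and>
      h = (\<lambda>x. \<Sum>(f,g)\<leftarrow>ps. f x * g x))" for h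
  have step: "\<exists>qs. (\<forall>(f,g)\<in>set qs. smooth_on S f \<and> smooth_on S g) \<and>
     (\<forall>x\<in>S. ((\<lambda>x. \<Sum>(f,g)\<leftarrow>ps. f x * g x) has_vector_derivative (\<Sum>(f,g)\<leftarrow>qs. f x * g x)) (at x within S))"
    if "\<forall>(f,g)\<in>set ps. smooth_on S f \<and> smooth_on S g" for ps
    using that
  proof (induction ps)
    case Nil
    then show ?case by (intro exI[of _ "[]"]) auto
  next
    case (Cons p ps)
    obtain f g where p: "p = (f, g)" by force
    from Cons p have fg: "smooth_on S f" "smooth_on S g" by auto
    obtain f' where f': "smooth_on S f'" "\<And>x. x \<in> S \<Longrightarrow> (f has_vector_derivative f' x) (at x within S)"
      using smooth_on_derivative[OF fg(1)] by metis
    obtain g' where g': "smooth_on S g'" "\<And>x. x \<in> S \<Longrightarrow> (g has_vector_derivative g' x) (at x within S)"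
      using smooth_on_derivative[OF fg(2)] by metis
    from Cons obtain qs where qs: "\<forall>(f,g)\<in>set qs. smooth_on S f \<and> smooth_on S g"
      "\<And>x. x \<in> S \<Longrightarrow> ((\<lambda>x. \<Sum>(f,g)\<leftarrow>ps. f x * g x) has_vector_derivative (\<Sum>(f,g)\<leftarrow>qs. f x * g x)) (at x within S)"
      by auto
    have "((\<lambda>x. \<Sum>(f,g)\<leftarrow>p#ps. f x * g x) has_vector_derivative
        (\<Sum>(f,g)\<leftarrow>(f, g') # (f', g) # qs. f x * g x)) (at x within S)" if "x \<in> S" for x
      using has_vector_derivative_add[OF has_vector_derivative_mult[OF f'(2) g'(2)] qs(2), OF that that that]
      by (simp add: p add.assoc)
    with f' g' fg qs show ?case by (intro exI[of _ "(f, g') # (f', g) # qs"]) auto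
  qed
  show ?thesis
  proof (rule smooth_on_coinduct[where X = X])
    show "X (\<lambda>x. f x * g x)"
      unfolding X_def by (intro exI[of _ "[(f, g)]"]) (use assms in auto)
  next
    fix h assume "X h"
    then obtain ps where ps: "\<forall>(f,g)\<in>set ps. smooth_on S f \<and> smooth_on S g"
      and h: "h = (\<lambda>x. \<Sum>(f,g)\<leftarrow>ps. f x * g x)" unfolding X_def by blast
    from step[OF ps] obtain qs where qs: "\<forall>(f,g)\<in>set qs. smooth_on S f \<and> smooth_on S g"
      "\<forall>x\<in>S. (h has_vector_derivative (\<Sum>(f,g)\<leftarrow>qs. f x * g x)) (at x within S)"
      unfolding h by blast
    then have "X (\<lambda>x. \<Sum>(f,g)\<leftarrow>qs. f x * g x)" unfolding X_def by blast
    with qs(2) show "\<exists>h'. X h' \<and> (\<forall>x\<in>S. (h has_vector_derivative h' x) (at x within S))"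
      by (intro exI[of _ "\<lambda>x. \<Sum>(f,g)\<leftarrow>qs. f x * g x"] conjI)
  qed
qed

lemma smooth_on_cmult: "smooth_on S f \<Longrightarrow> smooth_on S (\<lambda>x. a * f x)"
  by (rule smooth_on_mult[OF smooth_on_const])

lemma smooth_on_diff [intro]:
  assumes "smooth_on S f" "smooth_on S g"
  shows "smooth_on S (\<lambda>x. f x - g x)"
  using smooth_on_add[OF assms(1) smooth_on_cmult[OF assms(2), of "-1"]] by simp

lemma smooth_on_powr: "smooth_on {0<..} (\<lambda>x. complex_of_real (x powr b))"
proof (rule smooth_on_coinduct[where X = "\<lambda>f. \<exists>k b. f = (\<lambda>x. complex_of_real (k * x powr b))"])
  show "\<exists>k b'. (\<lambda>x. complex_of_real (x powr b)) = (\<lambda>x. complex_of_real (k * x powr b'))"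
    by (intro exI[of _ 1] exI[of _ b]) auto
next
  fix f assume "\<exists>k b. f = (\<lambda>x. complex_of_real (k * x powr b))"
  then obtain k b where f: "f = (\<lambda>x. complex_of_real (k * x powr b))" by blast
  have "(f has_vector_derivative complex_of_real (k * b * x powr (b - 1))) (at x within {0<..})" if "x > 0" for x
    unfolding f
    by (intro has_vector_derivative_of_real)
       (use that in \<open>auto intro!: derivative_eq_intros simp flip: has_real_derivative_iff_has_vector_derivative\<close>)
  then show "\<exists>f'. (\<exists>k b. f' = (\<lambda>x. complex_of_real (k * x powr b))) \<and>
     (\<forall>x\<in>{0<..}. (f has_vector_derivative f' x) (at x within {0<..}))"
    by (intro exI[of _ "\<lambda>x. complex_of_real (k * b * x powr (b - 1))"] conjI exI[of _ "k * b"] exI[of _ "b - 1"]) auto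
qed

text \<open>A function that vanishes near \<open>0\<close> has derivatives with the same property, so that these functions
  form a class closed under differentiation even after extension by zero.\<close>

lemma smooth_on_extend_zero:
  assumes "smooth_on {0<..} f" "a > 0" "\<And>x. 0 < x \<Longrightarrow> x < a \<Longrightarrow> f x = 0"
  shows "smooth_on UNIV (\<lambda>x. if 0 < x then f x else 0)"
proof (rule smooth_on_coinduct[where X = "\<lambda>h. \<exists>f. smooth_on {0<..} f \<and> (\<forall>x. 0 < x \<longrightarrow> x < a \<longrightarrow> f x = 0) \<and> h = (\<lambda>x. if 0 < x then f x else 0)"])
  show "\<exists>fa. smooth_on {0<..} fa \<and> (\<forall>x. 0 < x \<longrightarrow> x < a \<longrightarrow> fa x = 0) \<and> (\<lambda>x. if 0 < x then f x else 0) = (\<lambda>x. if 0 < x then fa x else 0)"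
    using assms by blast
next
  fix h assume "\<exists>f. smooth_on {0<..} f \<and> (\<forall>x. 0 < x \<longrightarrow> x < a \<longrightarrow> f x = 0) \<and> h = (\<lambda>x. if 0 < x then f x else 0)"
  then obtain f where f: "smooth_on {0<..} f" "\<And>x. 0 < x \<Longrightarrow> x < a \<Longrightarrow> f x = 0" "h = (\<lambda>x. if 0 < x then f x else 0)"
    by blast
  obtain f' where f': "smooth_on {0<..} f'" "\<And>x. 0 < x \<Longrightarrow> (f has_vector_derivative f' x) (at x within {0<..})"
    using smooth_on_derivative[OF f(1)] by (metis greaterThan_iff)
  have f'at: "(f has_vector_derivative f' x) (at x)" if "0 < x" for x
    using f'(2)[OF that] at_within_open[of x "{0<..}"] that by simp
  have zero: "(h has_vector_derivative 0) (at x)" if "x < a" for x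
    by (rule has_vector_derivative_transform_within_open[of "\<lambda>_. 0" _ _ "{..<a}"]) (use that f in auto)
  have "f' x = 0" if "0 < x" "x < a" for x
  proof -
    have "(f has_vector_derivative 0) (at x)"
      by (rule has_vector_derivative_transform_within_open[of "\<lambda>_. 0" _ _ "{0<..<a}"]) (use that f in auto)
    with f'at[OF that(1)] show ?thesis using vector_derivative_unique_at by blast
  qed
  moreover have "(h has_vector_derivative (if 0 < x then f' x else 0)) (at x)" for x
  proof (cases "0 < x")
    case True
    then show ?thesis
      by (auto intro!: has_vector_derivative_transform_within_open[of f _ _ "{0<..}"] f'at simp: f(3))
  next
    case False
    with zero assms(2) show ?thesis by simp
  qed
  ultimately show "\<exists>f'. (\<exists>f. smooth_on {0<..} f \<and> (\<forall>x. 0 < x \<longrightarrow> x < a \<longrightarrow> f x = 0) \<and> f' = (\<lambda>x. if 0 < x then f x else 0)) \<and>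
            (\<forall>x\<in>UNIV. (h has_vector_derivative f' x) (at x))"
    using f'(1) by (intro exI[of _ "\<lambda>x. if 0 < x then f' x else 0"]) auto
qed

text \<open>The classical smooth function that is flat at \<open>0\<close>.\<close>

definition flat :: "real \<Rightarrow> real" where
  "flat x = (if 0 < x then exp (- (1 / x)) else 0)"

lemma flat_nonneg: "0 \<le> flat x" and flat_le_1: "flat x \<le> 1"
  by (auto simp: flat_def)

lemma tendsto_poly_exp_0: "((\<lambda>t. poly p t * exp (- t)) \<longlongrightarrow> (0::real)) at_top"
proof -
  have "((\<lambda>t. \<Sum>i\<le>degree p. coeff p i * (t ^ i / exp t)) \<longlongrightarrow> (\<Sum>i\<le>degree p. coeff p i * 0)) at_top"
    by (intro tendsto_sum tendsto_mult tendsto_const tendsto_power_div_exp_0)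
  then show ?thesis
    by (simp add: poly_altdef sum_distrib_right exp_minus divide_inverse mult.assoc)
qed

text \<open>All derivatives are of the form \<open>p(1/x) e\<^sup>-\<^sup>1\<^sup>/\<^sup>x\<close> with a polynomial \<open>p\<close>, and these tend to \<open>0\<close> at the origin.\<close>

lemma smooth_flat: "smooth_on UNIV (\<lambda>x. complex_of_real (flat x))"
proof -
  define G where "G p x = (if 0 < x then poly p (1 / x) * exp (- (1 / x)) else 0)" for p :: "real poly" and x :: real
  have G: "(G p has_real_derivative G ([:0,0,1:] * (p - pderiv p)) x) (at x)" for p x
  proof (cases x "0::real" rule: linorder_cases)
    case less
    have "(G p has_real_derivative 0) (at x)"
      by (rule has_field_derivative_transform_within[of "\<lambda>_. 0" _ _ _ "-x"]) (use less in \<open>auto simp: G_def dist_real_def\<close>)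
    then show ?thesis using less by (simp add: G_def)
  next
    case greater
    have "((\<lambda>x. poly p (1 / x) * exp (- (1 / x))) has_real_derivative
        (poly (pderiv p) (1 / x) * (- 1 / x\<^sup>2)) * exp (- (1 / x)) + poly p (1/x) * (exp (- (1 / x)) * (1 / x\<^sup>2))) (at x)"
      using greater by (auto intro!: derivative_eq_intros DERIV_chain2[OF poly_DERIV] simp: power2_eq_square)
    then have "((\<lambda>x. poly p (1 / x) * exp (- (1 / x))) has_real_derivative G ([:0,0,1:] * (p - pderiv p)) x) (at x)"
      using greater by (simp add: G_def field_simps power2_eq_square)
    then show ?thesis
      by (rule has_field_derivative_transform_within[of _ _ _ _ x]) (use greater in \<open>auto simp: G_def dist_real_def\<close>)
  next
    case equal
    have "((\<lambda>t. poly ([:0,1:] * p) t * exp (- t)) \<longlongrightarrow> 0) at_top" by (rule tendsto_poly_exp_0)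
    then have "((\<lambda>h. poly ([:0,1:] * p) (inverse h) * exp (- inverse h)) \<longlongrightarrow> 0) (at_right 0)"
      by (rule filterlim_compose[OF _ filterlim_inverse_at_top_right])
    then have "((\<lambda>h. (G p (0 + h) - G p 0) / h) \<longlongrightarrow> 0) (at_right 0)"
      by (rule Lim_transform_eventually)
         (auto simp: G_def eventually_at_filter inverse_eq_divide)
    moreover have "((\<lambda>h. (G p (0 + h) - G p 0) / h) \<longlongrightarrow> 0) (at_left 0)"
      by (rule Lim_transform_eventually[OF tendsto_const]) (auto simp: G_def eventually_at_filter)
    ultimately have "((\<lambda>h. (G p (0 + h) - G p 0) / h) \<longlongrightarrow> 0) (at 0)"
      by (simp add: filterlim_at_split)
    then have "(G p has_real_derivative 0) (at 0)" by (simp add: DERIV_def)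
    then show ?thesis using equal by (simp add: G_def)
  qed
  show ?thesis
  proof (rule smooth_on_coinduct[where X = "\<lambda>f. \<exists>p. f = (\<lambda>x. complex_of_real (G p x))"])
    show "\<exists>p. (\<lambda>x. complex_of_real (flat x)) = (\<lambda>x. complex_of_real (G p x))"
      by (intro exI[of _ 1]) (auto simp: G_def flat_def)
  next
    fix f assume "\<exists>p. f = (\<lambda>x. complex_of_real (G p x))"
    then obtain p where f: "f = (\<lambda>x. complex_of_real (G p x))" by blast
    have "(f has_vector_derivative complex_of_real (G ([:0,0,1:] * (p - pderiv p)) x)) (at x)" for x
      unfolding f using G by (intro has_vector_derivative_of_real) (simp flip: has_real_derivative_iff_has_vector_derivative)
    then show "\<exists>f'. (\<exists>p. f' = (\<lambda>x. complex_of_real (G p x))) \<and> (\<forall>x\<in>UNIV. (f has_vector_derivative f' x) (at x))"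
      by (intro exI[of _ "\<lambda>x. complex_of_real (G ([:0,0,1:] * (p - pderiv p)) x)"]) auto
  qed
qed

text \<open>Since \<open>flat (n x)\<close> is the \<open>n\<close>-th root of \<open>flat x\<close>, scaling the argument produces an increasing
  sequence of smooth functions that converges to the indicator of \<open>(a,b)\<close>; no normalization is necessary.\<close>

definition bump :: "real \<Rightarrow> real \<Rightarrow> nat \<Rightarrow> real \<Rightarrow> real" where
  "bump a b n x = flat (real (Suc n) * (x - a)) * flat (real (Suc n) * (b - x))"

lemma bump_nonneg: "0 \<le> bump a b n x" and bump_le_1: "bump a b n x \<le> 1"
  by (auto simp: bump_def flat_nonneg flat_le_1 mult_le_one)

lemma bump_outside: "x \<notin> {a<..<b} \<Longrightarrow> bump a b n x = 0"
  by (auto simp: bump_def flat_def zero_less_mult_iff)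

lemma bump_pos: "x \<in> {a<..<b} \<Longrightarrow> bump a b n x > 0"
  by (auto simp: bump_def flat_def zero_less_mult_iff)

lemma smooth_bump: "smooth_on S (\<lambda>x. complex_of_real (bump a b n x))"
proof -
  have "smooth_on S (\<lambda>x. complex_of_real (flat (real (Suc n) * x + (- real (Suc n) * a))) *
       complex_of_real (flat ((- real (Suc n)) * x + real (Suc n) * b)))"
    by (intro smooth_on_mult smooth_on_scaled smooth_flat)
  then show ?thesis by (simp add: bump_def algebra_simps)
qed

lemma bump_tendsto: "(\<lambda>n. bump a b n x) \<longlonglongrightarrow> indicator {a<..<b} x"
proof (cases "x \<in> {a<..<b}")
  case True
  have "(\<lambda>n. exp (- (1 / (real (Suc n) * d)))) \<longlonglongrightarrow> exp 0" if "d > 0" for d :: real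
  proof (rule tendsto_exp)
    have "(\<lambda>n. - (inverse (real (Suc n)) * (1 / d))) \<longlonglongrightarrow> - (0 * (1 / d))"
      by (intro tendsto_intros LIMSEQ_inverse_real_of_nat)
    then show "(\<lambda>n. - (1 / (real (Suc n) * d))) \<longlonglongrightarrow> 0" by (simp add: field_simps)
  qed
  from tendsto_mult[OF this[of "x - a"] this[of "b - x"]] True
  show ?thesis by (simp add: bump_def flat_def zero_less_mult_iff)
next
  case False
  then show ?thesis by (simp add: bump_outside)
qed

lemma bump_Cc_infty: "0 < a \<Longrightarrow> (\<lambda>x. complex_of_real (bump a b n x)) \<in> Cc_infty {0<..}"
  unfolding Cc_infty_iff
  by (auto intro!: smooth_bump exI[of _ "{a..b}"] bump_outside)

section \<open>Integration on intervals and test functions\<close>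

lemma set_integral_empty [simp]: "set_lebesgue_integral M {} f = 0"
  by (simp add: set_lebesgue_integral_def)

lemma set_integrable_mult_bounded:
  fixes h k :: "real \<Rightarrow> complex"
  assumes h: "set_integrable lborel S h" and k: "set_borel_measurable lborel S k"
    and B: "\<And>x. x \<in> S \<Longrightarrow> norm (k x) \<le> B"
  shows "set_integrable lborel S (\<lambda>x. h x * k x)"
  unfolding set_integrable_def
proof (rule Bochner_Integration.integrable_bound)
  show "integrable lborel (\<lambda>x. B * norm (indicator S x *\<^sub>R h x))"
    using h by (intro integrable_mult_right integrable_norm) (simp add: set_integrable_def)
  have "(\<lambda>x. (indicator S x *\<^sub>R h x) * (indicator S x *\<^sub>R k x)) \<in> borel_measurable lborel"
    using h k by (intro borel_measurable_times) (auto simp: set_integrable_def set_borel_measurable_def)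
  also have "(\<lambda>x. (indicator S x *\<^sub>R h x) * (indicator S x *\<^sub>R k x)) = (\<lambda>x. indicator S x *\<^sub>R (h x * k x))"
    by (auto simp: indicator_def)
  finally show "(\<lambda>x. indicator S x *\<^sub>R (h x * k x)) \<in> borel_measurable lborel" .
  show "AE x in lborel. norm (indicator S x *\<^sub>R (h x * k x)) \<le> norm (B * norm (indicator S x *\<^sub>R h x))"
  proof (rule AE_I2)
    fix x
    have "norm (h x) * norm (k x) \<le> \<bar>B\<bar> * norm (h x)" if "x \<in> S"
      using mult_right_mono[OF order_trans[OF B[OF that] abs_ge_self], of "norm (h x)"] by (simp add: mult.commute)
    then show "norm (indicator S x *\<^sub>R (h x * k x)) \<le> norm (B * norm (indicator S x *\<^sub>R h x))"
      by (auto simp: indicator_def norm_mult abs_mult)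
  qed
qed

lemma set_integral_Ioo:
  fixes f :: "real \<Rightarrow> complex"
  assumes "set_integrable lborel {a..b} f"
  shows "(LBINT x:{a<..<b}. f x) = integral {a..b} f" "(LBINT x:{a<..<b}. f x) = (LBINT x:{a..b}. f x)"
proof -
  have "AE x in lborel. indicator {a<..<b} x *\<^sub>R f x = indicator {a..b} x *\<^sub>R f x"
    using AE_lborel_singleton[of a] AE_lborel_singleton[of b]
    by eventually_elim (auto simp: indicator_def)
  moreover have "set_integrable lborel {a<..<b} f"
    by (rule set_integrable_subset[OF assms]) auto
  ultimately show "(LBINT x:{a<..<b}. f x) = (LBINT x:{a..b}. f x)"
    unfolding set_lebesgue_integral_def
    by (intro integral_cong_AE) (use assms in \<open>auto simp: set_integrable_def\<close>)
  then show "(LBINT x:{a<..<b}. f x) = integral {a..b} f"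
    using set_borel_integral_eq_integral(2)[OF assms] by simp
qed

lemma locally_integrableD:
  assumes "locally_integrable f" "0 < a"
  shows "set_integrable lborel {a..b} f" "set_integrable lborel {a<..<b} f"
proof -
  have "set_integrable lborel {a..max b (a + 1)} f"
    using assms by (auto simp: locally_integrable_def)
  then show "set_integrable lborel {a..b} f" "set_integrable lborel {a<..<b} f"
    by (auto elim!: set_integrable_subset)
qed

lemma locally_integrable_measurable:
  assumes "locally_integrable f" "S \<in> sets borel" "S \<subseteq> {0<..}"
  shows "set_borel_measurable lborel S f"
proof -
  have "(\<lambda>x. indicator {0<..} x *\<^sub>R f x) \<in> borel_measurable lborel"
  proof (rule borel_measurable_LIMSEQ_metric[where f = "\<lambda>n x. indicator {1 / real (Suc n)..real (Suc n)} x *\<^sub>R f x"])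
    show "(\<lambda>x. indicator {1 / real (Suc n)..real (Suc n)} x *\<^sub>R f x) \<in> borel_measurable lborel" for n
      using locally_integrableD(1)[OF assms(1), of "1 / real (Suc n)" "real (Suc n)"]
      by (auto simp: set_integrable_def)
    fix x
    obtain N :: nat where N: "real N > max x (1 / x)" using reals_Archimedean2 by blast
    have "eventually (\<lambda>n. indicator {0<..} x = (indicator {1 / real (Suc n)..real (Suc n)} x :: real)) sequentially"
      using eventually_ge_at_top[of N]
    proof eventually_elim
      fix n assume "N \<le> n"
      then have *: "real (Suc n) > max x (1 / x)" using N by linarith
      show "indicator {0<..} x = (indicator {1 / real (Suc n)..real (Suc n)} x :: real)"
      proof (cases "x > 0")
        case True
        with * have "1 / real (Suc n) \<le> x" "x \<le> real (Suc n)" by (auto simp: field_simps)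
        with True show ?thesis by (auto simp: indicator_def)
      next
        case False
        moreover have "1 / real (Suc n) > 0" by simp
        ultimately have "\<not> 1 / real (Suc n) \<le> x" by linarith
        with False show ?thesis by (auto simp: indicator_def)
      qed
    qed
    then show "(\<lambda>n. indicator {1 / real (Suc n)..real (Suc n)} x *\<^sub>R f x) \<longlonglongrightarrow> indicator {0<..} x *\<^sub>R f x"
      by (intro tendsto_eventually) (auto elim: eventually_mono)
  qed
  then have "(\<lambda>x. indicator S x *\<^sub>R (indicator {0<..} x *\<^sub>R f x)) \<in> borel_measurable lborel"
    using assms(2) by (rule_tac borel_measurable_scaleR[OF borel_measurable_indicator]) auto
  moreover have "(\<lambda>x. indicator S x *\<^sub>R (indicator {0<..} x *\<^sub>R f x)) = (\<lambda>x. indicator S x *\<^sub>R f x)"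
    using assms(3) by (auto simp: indicator_def fun_eq_iff)
  ultimately show ?thesis by (simp add: set_borel_measurable_def)
qed

lemma locally_integrable_measurable_Ioo:
  assumes "locally_integrable f" "0 \<le> a"
  shows "set_borel_measurable lborel {a<..<b} f"
  using assms by (intro locally_integrable_measurable) auto

lemma locally_integrable_diff:
  "locally_integrable f \<Longrightarrow> locally_integrable g \<Longrightarrow> locally_integrable (\<lambda>x. f x - g x)"
  unfolding locally_integrable_def by (auto intro: set_integral_diff)

lemma locally_integrable_continuous:
  "continuous_on {0<..} f \<Longrightarrow> locally_integrable f"
  unfolding locally_integrable_def
  by (auto intro!: borel_integrable_compact simp: set_integrable_def intro: continuous_on_subset)

lemma sets_borel_Ioo: "sets borel = sigma_sets UNIV (range (\<lambda>(a, b). {a<..<b :: real}))"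
proof -
  have "(\<lambda>(a, b). {a<..<b :: real}) = (\<lambda>(a, b). box a b)" by (auto simp: fun_eq_iff box_real)
  then show ?thesis by (simp only:) (subst borel_eq_box, simp)
qed

text \<open>Open intervals generate the Borel sets and are stable under intersection, so that by Dynkin's theorem the
  integrals over all Borel sets vanish.\<close>

lemma AE_zero_of_interval_integrals:
  fixes h :: "real \<Rightarrow> complex"
  assumes int: "\<And>a b. \<alpha> < a \<Longrightarrow> a < b \<Longrightarrow> set_integrable lborel {a..b} h"
    and zero: "\<And>a b. \<alpha> < a \<Longrightarrow> a < b \<Longrightarrow> (LBINT x:{a<..<b}. h x) = 0"
  shows "AE x in lborel. \<alpha> < x \<longrightarrow> h x = 0"
proof -
  have *: "AE x in lborel. A < x \<longrightarrow> x < B \<longrightarrow> h x = 0" if "\<alpha> < A" "A < B" for A B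
  proof -
    define f where "f x = indicator {A<..<B} x *\<^sub>R h x" for x
    have f_int: "integrable lborel f"
      using set_integrable_subset[OF int[OF that], of "{A<..<B}"]
      by (simp add: set_integrable_def f_def[abs_def] greaterThanLessThan_subseteq_atLeastAtMost_iff)
    have f_Ioo: "(LBINT x:{a<..<b}. f x) = 0" for a b
    proof -
      have "(LBINT x:{a<..<b}. f x) = (LBINT x:{max a A<..<min b B}. h x)"
        by (auto simp: set_lebesgue_integral_def f_def indicator_def intro!: Bochner_Integration.integral_cong)
      also have "\<dots> = 0"
        using zero[of "max a A" "min b B"] that by (cases "max a A < min b B") auto
      finally show ?thesis .
    qed
    have tot: "integral\<^sup>L lborel f = 0"
    proof -
      have "integral\<^sup>L lborel f = (LBINT x:{A<..<B}. f x)"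
        by (auto simp: set_lebesgue_integral_def f_def indicator_def intro!: Bochner_Integration.integral_cong)
      then show ?thesis using f_Ioo by simp
    qed
    have "AE x in lborel. f x = 0"
    proof (rule sigma_finite_measure.density_zero[OF sigma_finite_lborel f_int])
      fix S assume "S \<in> sets (lborel :: real measure)"
      then have S: "S \<in> sigma_sets UNIV (range (\<lambda>(a, b). {a<..<b :: real}))"
        using sets_borel_Ioo by auto
      have *: "Int_stable (range (\<lambda>(a, b). {a<..<b :: real}))"
        by (auto simp: Int_stable_def Int_greaterThanLessThan image_iff)
      have **: "range (\<lambda>(a, b). {a<..<b :: real}) \<subseteq> Pow UNIV" by simp
      from * ** S show "(LBINT x:S. f x) = 0"
      proof (induction rule: sigma_sets_induct_disjoint)
        case (basic S)
        then show ?case using f_Ioo by auto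
      next
        case (compl S)
        then have S: "S \<in> sets borel" using sets_borel_Ioo by auto
        have "(LBINT x:UNIV - S. f x) = integral\<^sup>L lborel f - (LBINT x:S. f x)"
          unfolding set_lebesgue_integral_def
          by (subst Bochner_Integration.integral_diff[symmetric])
             (use f_int S in \<open>auto simp: indicator_def intro!: Bochner_Integration.integral_cong integrable_mult_indicator[unfolded indicator_def]\<close>)
        then show ?case using compl tot by simp
      next
        case (union S)
        then have S: "S i \<in> sets borel" for i using sets_borel_Ioo by auto
        have "(LBINT x:(\<Union>i. S i). f x) = (\<Sum>i. (LBINT x:S i. f x))"
          using union.hyps(1) S
          by (intro lebesgue_integral_countable_add)
             (auto simp: disjoint_family_on_def set_integrable_def intro!: integrable_mult_indicator f_int)
        then show ?case using union by simp
      qed auto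
    qed
    then show ?thesis by eventually_elim (auto simp: f_def)
  qed
  have "AE x in lborel. \<forall>n. \<alpha> + 1 / real (Suc n) < x \<longrightarrow> x < \<alpha> + real (Suc (Suc n)) \<longrightarrow> h x = 0"
    by (subst AE_all_countable, intro allI *) (auto simp: field_simps intro!: add_pos_nonneg)
  then show ?thesis
  proof eventually_elim
    fix x assume x: "\<forall>n. \<alpha> + 1 / real (Suc n) < x \<longrightarrow> x < \<alpha> + real (Suc (Suc n)) \<longrightarrow> h x = 0"
    show "\<alpha> < x \<longrightarrow> h x = 0"
    proof
      assume "\<alpha> < x"
      obtain N :: nat where N: "real N > max (x - \<alpha>) (1 / (x - \<alpha>))" using reals_Archimedean2 by blast
      have "1 / real (Suc N) < x - \<alpha>" "x - \<alpha> < real (Suc (Suc N))"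
        using N \<open>\<alpha> < x\<close> by (auto simp: field_simps)
      with x show "h x = 0" by (auto simp: algebra_simps)
    qed
  qed
qed

text \<open>The derivative is again a test function; the common support is enclosed in an open interval whose
  closure avoids \<open>0\<close>.\<close>

lemma test_function_derivative:
  assumes "\<phi> \<in> Cc_infty {0<..}"
  obtains \<phi>' a b where "0 < a" "a < b" "\<phi>' \<in> Cc_infty {0<..}"
    "\<And>x. 0 < x \<Longrightarrow> (\<phi> has_vector_derivative \<phi>' x) (at x)"
    "\<And>x. 0 < x \<Longrightarrow> x \<notin> {a<..<b} \<Longrightarrow> \<phi> x = 0" "\<And>x. 0 < x \<Longrightarrow> x \<notin> {a<..<b} \<Longrightarrow> \<phi>' x = 0"
proof -
  from assms obtain K where K: "compact K" "K \<subseteq> {0<..}" "\<And>x. 0 < x \<Longrightarrow> x \<notin> K \<Longrightarrow> \<phi> x = 0"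
    and s: "smooth_on {0<..} \<phi>" by (auto simp: Cc_infty_iff)
  obtain a b where ab: "0 < a" "a < b" "K \<subseteq> {a<..<b}"
  proof (cases "K = {}")
    case True
    then show ?thesis using that[of 1 2] by auto
  next
    case False
    then obtain m M where "m \<in> K" "\<And>x. x \<in> K \<Longrightarrow> m \<le> x" "M \<in> K" "\<And>x. x \<in> K \<Longrightarrow> x \<le> M"
      using compact_attains_inf[OF K(1)] compact_attains_sup[OF K(1)] by metis
    then show ?thesis using that[of "m/2" "M+1"] K(2) by fastforce
  qed
  obtain \<phi>' where d: "smooth_on {0<..} \<phi>'" "\<And>x. 0 < x \<Longrightarrow> (\<phi> has_vector_derivative \<phi>' x) (at x within {0<..})"
    using smooth_on_derivative[OF s] by (metis greaterThan_iff)
  have d': "(\<phi> has_vector_derivative \<phi>' x) (at x)" if "0 < x" for x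
    using d(2)[OF that] at_within_open[of x "{0<..}"] that by simp
  have z: "\<phi>' x = 0" if "0 < x" "x \<notin> K" for x
  proof -
    have "(\<phi> has_vector_derivative 0) (at x)"
    proof (rule has_vector_derivative_transform_within_open[of "\<lambda>_. 0" _ _ "{0<..} - K"])
      show "open ({0<..} - K)" using compact_imp_closed[OF K(1)] by auto
    qed (use that K in auto)
    with d'[OF that(1)] show ?thesis using vector_derivative_unique_at by blast
  qed
  have "\<phi>' \<in> Cc_infty {0<..}"
    unfolding Cc_infty_iff using d(1) z K by (intro conjI exI[of _ K]) auto
  with that[of a b \<phi>'] ab d' z K(3) show ?thesis by blast
qed

lemma Cc_infty_continuous: "\<phi> \<in> Cc_infty S \<Longrightarrow> continuous_on S \<phi>"
  by (auto simp: Cc_infty_iff intro: smooth_on_continuous)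

lemma continuous_set_measurable:
  fixes f :: "real \<Rightarrow> 'a::real_normed_vector"
  shows "continuous_on S f \<Longrightarrow> S \<in> sets borel \<Longrightarrow> set_borel_measurable lborel S f"
  by (simp add: set_borel_measurable_def borel_measurable_continuous_on_indicator)

lemma integrable_mult_test:
  assumes h: "locally_integrable h" and \<phi>: "\<phi> \<in> Cc_infty {0<..}"
  shows "set_integrable lborel {0<..} (\<lambda>x. h x * \<phi> x)"
proof -
  obtain \<phi>' a b where ab: "0 < a" "a < b" "\<And>x. 0 < x \<Longrightarrow> x \<notin> {a<..<b} \<Longrightarrow> \<phi> x = 0"
    using test_function_derivative[OF \<phi>] by metis
  have c: "continuous_on {a..b} \<phi>"
    using Cc_infty_continuous[OF \<phi>] ab by (auto elim: continuous_on_subset)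
  then obtain B where "\<And>x. x \<in> {a..b} \<Longrightarrow> norm (\<phi> x) \<le> B"
    using compact_imp_bounded[OF compact_continuous_image[OF c compact_Icc]] unfolding bounded_iff by blast
  then have "set_integrable lborel {a..b} (\<lambda>x. h x * \<phi> x)"
    using locally_integrableD(1)[OF h ab(1)] continuous_set_measurable[OF c]
    by (intro set_integrable_mult_bounded) auto
  moreover have "(\<lambda>x. indicator {a..b} x *\<^sub>R (h x * \<phi> x)) = (\<lambda>x. indicator {0<..} x *\<^sub>R (h x * \<phi> x))"
    using ab(1) ab(3) by (fastforce simp: indicator_def fun_eq_iff)
  ultimately show ?thesis by (simp add: set_integrable_def)
qed

text \<open>The fundamental lemma of the calculus of variations: approximate the indicator of an interval by
  bump functions.\<close>

lemma AE_zero_of_test_functions: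
  assumes h: "locally_integrable h"
    and zero: "\<And>\<phi>. \<phi> \<in> Cc_infty {0<..} \<Longrightarrow> (LBINT x:{0<..}. h x * \<phi> x) = 0"
  shows "AE x in lborel. 0 < x \<longrightarrow> h x = 0"
proof (rule AE_zero_of_interval_integrals)
  fix a b :: real assume ab: "0 < a" "a < b"
  show ab_int: "set_integrable lborel {a..b} h" using h ab by (auto simp: locally_integrable_def)
  let ?\<phi> = "\<lambda>n x. complex_of_real (bump a b n x)"
  have "(\<lambda>n. integral\<^sup>L lborel (\<lambda>x. indicator {0<..} x *\<^sub>R (h x * ?\<phi> n x))) \<longlonglongrightarrow> integral\<^sup>L lborel (\<lambda>x. indicator {a<..<b} x *\<^sub>R h x)"
  proof (rule integral_dominated_convergence)
    show "integrable lborel (\<lambda>x. norm (indicator {a..b} x *\<^sub>R h x))"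
      using ab_int by (intro integrable_norm) (simp add: set_integrable_def)
    show "(\<lambda>x. indicator {a<..<b} x *\<^sub>R h x) \<in> borel_measurable lborel"
      using locally_integrableD(2)[OF h ab(1)] by (auto simp: set_integrable_def)
    show "(\<lambda>x. indicator {0<..} x *\<^sub>R (h x * ?\<phi> n x)) \<in> borel_measurable lborel" for n
      using integrable_mult_test[OF h bump_Cc_infty[OF ab(1)]] by (auto simp: set_integrable_def)
    show "AE x in lborel. (\<lambda>n. indicator {0<..} x *\<^sub>R (h x * ?\<phi> n x)) \<longlonglongrightarrow> indicator {a<..<b} x *\<^sub>R h x"
    proof (rule AE_I2)
      fix x
      have "(\<lambda>n. indicator {0<..} x *\<^sub>R (h x * ?\<phi> n x)) \<longlonglongrightarrow> indicator {0<..} x *\<^sub>R (h x * complex_of_real (indicator {a<..<b} x))"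
        by (intro tendsto_intros bump_tendsto)
      also have "indicator {0<..} x *\<^sub>R (h x * complex_of_real (indicator {a<..<b} x)) = indicator {a<..<b} x *\<^sub>R h x"
        using ab by (auto simp: indicator_def)
      finally show "(\<lambda>n. indicator {0<..} x *\<^sub>R (h x * ?\<phi> n x)) \<longlonglongrightarrow> indicator {a<..<b} x *\<^sub>R h x" .
    qed
    show "AE x in lborel. norm (indicator {0<..} x *\<^sub>R (h x * ?\<phi> n x)) \<le> norm (indicator {a..b} x *\<^sub>R h x)" for n
    proof (rule AE_I2)
      fix x
      show "norm (indicator {0<..} x *\<^sub>R (h x * ?\<phi> n x)) \<le> norm (indicator {a..b} x *\<^sub>R h x)"
        using bump_outside[of x a b n] bump_nonneg[of a b n x] bump_le_1[of a b n x] ab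
        by (cases "x \<in> {a<..<b}") (auto simp: norm_mult mult_left_le)
    qed
  qed
  moreover have "integral\<^sup>L lborel (\<lambda>x. indicator {0<..} x *\<^sub>R (h x * ?\<phi> n x)) = 0" for n
    using zero[OF bump_Cc_infty[OF ab(1)]] by (simp add: set_lebesgue_integral_def)
  ultimately show "(LBINT x:{a<..<b}. h x) = 0"
    by (simp add: set_lebesgue_integral_def LIMSEQ_const_iff)
qed

lemma weak_derivative_unique:
  assumes "has_weak_derivative u g" "has_weak_derivative u g'"
  shows "AE x in lborel. 0 < x \<longrightarrow> g x = g' x"
proof -
  have "AE x in lborel. 0 < x \<longrightarrow> g x - g' x = 0"
  proof (rule AE_zero_of_test_functions)
    show "locally_integrable (\<lambda>x. g x - g' x)"
      using assms by (auto simp: has_weak_derivative_def intro: locally_integrable_diff)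
    fix \<phi> assume \<phi>: "\<phi> \<in> Cc_infty {0<..}"
    have "(LBINT x:{0<..}. (g x - g' x) * \<phi> x) = (LBINT x:{0<..}. g x * \<phi> x) - (LBINT x:{0<..}. g' x * \<phi> x)"
      unfolding left_diff_distrib using assms
      by (intro set_integral_diff integrable_mult_test \<phi>) (auto simp: has_weak_derivative_def)
    also have "\<dots> = 0"
      using assms \<phi> unfolding has_weak_derivative_def by (metis (no_types, lifting) add.inverse_inverse cancel_comm_monoid_add_class.diff_cancel)
    finally show "(LBINT x:{0<..}. (g x - g' x) * \<phi> x) = 0" .
  qed
  then show ?thesis by eventually_elim auto
qed

text \<open>Local absolute continuity on the half line, written as an integral identity.\<close>

definition is_primitive :: "(real \<Rightarrow> complex) \<Rightarrow> (real \<Rightarrow> complex) \<Rightarrow> bool" where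
  "is_primitive u g \<longleftrightarrow> locally_integrable g \<and>
     (\<forall>a b. 0 < a \<longrightarrow> a < b \<longrightarrow> u b - u a = (LBINT t:{a<..<b}. g t))"

lemma set_integral_Ioo_split:
  assumes "locally_integrable g" "0 < a" "a < m" "m < b"
  shows "(LBINT t:{a<..<b}. g t) = (LBINT t:{a<..<m}. g t) + (LBINT t:{m<..<b}. g t)"
proof -
  have i: "set_integrable lborel {x..y} g" if "0 < x" for x y
    using assms(1) that by (rule locally_integrableD)
  have "integral {a..m} g + integral {m..b} g = integral {a..b} g"
    using assms by (intro Henstock_Kurzweil_Integration.integral_combine set_borel_integral_eq_integral i) auto
  then show ?thesis using assms by (simp add: set_integral_Ioo(1) i)
qed

lemma primitive_exists:
  assumes "locally_integrable g"
  obtains u where "is_primitive u g"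
proof -
  define u where "u y = (LBINT t:{1<..<y}. g t) - (LBINT t:{y<..<1}. g t)" for y
  have "u b - u a = (LBINT t:{a<..<b}. g t)" if "0 < a" "a < b" for a b
    using set_integral_Ioo_split[OF assms, of a 1 b] set_integral_Ioo_split[OF assms, of a b 1]
      set_integral_Ioo_split[OF assms, of 1 a b] that
    unfolding u_def by (cases a "1::real" rule: linorder_cases; cases b "1::real" rule: linorder_cases) auto
  with assms show ?thesis by (intro that[of u]) (auto simp: is_primitive_def)
qed

lemma primitive_eq:
  assumes "is_primitive u g" "0 < a" "a \<le> x"
  shows "u x = u a + integral {a..x} g"
proof (cases "a = x")
  case False
  with assms have "u x - u a = (LBINT t:{a<..<x}. g t)" unfolding is_primitive_def by auto
  also have "\<dots> = integral {a..x} g"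
    using assms by (intro set_integral_Ioo locally_integrableD) (auto simp: is_primitive_def)
  finally show ?thesis by (simp add: algebra_simps)
qed simp

lemma primitive_continuous:
  assumes "is_primitive u g"
  shows "continuous_on {0<..} u"
proof -
  have "isCont u x" if "0 < x" for x
  proof -
    have "continuous_on {x/2..2*x} (\<lambda>y. u (x/2) + integral {x/2..y} g)"
      using assms that
      by (intro continuous_intros indefinite_integral_continuous_1 set_borel_integral_eq_integral locally_integrableD)
         (auto simp: is_primitive_def)
    then have "continuous_on {x/2..2*x} u"
      using that assms by (subst continuous_on_cong[OF refl primitive_eq]) auto
    then show ?thesis using that
      by (intro continuous_on_interior[of "{x/2..2*x}"]) auto
  qed
  then show ?thesis by (intro continuous_at_imp_continuous_on) auto
qed

lemma primitive_has_derivative: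
  assumes "is_primitive u g" "continuous_on {0<..} g" "0 < x"
  shows "(u has_vector_derivative g x) (at x)"
proof -
  have "((\<lambda>y. integral {x/2..y} g) has_vector_derivative g x) (at x within {x/2..2*x})"
    using assms by (intro integral_has_vector_derivative) (auto elim: continuous_on_subset)
  then have "((\<lambda>y. u (x/2) + integral {x/2..y} g) has_vector_derivative g x) (at x within {x/2..2*x})"
    using has_vector_derivative_add[OF has_vector_derivative_const] by fastforce
  then have "((\<lambda>y. u (x/2) + integral {x/2..y} g) has_vector_derivative g x) (at x)"
    using assms at_within_interior[of x "{x/2..2*x}"] by simp
  then show ?thesis
  proof (rule has_vector_derivative_transform_within_open[of _ _ _ "{x/2<..}"])
    show "u (x/2) + integral {x/2..y} g = u y" if "y \<in> {x/2<..}" for y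
      using primitive_eq[OF assms(1), of "x/2" y] assms(3) that by simp
  qed (use assms in auto)
qed

lemma primitiveI:
  assumes "continuous_on {0<..} u" "locally_integrable g" "finite S"
    and "\<And>x. 0 < x \<Longrightarrow> x \<notin> S \<Longrightarrow> (u has_vector_derivative g x) (at x)"
  shows "is_primitive u g"
  unfolding is_primitive_def
proof (intro conjI allI impI)
  fix a b :: real assume ab: "0 < a" "a < b"
  have "(g has_integral u b - u a) {a..b}"
    using assms ab by (intro fundamental_theorem_of_calculus_interior_strong[of S]) (auto elim: continuous_on_subset)
  then show "u b - u a = (LBINT t:{a<..<b}. g t)"
    using set_integral_Ioo(1)[OF locally_integrableD(1)[OF assms(2) ab(1)]] by (simp add: integral_unique)
qed fact

text \<open>Both sides are iterated integrals of \<open>p(t) w(s)\<close> over the triangle \<open>0 < t < s < R\<close>.  The last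
  hypothesis is the absolute convergence that Fubini's theorem needs; it admits functions \<open>w\<close> that are
  not integrable at \<open>0\<close>, provided that the integral of \<open>\<bar>p\<bar>\<close> from \<open>0\<close> is small there.\<close>

lemma primitive_by_parts:
  fixes p v w :: "real \<Rightarrow> complex"
  assumes p: "set_integrable lborel {0<..<R} p" "(LBINT t:{0<..<R}. p t) = 0"
    and v: "is_primitive v w"
    and dom: "set_integrable lborel {0<..<R} (\<lambda>s. (LBINT t:{0<..<s}. norm (p t)) * norm (w s))"
  shows "(LBINT s:{0<..<R}. (LBINT t:{0<..<s}. p t) * w s) = - (LBINT t:{0<..<R}. p t * v t)"
proof -
  define P where "P t = indicator {0<..<R} t *\<^sub>R p t" for t
  define W where "W t = indicator {0<..<R} t *\<^sub>R w t" for t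
  define F where "F s t = (if t < s then P t * W s else 0)" for s t
  have P: "integrable lborel P" using p by (simp add: P_def[abs_def] set_integrable_def)
  have [measurable]: "P \<in> borel_measurable lborel" using P by auto
  have [measurable]: "W \<in> borel_measurable lborel"
    using locally_integrable_measurable_Ioo[of w 0 R] v
    by (auto simp: W_def[abs_def] is_primitive_def set_borel_measurable_def)
  have indPS: "indicator {0<..<s} t *\<^sub>R p t = (if t < s then P t else 0)" if "s \<in> {0<..<R}" for s t
    using that by (auto simp: P_def indicator_def)
  have Fint: "integrable (lborel \<Otimes>\<^sub>M lborel) (case_prod F)"
  proof (rule lborel_pair.Fubini_integrable)
    show "case_prod F \<in> borel_measurable (lborel \<Otimes>\<^sub>M lborel)"
      unfolding F_def[abs_def] by measurable
    have "(\<lambda>s. LINT t|lborel. norm (case (s, t) of (s, t) \<Rightarrow> F s t)) =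
       (\<lambda>s. indicator {0<..<R} s *\<^sub>R ((LBINT t:{0<..<s}. norm (p t)) * norm (w s)))"
    proof
      fix s
      have "norm (F s t) = indicator {0<..<R} s *\<^sub>R (indicator {0<..<s} t *\<^sub>R norm (p t)) * norm (w s)" for t
        by (auto simp: F_def P_def W_def indicator_def norm_mult)
      then show "(LINT t|lborel. norm (case (s, t) of (s, t) \<Rightarrow> F s t)) =
         indicator {0<..<R} s *\<^sub>R ((LBINT t:{0<..<s}. norm (p t)) * norm (w s))"
        by (simp add: set_lebesgue_integral_def)
    qed
    then show "integrable lborel (\<lambda>s. LINT t|lborel. norm (case (s, t) of (s, t) \<Rightarrow> F s t))"
      using dom by (simp add: set_integrable_def)
    show "AE s in lborel. integrable lborel (\<lambda>t. case (s, t) of (s, t) \<Rightarrow> F s t)"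
    proof (rule AE_I2)
      fix s
      have "integrable lborel (\<lambda>t. indicator {..<s} t *\<^sub>R P t * W s)"
        by (intro integrable_mult_left integrable_mult_indicator P) auto
      moreover have "(\<lambda>t. indicator {..<s} t *\<^sub>R P t * W s) = F s"
        by (auto simp: F_def indicator_def)
      ultimately show "integrable lborel (\<lambda>t. case (s, t) of (s, t) \<Rightarrow> F s t)" by simp
    qed
  qed
  have inner1: "(LINT t|lborel. F s t) = indicator {0<..<R} s *\<^sub>R ((LBINT t:{0<..<s}. p t) * w s)" for s
  proof (cases "s \<in> {0<..<R}")
    case True
    have "(LINT t|lborel. F s t) = (LINT t|lborel. (indicator {0<..<s} t *\<^sub>R p t) * W s)"
      unfolding indPS[OF True] by (intro Bochner_Integration.integral_cong) (auto simp: F_def)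
    also have "\<dots> = (LBINT t:{0<..<s}. p t) * W s"
      unfolding set_lebesgue_integral_def by (rule integral_mult_left_zero)
    finally show ?thesis using True by (simp add: W_def)
  next
    case False
    then have "F s = (\<lambda>_. 0)" by (auto simp: F_def W_def)
    with False show ?thesis by simp
  qed
  have inner2: "(LINT s|lborel. F s t) = indicator {0<..<R} t *\<^sub>R (p t * (v R - v t))" for t
  proof (cases "t \<in> {0<..<R}")
    case True
    have "(LINT s|lborel. F s t) = (LINT s|lborel. p t * (indicator {t<..<R} s *\<^sub>R w s))"
      using True by (intro Bochner_Integration.integral_cong) (auto simp: F_def P_def W_def indicator_def)
    also have "\<dots> = p t * (LBINT s:{t<..<R}. w s)"
      unfolding set_lebesgue_integral_def by (rule integral_mult_right_zero)
    also have "(LBINT s:{t<..<R}. w s) = v R - v t"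
      using v True by (simp add: is_primitive_def)
    finally show ?thesis using True by simp
  next
    case False
    then have "(\<lambda>s. F s t) = (\<lambda>_. 0)" by (auto simp: F_def P_def)
    with False show ?thesis by simp
  qed
  have i2: "set_integrable lborel {0<..<R} (\<lambda>t. p t * (v R - v t))"
    using lborel_pair.integrable_snd[OF Fint] by (simp add: set_integrable_def inner2)
  have i3: "set_integrable lborel {0<..<R} (\<lambda>t. p t * v R)"
    by (intro set_integrable_mult_left p)
  have "set_integrable lborel {0<..<R} (\<lambda>t. p t * v R - p t * (v R - v t))"
    by (intro set_integral_diff i2 i3)
  then have i4: "set_integrable lborel {0<..<R} (\<lambda>t. p t * v t)"
    by (simp add: algebra_simps)
  have "(LBINT s:{0<..<R}. (LBINT t:{0<..<s}. p t) * w s) = (LBINT s. LBINT t. F s t)"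
    by (simp add: set_lebesgue_integral_def[of _ _ "\<lambda>s. (LBINT t:{0<..<s}. p t) * w s"] inner1)
  also have "\<dots> = (LBINT t. LBINT s. F s t)"
    using lborel_pair.Fubini_integral[OF Fint] by simp
  also have "\<dots> = (LBINT t:{0<..<R}. p t * v R - p t * v t)"
    by (simp add: set_lebesgue_integral_def inner2 right_diff_distrib)
  also have "\<dots> = (LBINT t:{0<..<R}. p t * v R) - (LBINT t:{0<..<R}. p t * v t)"
    by (rule set_integral_diff(2)[OF i3 i4])
  finally show ?thesis using p(2) by simp
qed

section \<open>Weak derivatives and primitives\<close>

lemma set_integral_FTC:
  fixes f :: "real \<Rightarrow> complex"
  assumes "a \<le> b" "\<And>x. a \<le> x \<Longrightarrow> x \<le> b \<Longrightarrow> (f has_vector_derivative f' x) (at x)"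
    "continuous_on {a..b} f'"
  shows "(LBINT x:{a<..<b}. f' x) = f b - f a"
proof -
  have "set_integrable lborel {a..b} f'"
    unfolding set_integrable_def by (rule borel_integrable_compact) (use assms in auto)
  then have "(LBINT x:{a<..<b}. f' x) = integral {a..b} f'" by (rule set_integral_Ioo)
  also have "\<dots> = f b - f a"
    using assms by (intro integral_unique fundamental_theorem_of_calculus)
      (auto intro: has_vector_derivative_at_within)
  finally show ?thesis .
qed

lemma set_integral_vanishing_near_0:
  fixes f :: "real \<Rightarrow> 'a :: {banach, second_countable_topology}"
  assumes "\<And>x. 0 < x \<Longrightarrow> x < a \<Longrightarrow> f x = 0" "0 < a"
  shows "(LBINT x:{0<..<s}. f x) = (LBINT x:{a/2<..<s}. f x)"
  unfolding set_lebesgue_integral_def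
proof (rule Bochner_Integration.integral_cong)
  fix x show "indicator {0<..<s} x *\<^sub>R f x = indicator {a/2<..<s} x *\<^sub>R f x"
    using assms by (cases "0 < x \<and> x \<le> a / 2") (auto simp: indicator_def)
qed simp

lemma primitive_imp_weak_derivative:
  assumes "is_primitive u g"
  shows "has_weak_derivative u g"
  unfolding has_weak_derivative_def
proof (intro conjI ballI)
  have g: "locally_integrable g" using assms by (simp add: is_primitive_def)
  then show "locally_integrable g" .
  show "locally_integrable u"
    by (rule locally_integrable_continuous[OF primitive_continuous[OF assms]])
  fix \<phi> assume \<phi>: "\<phi> \<in> Cc_infty {0<..}"
  obtain \<phi>' a b where ab: "0 < a" "a < b" and "\<phi>' \<in> Cc_infty {0<..}"
    and d: "\<And>x. 0 < x \<Longrightarrow> (\<phi> has_vector_derivative \<phi>' x) (at x)"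
    and z: "\<And>x. 0 < x \<Longrightarrow> x \<notin> {a<..<b} \<Longrightarrow> \<phi> x = 0" "\<And>x. 0 < x \<Longrightarrow> x \<notin> {a<..<b} \<Longrightarrow> \<phi>' x = 0"
    by (rule test_function_derivative[OF \<phi>]) (rule that; assumption)
  then have c': "continuous_on {0<..} \<phi>'" by (intro Cc_infty_continuous)
  have ci: "continuous_on {x..y} \<phi>'" if "0 < x" for x y
    using c' by (rule continuous_on_subset) (use that in auto)
  have fi: "(LBINT t:{0<..<s}. \<phi>' t) = \<phi> s" if "0 < s" for s
  proof (cases "s < a")
    case True
    then have "(LBINT t:{0<..<s}. \<phi>' t) = (LBINT t:{0<..<s}. 0)"
      unfolding set_lebesgue_integral_def
      by (intro Bochner_Integration.integral_cong) (use z in \<open>auto simp: indicator_def\<close>)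
    with True that z show ?thesis by (simp add: set_lebesgue_integral_def)
  next
    case False
    have "(LBINT t:{0<..<s}. \<phi>' t) = (LBINT t:{a/2<..<s}. \<phi>' t)"
      by (rule set_integral_vanishing_near_0) (use z ab in auto)
    also have "\<dots> = \<phi> s - \<phi> (a/2)"
      by (intro set_integral_FTC d ci) (use False ab in auto)
    finally show ?thesis using z ab by simp
  qed
  obtain B where B: "\<And>x. x \<in> {a..b} \<Longrightarrow> norm (\<phi>' x) \<le> B"
    using compact_imp_bounded[OF compact_continuous_image[OF ci[OF ab(1)] compact_Icc]] unfolding bounded_iff by blast
  have B': "norm (\<phi>' x) \<le> \<bar>B\<bar>" if "0 < x" for x
    using B[of x] z(2)[OF that] by (cases "x \<in> {a..b}") (auto intro: order_trans[OF _ abs_ge_self])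
  define R where "R = b + 1"
  have bi: "set_integrable lborel {0<..<s} (\<lambda>t. norm (\<phi>' t))" for s
  proof -
    have "set_integrable lborel {0<..<s} \<phi>'"
    proof -
      have "set_integrable lborel {0<..} (\<lambda>x. 1 * \<phi>' x)"
        by (intro integrable_mult_test locally_integrable_continuous continuous_intros) fact
      then show ?thesis by (auto elim: set_integrable_subset)
    qed
    then show ?thesis by (rule set_integrable_norm)
  qed
  define N where "N s = (LBINT t:{0<..<s}. norm (\<phi>' t))" for s
  have N_mono: "N s \<le> N s'" if "s \<le> s'" for s s'
    unfolding N_def set_lebesgue_integral_def
    by (intro integral_mono bi[unfolded set_integrable_def]) (use that in \<open>auto simp: indicator_def\<close>)
  have N0: "N s = 0" if "s < a" for s
  proof -
    have "N s = (LBINT t:{0<..<s}. 0)"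
      unfolding N_def set_lebesgue_integral_def
      by (intro Bochner_Integration.integral_cong) (use z that in \<open>auto simp: indicator_def\<close>)
    then show ?thesis by simp
  qed
  have "(LBINT s:{0<..<R}. (LBINT t:{0<..<s}. \<phi>' t) * g s) = - (LBINT t:{0<..<R}. \<phi>' t * u t)"
  proof (rule primitive_by_parts[OF _ _ assms])
    show "set_integrable lborel {0<..<R} \<phi>'"
      using integrable_mult_test[OF locally_integrable_continuous \<open>\<phi>' \<in> _\<close>, of "\<lambda>_. 1"]
      by (auto elim: set_integrable_subset)
    show "(LBINT t:{0<..<R}. \<phi>' t) = 0"
      using fi[of R] z(1)[of R] ab by (simp add: R_def)
    show "set_integrable lborel {0<..<R} (\<lambda>s. (LBINT t:{0<..<s}. norm (\<phi>' t)) * norm (g s))"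
      unfolding N_def[symmetric] set_integrable_def
    proof (rule Bochner_Integration.integrable_bound)
      show "integrable lborel (\<lambda>x. N R * norm (indicator {a..R} x *\<^sub>R g x))"
        using locally_integrableD(1)[OF g ab(1), of R]
        by (intro integrable_mult_right integrable_norm) (simp add: set_integrable_def)
      have "mono N" using N_mono by (auto intro: monoI)
      then have [measurable]: "N \<in> borel_measurable borel" by (rule borel_measurable_mono)
      have [measurable]: "(\<lambda>x. indicator {0<..<R} x *\<^sub>R g x) \<in> borel_measurable borel"
        using locally_integrable_measurable_Ioo[OF g, of 0 R]
        by (auto simp: set_borel_measurable_def)
      have "(\<lambda>x. N x * norm (indicator {0<..<R} x *\<^sub>R g x)) \<in> borel_measurable lborel"
        by measurable
      then show "(\<lambda>x. indicator {0<..<R} x *\<^sub>R (N x * norm (g x))) \<in> borel_measurable lborel"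
        by (simp add: mult_ac)
      show "AE x in lborel. norm (indicator {0<..<R} x *\<^sub>R (N x * norm (g x)))
            \<le> norm (N R * norm (indicator {a..R} x *\<^sub>R g x))"
      proof (rule AE_I2)
        fix x
        have "N x \<ge> 0" "N R \<ge> 0" by (auto simp: N_def set_lebesgue_integral_def intro!: integral_nonneg_AE)
        then show "norm (indicator {0<..<R} x *\<^sub>R (N x * norm (g x))) \<le> norm (N R * norm (indicator {a..R} x *\<^sub>R g x))"
          using N_mono[of x R] N0[of x] by (auto simp: indicator_def abs_mult intro!: mult_right_mono)
      qed
    qed
  qed
  moreover have "(LBINT s:{0<..<R}. (LBINT t:{0<..<s}. \<phi>' t) * g s) = (LBINT s:{0<..}. g s * \<phi> s)"
    unfolding set_lebesgue_integral_def[of _ _ "\<lambda>s. (LBINT t:{0<..<s}. \<phi>' t) * g s"]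
      set_lebesgue_integral_def[of _ _ "\<lambda>s. g s * \<phi> s"]
    by (intro Bochner_Integration.integral_cong) (use fi z(1) in \<open>auto simp: indicator_def R_def\<close>)
  moreover have "(LBINT t:{0<..<R}. \<phi>' t * u t) = (LBINT x:{0<..}. u x * vector_derivative \<phi> (at x))"
    unfolding set_lebesgue_integral_def
    by (intro Bochner_Integration.integral_cong)
       (use vector_derivative_at[OF d] z(2) in \<open>auto simp: indicator_def R_def\<close>)
  ultimately show "(LBINT x:{0<..}. u x * vector_derivative \<phi> (at x)) = - (LBINT x:{0<..}. g x * \<phi> x)"
    by simp
qed

text \<open>The primitive that vanishes near \<open>0\<close> is constant beyond the support of \<open>q\<close>, and this constant is the integral of
  \<open>q\<close>.  This identifies the derivatives of test functions, and later it integrates the source of a core function.\<close>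

lemma Cc_infty_antiderivative:
  assumes q: "q \<in> Cc_infty {0<..}" and zero: "(LBINT x:{0<..}. q x) = 0"
  shows "(\<lambda>y. LBINT t:{0<..<y}. q t) \<in> Cc_infty {0<..}"
    and "\<And>x. 0 < x \<Longrightarrow> ((\<lambda>y. LBINT t:{0<..<y}. q t) has_vector_derivative q x) (at x)"
proof -
  obtain a b where ab: "0 < a" "a < b" and z: "\<And>x. 0 < x \<Longrightarrow> x \<notin> {a<..<b} \<Longrightarrow> q x = 0"
    by (rule test_function_derivative[OF q]) (rule that; assumption)
  have c: "continuous_on {0<..} q" using q by (rule Cc_infty_continuous)
  let ?\<phi> = "\<lambda>y. LBINT t:{0<..<y}. q t"
  have \<phi>a: "?\<phi> y = 0" if "y \<le> a" for y
  proof -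
    have "?\<phi> y = (LBINT t:{0<..<y}. 0)"
      unfolding set_lebesgue_integral_def
      by (intro Bochner_Integration.integral_cong) (use z that in \<open>auto simp: indicator_def\<close>)
    then show ?thesis by simp
  qed
  have \<phi>b: "?\<phi> y = 0" if "b \<le> y" for y
  proof -
    have "indicator {0<..<y} x *\<^sub>R q x = indicator {0<..} x *\<^sub>R q x" for x
      using z[of x] that by (cases "0 < x \<and> x < b") (auto simp: indicator_def)
    then have "?\<phi> y = (LBINT t:{0<..}. q t)"
      unfolding set_lebesgue_integral_def by (simp only:)
    then show ?thesis using zero by simp
  qed
  obtain v where v: "is_primitive v q"
    using primitive_exists[OF locally_integrable_continuous[OF c]] .
  have \<phi>v: "?\<phi> y = v y - v (a/2)" if "y > a/2" for y
  proof -
    have "?\<phi> y = (LBINT t:{a/2<..<y}. q t)"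
      by (rule set_integral_vanishing_near_0) (use z ab in auto)
    then show ?thesis using v ab that by (simp add: is_primitive_def)
  qed
  show d: "(?\<phi> has_vector_derivative q x) (at x)" if "0 < x" for x
  proof (cases "x < a")
    case True
    have "(?\<phi> has_vector_derivative 0) (at x)"
      by (rule has_vector_derivative_transform_within_open[of "\<lambda>_. 0" _ _ "{..<a}"]) (use True \<phi>a in auto)
    then show ?thesis using z[of x] True that by simp
  next
    case False
    have "((\<lambda>y. v y - v (a/2)) has_vector_derivative q x) (at x)"
      using has_vector_derivative_diff[OF primitive_has_derivative[OF v c that] has_vector_derivative_const] by simp
    then show ?thesis
      by (rule has_vector_derivative_transform_within_open[of _ _ _ "{a/2<..}"])
         (use False ab \<phi>v in auto)
  qed
  show "?\<phi> \<in> Cc_infty {0<..}"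
    unfolding Cc_infty_iff
  proof (intro conjI exI[of _ "{a..b}"])
    show "smooth_on {0<..} ?\<phi>"
      by (rule smooth_on_primitive[of _ q]) (use q d in \<open>auto simp: Cc_infty_iff intro: has_vector_derivative_at_within\<close>)
  qed (use \<phi>a \<phi>b ab in auto)
qed

lemma Cc_infty_diff_cmult:
  assumes f: "f \<in> Cc_infty S" and g: "g \<in> Cc_infty S"
  shows "(\<lambda>x. f x - k * g x) \<in> Cc_infty S"
proof -
  from f obtain K where K: "compact K" "K \<subseteq> S" "\<forall>x\<in>S - K. f x = 0" and fs: "smooth_on S f"
    by (auto simp: Cc_infty_iff)
  from g obtain L where L: "compact L" "L \<subseteq> S" "\<forall>x\<in>S - L. g x = 0" and gs: "smooth_on S g"
    by (auto simp: Cc_infty_iff)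
  show ?thesis
    unfolding Cc_infty_iff
    using K L fs gs by (intro conjI smooth_on_diff smooth_on_cmult exI[of _ "K \<union> L"]) auto
qed

lemma Cc_infty_mult_smooth:
  assumes "smooth_on S f" "g \<in> Cc_infty S"
  shows "(\<lambda>x. f x * g x) \<in> Cc_infty S"
proof -
  from assms obtain K where "compact K" "K \<subseteq> S" "\<forall>x\<in>S - K. g x = 0" "smooth_on S g"
    by (auto simp: Cc_infty_iff)
  with assms(1) show ?thesis unfolding Cc_infty_iff by (intro conjI smooth_on_mult exI[of _ K]) auto
qed

lemma bump_integral_nonzero:
  assumes "0 < a" "a < b"
  shows "(LBINT x:{0<..}. complex_of_real (bump a b n x)) \<noteq> 0"
proof
  assume "(LBINT x:{0<..}. complex_of_real (bump a b n x)) = 0"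
  then have "complex_of_real (LBINT x:{0<..}. bump a b n x) = 0"
    by (simp only: set_integral_complex_of_real)
  then have zero: "(LBINT x:{0<..}. bump a b n x) = 0" by simp
  have "set_integrable lborel {0<..} (\<lambda>x. 1 * complex_of_real (bump a b n x))"
    by (intro integrable_mult_test bump_Cc_infty assms locally_integrable_continuous continuous_intros)
  then have "integrable lborel (\<lambda>x. Re (indicator {0<..} x *\<^sub>R (1 * complex_of_real (bump a b n x))))"
    unfolding set_integrable_def by (rule integrable_Re)
  then have "set_integrable lborel {0<..} (bump a b n)"
    by (simp add: set_integrable_def)
  then have "AE x in lborel. indicator {0<..} x *\<^sub>R bump a b n x = 0"
    using zero unfolding set_lebesgue_integral_def set_integrable_def
    by (subst (asm) integral_nonneg_eq_0_iff_AE) (auto simp: bump_nonneg indicator_def)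
  then have "AE x in lborel. x \<notin> {a<..<b}"
    by eventually_elim (use assms bump_pos[of _ a b n] in \<open>force simp: indicator_def\<close>)
  then have "emeasure lborel {a<..<b} = 0"
    by (subst (asm) AE_iff_measurable[of "{a<..<b}"]) auto
  with assms show False by simp
qed

text \<open>The lemma of du Bois-Reymond.  If \<open>G\<close> is a primitive of \<open>g\<close>, then \<open>u - G\<close> is orthogonal to the
  derivatives of test functions, that is, to all test functions with integral zero.  Subtracting from a
  test function a multiple of a fixed one with nonzero integral shows that \<open>u - G\<close> is constant.\<close>

theorem weak_derivative_imp_primitive:
  assumes "has_weak_derivative u g"
  obtains v where "is_primitive v g" "AE x in lborel. 0 < x \<longrightarrow> u x = v x"
proof -
  have ug: "locally_integrable u" "locally_integrable g"
    using assms by (auto simp: has_weak_derivative_def)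
  obtain G where G: "is_primitive G g" using primitive_exists[OF ug(2)] .
  have Gw: "has_weak_derivative G g" by (rule primitive_imp_weak_derivative[OF G])
  define h where "h x = u x - G x" for x
  have h: "locally_integrable h"
    unfolding h_def using Gw ug by (auto simp: has_weak_derivative_def intro: locally_integrable_diff)
  have h_der: "(LBINT x:{0<..}. h x * q x) = 0" if q: "q \<in> Cc_infty {0<..}" "(LBINT x:{0<..}. q x) = 0" for q
  proof -
    define \<phi> where "\<phi> = (\<lambda>y. LBINT t:{0<..<y}. q t)"
    have \<phi>: "\<phi> \<in> Cc_infty {0<..}" "\<And>x. 0 < x \<Longrightarrow> (\<phi> has_vector_derivative q x) (at x)"
      unfolding \<phi>_def using Cc_infty_antiderivative[OF q] by auto
    have w: "(LBINT x:{0<..}. f x * q x) = - (LBINT x:{0<..}. g x * \<phi> x)" if "has_weak_derivative f g" for f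
    proof -
      have "(LBINT x:{0<..}. f x * q x) = (LBINT x:{0<..}. f x * vector_derivative \<phi> (at x))"
        by (intro set_lebesgue_integral_cong) (auto simp: vector_derivative_at[OF \<phi>(2)])
      then show ?thesis using that \<phi>(1) by (simp add: has_weak_derivative_def)
    qed
    have "(LBINT x:{0<..}. h x * q x) = (LBINT x:{0<..}. u x * q x) - (LBINT x:{0<..}. G x * q x)"
      unfolding h_def left_diff_distrib
      by (intro set_integral_diff integrable_mult_test q ug) (use Gw in \<open>simp add: has_weak_derivative_def\<close>)
    with w[OF assms] w[OF Gw] show ?thesis by simp
  qed
  define \<beta> where "\<beta> x = complex_of_real (bump 1 2 0 x)" for x
  have \<beta>: "\<beta> \<in> Cc_infty {0<..}" unfolding \<beta>_def by (rule bump_Cc_infty) simp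
  define I where "I = (LBINT x:{0<..}. \<beta> x)"
  have I: "I \<noteq> 0" unfolding I_def \<beta>_def by (rule bump_integral_nonzero) auto
  define C where "C = (LBINT x:{0<..}. h x * \<beta> x) / I"
  have ti: "set_integrable lborel {0<..} \<psi>" if "\<psi> \<in> Cc_infty {0<..}" for \<psi>
    using integrable_mult_test[OF locally_integrable_continuous that, of "\<lambda>_. 1"] by simp
  have "AE x in lborel. 0 < x \<longrightarrow> h x - C = 0"
  proof (rule AE_zero_of_test_functions)
    show "locally_integrable (\<lambda>x. h x - C)"
      by (intro locally_integrable_diff h locally_integrable_continuous continuous_intros)
    fix \<psi> assume \<psi>: "\<psi> \<in> Cc_infty {0<..}"
    define m where "m = (LBINT x:{0<..}. \<psi> x)"
    have q: "(\<lambda>x. \<psi> x - (m / I) * \<beta> x) \<in> Cc_infty {0<..}" by (rule Cc_infty_diff_cmult[OF \<psi> \<beta>])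
    have "(LBINT x:{0<..}. \<psi> x - (m / I) * \<beta> x) = m - (m / I) * I"
      by (subst set_integral_diff(2)[OF ti[OF \<psi>] set_integrable_mult_right[OF ti[OF \<beta>]]])
         (simp add: m_def I_def)
    also have "\<dots> = 0" using I by simp
    finally have "(LBINT x:{0<..}. h x * (\<psi> x - (m / I) * \<beta> x)) = 0" by (rule h_der[OF q])
    moreover have "(LBINT x:{0<..}. h x * (\<psi> x - (m / I) * \<beta> x)) =
      (LBINT x:{0<..}. h x * \<psi> x) - (LBINT x:{0<..}. (m / I) * (h x * \<beta> x))"
      by (subst set_integral_diff(2)[OF integrable_mult_test[OF h \<psi>]
            set_integrable_mult_right[OF integrable_mult_test[OF h \<beta>]], symmetric])
         (simp add: algebra_simps)
    ultimately have "(LBINT x:{0<..}. h x * \<psi> x) = m * C" by (simp add: C_def)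
    moreover have "(LBINT x:{0<..}. (h x - C) * \<psi> x) = (LBINT x:{0<..}. h x * \<psi> x) - (LBINT x:{0<..}. C * \<psi> x)"
      unfolding left_diff_distrib by (intro set_integral_diff integrable_mult_test h \<psi> set_integrable_mult_right ti)
    ultimately show "(LBINT x:{0<..}. (h x - C) * \<psi> x) = 0" by (simp add: m_def)
  qed
  then have "AE x in lborel. 0 < x \<longrightarrow> u x = G x + C"
    by eventually_elim (auto simp: h_def algebra_simps)
  moreover have "is_primitive (\<lambda>x. G x + C) g" using G by (simp add: is_primitive_def)
  ultimately show ?thesis using that by blast
qed

section \<open>The weighted space of square integrable functions\<close>

lemma space_weighted [simp]: "space (weighted c) = {0<..}"
  by (simp add: weighted_def space_restrict_space)

lemma measurable_weighted_cong: "measurable (weighted c) N = measurable (restrict_space lborel {0<..}) N"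
  unfolding weighted_def by (intro measurable_cong_sets) simp_all

lemma borel_measurable_weighted:
  fixes f :: "real \<Rightarrow> 'b::real_normed_vector"
  shows "f \<in> borel_measurable (weighted c) \<longleftrightarrow> set_borel_measurable lborel {0<..} f"
  by (simp add: measurable_weighted_cong borel_measurable_restrict_space_iff set_borel_measurable_def)

lemma measurable_weightedI:
  "f \<in> borel_measurable borel \<Longrightarrow> f \<in> borel_measurable (weighted c)"
  unfolding measurable_weighted_cong by (rule measurable_restrict_space1) simp

lemma measurable_weighted_continuous:
  fixes f :: "real \<Rightarrow> 'b::real_normed_vector"
  shows "continuous_on {0<..} f \<Longrightarrow> f \<in> borel_measurable (weighted c)"
  unfolding borel_measurable_weighted by (rule continuous_set_measurable) auto

lemma AE_weighted: "(AE y in weighted c. P y) \<longleftrightarrow> (AE y in lborel. 0 < y \<longrightarrow> P y)"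
proof -
  have "(AE y in weighted c. P y) \<longleftrightarrow> (AE y in restrict_space lborel {0<..}. 0 < ennreal (y powr c) \<longrightarrow> P y)"
    unfolding weighted_def by (rule AE_density, rule measurable_restrict_space1) simp
  also have "\<dots> \<longleftrightarrow> (AE y in lborel. 0 < y \<longrightarrow> 0 < ennreal (y powr c) \<longrightarrow> P y)"
    by (subst AE_restrict_space_iff) simp_all
  also have "\<dots> \<longleftrightarrow> (AE y in lborel. 0 < y \<longrightarrow> P y)"
    by (rule AE_cong) auto
  finally show ?thesis .
qed

lemma integral_weighted_if_measurable:
  fixes f :: "real \<Rightarrow> 'b::{banach, second_countable_topology}"
  assumes "f \<in> borel_measurable (weighted c)"
  shows "integrable (weighted c) f \<longleftrightarrow> set_integrable lborel {0<..} (\<lambda>y. y powr c *\<^sub>R f y)"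
    and "integral\<^sup>L (weighted c) f = (LBINT y:{0<..}. y powr c *\<^sub>R f y)"
proof -
  have f: "f \<in> borel_measurable (restrict_space lborel {0<..})" using assms by (simp only: measurable_weighted_cong)
  have p: "(\<lambda>y. y powr c) \<in> borel_measurable (restrict_space lborel {0<..})"
    by (rule measurable_restrict_space1) simp
  show "integrable (weighted c) f \<longleftrightarrow> set_integrable lborel {0<..} (\<lambda>y. y powr c *\<^sub>R f y)"
    unfolding weighted_def by (subst integrable_density[OF f p]) (auto simp: integrable_restrict_space set_integrable_def)
  show "integral\<^sup>L (weighted c) f = (LBINT y:{0<..}. y powr c *\<^sub>R f y)"
    unfolding weighted_def by (subst integral_density[OF f p]) (auto simp: integral_restrict_space set_lebesgue_integral_def)
qed

lemma integrable_weighted: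
  fixes f :: "real \<Rightarrow> 'b::{banach, second_countable_topology}"
  shows "integrable (weighted c) f \<longleftrightarrow> set_integrable lborel {0<..} (\<lambda>y. y powr c *\<^sub>R f y)"
proof
  assume "integrable (weighted c) f"
  then show "set_integrable lborel {0<..} (\<lambda>y. y powr c *\<^sub>R f y)"
    using integral_weighted_if_measurable(1)[of f c] borel_measurable_integrable by blast
next
  assume r: "set_integrable lborel {0<..} (\<lambda>y. y powr c *\<^sub>R f y)"
  then have "(\<lambda>y. indicator {0<..} y *\<^sub>R (y powr c *\<^sub>R f y)) \<in> borel_measurable lborel"
    unfolding set_integrable_def by (rule borel_measurable_integrable)
  then have "(\<lambda>y. y powr (-c) *\<^sub>R (indicator {0<..} y *\<^sub>R (y powr c *\<^sub>R f y))) \<in> borel_measurable lborel"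
    by (rule borel_measurable_scaleR[rotated]) simp
  also have "(\<lambda>y. y powr (-c) *\<^sub>R (indicator {0<..} y *\<^sub>R (y powr c *\<^sub>R f y))) = (\<lambda>y. indicator {0<..} y *\<^sub>R f y)"
    by (auto simp: fun_eq_iff indicator_def powr_minus)
  finally have "f \<in> borel_measurable (weighted c)"
    by (simp add: borel_measurable_weighted set_borel_measurable_def)
  then show "integrable (weighted c) f" using r integral_weighted_if_measurable(1) by blast
qed

lemma integral_weighted:
  fixes f :: "real \<Rightarrow> 'b::{banach, second_countable_topology}"
  shows "integral\<^sup>L (weighted c) f = (LBINT y:{0<..}. y powr c *\<^sub>R f y)"
proof (cases "integrable (weighted c) f")
  case True
  then show ?thesis by (intro integral_weighted_if_measurable borel_measurable_integrable)
next
  case False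
  then have "\<not> set_integrable lborel {0<..} (\<lambda>y. y powr c *\<^sub>R f y)" by (simp add: integrable_weighted)
  with False show ?thesis
    by (simp add: set_integrable_def set_lebesgue_integral_def not_integrable_integral_eq)
qed

lemma L2_iff:
  "u \<in> L2 c \<longleftrightarrow> u \<in> borel_measurable (weighted c) \<and> integrable (weighted c) (\<lambda>y. (norm (u y))\<^sup>2)"
  by (simp add: Lq_def)

lemma L2_measurable: "u \<in> L2 c \<Longrightarrow> u \<in> borel_measurable (weighted c)"
  by (simp add: L2_iff)

lemma L2_square_integrable: "u \<in> L2 c \<Longrightarrow> integrable (weighted c) (\<lambda>y. (norm (u y))\<^sup>2)"
  by (simp add: L2_iff)

lemma L2_norm_nonneg [simp]: "0 \<le> L2_norm c u"
  by (simp add: L2_norm_def)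

lemma L2_norm_square: "(L2_norm c u)\<^sup>2 = (\<integral>y. (norm (u y))\<^sup>2 \<partial>weighted c)"
  by (simp add: L2_norm_def)

lemma L2_bound:
  assumes v: "v \<in> L2 c" and u: "u \<in> borel_measurable (weighted c)"
    and le: "AE y in weighted c. norm (u y) \<le> norm (v y)"
  shows "u \<in> L2 c" "L2_norm c u \<le> L2_norm c v"
proof -
  have i: "integrable (weighted c) (\<lambda>y. (norm (u y))\<^sup>2)"
  proof (rule Bochner_Integration.integrable_bound[OF L2_square_integrable[OF v]])
    show "(\<lambda>y. (norm (u y))\<^sup>2) \<in> borel_measurable (weighted c)"
      using u by measurable
    show "AE y in weighted c. norm ((norm (u y))\<^sup>2) \<le> norm ((norm (v y))\<^sup>2)"
      using le by eventually_elim (auto intro: power_mono)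
  qed
  then show "u \<in> L2 c" using u by (simp add: L2_iff)
  show "L2_norm c u \<le> L2_norm c v"
    unfolding L2_norm_def using i L2_square_integrable[OF v]
    by (intro real_sqrt_le_mono integral_mono_AE) (use le in \<open>auto elim!: AE_mp intro!: AE_I2 power_mono\<close>)
qed

lemma L2_cong_AE:
  assumes "u \<in> L2 c" "v \<in> borel_measurable (weighted c)" "AE y in weighted c. u y = v y"
  shows "v \<in> L2 c"
  by (rule L2_bound(1)[OF assms(1,2)]) (use assms(3) in eventually_elim, auto)

lemma L2_norm_cong_AE:
  assumes "u \<in> L2 c" "v \<in> L2 c" "AE y in weighted c. u y = v y"
  shows "L2_norm c u = L2_norm c v"
proof (rule antisym)
  show "L2_norm c u \<le> L2_norm c v"
    by (rule L2_bound(2)) (use assms L2_measurable in \<open>auto elim: eventually_mono\<close>)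
  show "L2_norm c v \<le> L2_norm c u"
    by (rule L2_bound(2)) (use assms L2_measurable in \<open>auto elim: eventually_mono\<close>)
qed

lemma L2_cmult:
  assumes "u \<in> L2 c"
  shows "(\<lambda>y. k * u y) \<in> L2 c" "L2_norm c (\<lambda>y. k * u y) = norm k * L2_norm c u"
proof -
  show "(\<lambda>y. k * u y) \<in> L2 c"
    using assms unfolding L2_iff by (auto simp: norm_mult power_mult_distrib)
  show "L2_norm c (\<lambda>y. k * u y) = norm k * L2_norm c u"
    by (simp add: L2_norm_def norm_mult power_mult_distrib real_sqrt_mult)
qed

lemma L2_bounded_mult:
  assumes "u \<in> L2 c" "k \<in> borel_measurable (weighted c)" "AE y in weighted c. norm (k y) \<le> B"
  shows "(\<lambda>y. k y * u y) \<in> L2 c" "L2_norm c (\<lambda>y. k y * u y) \<le> \<bar>B\<bar> * L2_norm c u"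
proof -
  have m: "(\<lambda>y. k y * u y) \<in> borel_measurable (weighted c)"
    by (intro borel_measurable_times assms L2_measurable)
  have le: "AE y in weighted c. norm (k y * u y) \<le> norm (complex_of_real B * u y)"
    using assms(3) by eventually_elim (auto simp: norm_mult intro!: mult_right_mono)
  show "(\<lambda>y. k y * u y) \<in> L2 c" "L2_norm c (\<lambda>y. k y * u y) \<le> \<bar>B\<bar> * L2_norm c u"
    using L2_bound[OF L2_cmult(1)[OF assms(1)] m le] L2_cmult(2)[OF assms(1)] by auto
qed

lemma L2_add: 
  assumes "u \<in> L2 c" "v \<in> L2 c"
  shows "(\<lambda>y. u y + v y) \<in> L2 c"
  unfolding L2_iff
proof
  show m: "(\<lambda>y. u y + v y) \<in> borel_measurable (weighted c)"
    by (intro borel_measurable_add assms L2_measurable)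
  show "integrable (weighted c) (\<lambda>y. (norm (u y + v y))\<^sup>2)"
  proof (rule Bochner_Integration.integrable_bound)
    show "integrable (weighted c) (\<lambda>y. 2 * (norm (u y))\<^sup>2 + 2 * (norm (v y))\<^sup>2)"
      by (intro Bochner_Integration.integrable_add integrable_mult_right L2_square_integrable assms)
    show "(\<lambda>y. (norm (u y + v y))\<^sup>2) \<in> borel_measurable (weighted c)"
      using m by measurable
    show "AE y in weighted c. norm ((norm (u y + v y))\<^sup>2) \<le> norm (2 * (norm (u y))\<^sup>2 + 2 * (norm (v y))\<^sup>2)"
    proof (rule AE_I2)
      fix y
      have "(norm (u y + v y))\<^sup>2 \<le> (norm (u y) + norm (v y))\<^sup>2"
        by (intro power_mono norm_triangle_ineq) auto
      also have "\<dots> \<le> 2 * (norm (u y))\<^sup>2 + 2 * (norm (v y))\<^sup>2"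
        using zero_le_power2[of "norm (u y) - norm (v y)"] by (simp add: power2_eq_square algebra_simps)
      finally show "norm ((norm (u y + v y))\<^sup>2) \<le> norm (2 * (norm (u y))\<^sup>2 + 2 * (norm (v y))\<^sup>2)" by simp
    qed
  qed
qed

lemma L2_diff:
  assumes "u \<in> L2 c" "v \<in> L2 c"
  shows "(\<lambda>y. u y - v y) \<in> L2 c"
  using L2_add[OF assms(1) L2_cmult(1)[OF assms(2), of "-1"]] by simp

lemma L2_cnj:
  assumes "u \<in> L2 c"
  shows "(\<lambda>y. cnj (u y)) \<in> L2 c"
proof (rule L2_bound(1)[OF assms])
  have "cnj \<in> borel_measurable borel"
    by (intro borel_measurable_continuous_onI continuous_intros)
  with L2_measurable[OF assms] show "(\<lambda>y. cnj (u y)) \<in> borel_measurable (weighted c)"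
    by (rule measurable_compose)
qed simp

lemma L2_mult_integrable:
  assumes "u \<in> L2 c" "v \<in> L2 c"
  shows "integrable (weighted c) (\<lambda>y. u y * v y)"
proof (rule Bochner_Integration.integrable_bound)
  show "integrable (weighted c) (\<lambda>y. (norm (u y))\<^sup>2 + (norm (v y))\<^sup>2)"
    by (intro Bochner_Integration.integrable_add L2_square_integrable assms)
  show "(\<lambda>y. u y * v y) \<in> borel_measurable (weighted c)"
    by (intro borel_measurable_times assms L2_measurable)
  show "AE y in weighted c. norm (u y * v y) \<le> norm ((norm (u y))\<^sup>2 + (norm (v y))\<^sup>2)"
  proof (rule AE_I2)
    fix y
    have "2 * norm (u y) * norm (v y) \<le> (norm (u y))\<^sup>2 + (norm (v y))\<^sup>2"
      by (rule sum_squares_bound)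
    moreover have "0 \<le> norm (u y) * norm (v y)" by simp
    ultimately show "norm (u y * v y) \<le> norm ((norm (u y))\<^sup>2 + (norm (v y))\<^sup>2)"
      unfolding norm_mult real_norm_def by linarith
  qed
qed

lemma L2_mult_cnj_integrable:
  "u \<in> L2 c \<Longrightarrow> v \<in> L2 c \<Longrightarrow> integrable (weighted c) (\<lambda>y. u y * cnj (v y))"
  by (intro L2_mult_integrable L2_cnj)

lemma L2_norm_mult_integrable:
  "u \<in> L2 c \<Longrightarrow> v \<in> L2 c \<Longrightarrow> integrable (weighted c) (\<lambda>y. norm (u y) * norm (v y))"
  using integrable_norm[OF L2_mult_integrable] by (simp add: norm_mult)

lemma L2_Cauchy_Schwarz:
  assumes "u \<in> L2 c" "v \<in> L2 c"
  shows "(\<integral>y. norm (u y) * norm (v y) \<partial>weighted c) \<le> L2_norm c u * L2_norm c v"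
proof (rule power2_le_imp_le)
  let ?M = "weighted c"
  have m: "(\<lambda>y. ennreal (norm (w y))) \<in> borel_measurable ?M" if "w \<in> L2 c" for w
    using L2_measurable[OF that] by measurable
  have sq: "(\<integral>\<^sup>+y. (ennreal (norm (w y)))\<^sup>2 \<partial>?M) = ennreal ((L2_norm c w)\<^sup>2)" if "w \<in> L2 c" for w
    unfolding L2_norm_square using L2_square_integrable[OF that]
    by (subst nn_integral_eq_integral[symmetric]) (auto simp: ennreal_power)
  have "ennreal ((\<integral>y. norm (u y) * norm (v y) \<partial>?M)\<^sup>2) = (\<integral>\<^sup>+y. ennreal (norm (u y)) * ennreal (norm (v y)) \<partial>?M)\<^sup>2"
  proof -
    have "(\<integral>\<^sup>+y. ennreal (norm (u y)) * ennreal (norm (v y)) \<partial>?M) = (\<integral>\<^sup>+y. ennreal (norm (u y) * norm (v y)) \<partial>?M)"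
      by (simp add: ennreal_mult)
    also have "\<dots> = ennreal (\<integral>y. norm (u y) * norm (v y) \<partial>?M)"
      by (rule nn_integral_eq_integral[OF L2_norm_mult_integrable[OF assms]]) auto
    finally show ?thesis by (simp add: ennreal_power integral_nonneg_AE)
  qed
  also have "\<dots> \<le> (\<integral>\<^sup>+y. (ennreal (norm (u y)))\<^sup>2 \<partial>?M) * (\<integral>\<^sup>+y. (ennreal (norm (v y)))\<^sup>2 \<partial>?M)"
    by (rule Cauchy_Schwarz_nn_integral) (intro m assms)+
  also have "\<dots> = ennreal ((L2_norm c u * L2_norm c v)\<^sup>2)"
    by (simp add: sq assms ennreal_mult power_mult_distrib)
  finally show "(\<integral>y. norm (u y) * norm (v y) \<partial>?M)\<^sup>2 \<le> (L2_norm c u * L2_norm c v)\<^sup>2"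
    by simp
qed simp

lemma L2_norm_triangle:
  assumes "u \<in> L2 c" "v \<in> L2 c"
  shows "L2_norm c (\<lambda>y. u y + v y) \<le> L2_norm c u + L2_norm c v"
proof (rule power2_le_imp_le)
  let ?M = "weighted c"
  note i = L2_square_integrable[OF assms(1)] L2_square_integrable[OF assms(2)] L2_norm_mult_integrable[OF assms]
  have "(L2_norm c (\<lambda>y. u y + v y))\<^sup>2 \<le> (\<integral>y. (norm (u y))\<^sup>2 + 2 * (norm (u y) * norm (v y)) + (norm (v y))\<^sup>2 \<partial>?M)"
    unfolding L2_norm_square
  proof (rule integral_mono[OF L2_square_integrable[OF L2_add[OF assms]]])
    show "integrable ?M (\<lambda>y. (norm (u y))\<^sup>2 + 2 * (norm (u y) * norm (v y)) + (norm (v y))\<^sup>2)"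
      by (intro Bochner_Integration.integrable_add integrable_mult_right i)
    fix y
    have "(norm (u y + v y))\<^sup>2 \<le> (norm (u y) + norm (v y))\<^sup>2"
      by (intro power_mono norm_triangle_ineq) auto
    then show "(norm (u y + v y))\<^sup>2 \<le> (norm (u y))\<^sup>2 + 2 * (norm (u y) * norm (v y)) + (norm (v y))\<^sup>2"
      by (simp add: power2_sum)
  qed
  also have "\<dots> = (L2_norm c u)\<^sup>2 + 2 * (\<integral>y. norm (u y) * norm (v y) \<partial>?M) + (L2_norm c v)\<^sup>2"
    unfolding L2_norm_square
    by (subst Bochner_Integration.integral_add, intro Bochner_Integration.integrable_add integrable_mult_right i, rule i,
        subst Bochner_Integration.integral_add, rule i, intro integrable_mult_right i) simp
  also have "\<dots> \<le> (L2_norm c u + L2_norm c v)\<^sup>2"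
    using L2_Cauchy_Schwarz[OF assms] by (simp add: power2_sum)
  finally show "(L2_norm c (\<lambda>y. u y + v y))\<^sup>2 \<le> (L2_norm c u + L2_norm c v)\<^sup>2" .
qed simp

lemma L2_norm_triangle_diff:
  assumes "u \<in> L2 c" "v \<in> L2 c"
  shows "L2_norm c (\<lambda>y. u y - v y) \<le> L2_norm c u + L2_norm c v"
  using L2_norm_triangle[OF assms(1) L2_cmult(1)[OF assms(2), of "-1"]] L2_cmult(2)[OF assms(2), of "-1"] by simp

lemma L2_imp_locally_integrable:
  assumes "u \<in> L2 c"
  shows "locally_integrable u"
  unfolding locally_integrable_def
proof (intro allI impI)
  fix a b :: real assume ab: "0 < a" "a < b"
  have "continuous_on {a..b} (\<lambda>y. y powr (-c))"
    using ab by (intro continuous_intros) auto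
  then have "bounded ((\<lambda>y. y powr (-c)) ` {a..b})"
    by (intro compact_imp_bounded compact_continuous_image) auto
  then obtain B where B: "\<And>y. y \<in> {a..b} \<Longrightarrow> norm (y powr (-c)) \<le> B"
    unfolding bounded_iff by blast
  then have B0: "B \<ge> 0" using ab by (meson atLeastAtMost_iff less_eq_real_def norm_ge_zero order_trans order_refl)
  show "set_integrable lborel {a..b} u"
    unfolding set_integrable_def
  proof (rule Bochner_Integration.integrable_bound)
    have "set_integrable lborel {0<..} (\<lambda>y. y powr c *\<^sub>R (norm (u y))\<^sup>2)"
      using assms by (simp add: L2_iff integrable_weighted)
    then show "integrable lborel (\<lambda>y. indicator {a..b} y + B * (indicator {0<..} y *\<^sub>R (y powr c *\<^sub>R (norm (u y))\<^sup>2)))"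
      by (intro Bochner_Integration.integrable_add integrable_mult_right integrable_real_indicator)
         (use ab in \<open>auto simp: set_integrable_def\<close>)
    have "set_borel_measurable lborel {0<..} u"
      using L2_measurable[OF assms] by (simp add: borel_measurable_weighted)
    then show "(\<lambda>y. indicator {a..b} y *\<^sub>R u y) \<in> borel_measurable lborel"
      unfolding set_borel_measurable_def[symmetric] by (rule set_borel_measurable_subset) (use ab in auto)
    show "AE y in lborel. norm (indicator {a..b} y *\<^sub>R u y) \<le>
        norm (indicator {a..b} y + B * (indicator {0<..} y *\<^sub>R (y powr c *\<^sub>R (norm (u y))\<^sup>2)))"
    proof (rule AE_I2)
      fix y
      show "norm (indicator {a..b} y *\<^sub>R u y) \<le>
        norm (indicator {a..b} y + B * (indicator {0<..} y *\<^sub>R (y powr c *\<^sub>R (norm (u y))\<^sup>2)))"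
      proof (cases "y \<in> {a..b}")
        case True
        have "norm (u y) \<le> 1 + (norm (u y))\<^sup>2"
          using zero_le_power2[of "norm (u y) - 1"] norm_ge_zero[of "u y"]
          unfolding power2_diff by (simp, linarith)
        also have "(norm (u y))\<^sup>2 = y powr (-c) * (y powr c * (norm (u y))\<^sup>2)"
          using True ab by (simp add: powr_minus field_simps)
        also have "\<dots> \<le> B * (y powr c * (norm (u y))\<^sup>2)"
          using B[OF True] by (intro mult_right_mono) auto
        finally show ?thesis using True ab B0 by (auto simp: abs_if)
      qed auto
    qed
  qed
qed

lemma powr_Ioo_integral:
  fixes R :: real
  assumes "a > -1" "0 \<le> R"
  shows "set_integrable lborel {0<..<R} (\<lambda>y. y powr a)" "(LBINT y:{0<..<R}. y powr a) = R powr (a + 1) / (a + 1)"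
proof -
  have h: "((\<lambda>x. x powr a) has_integral (R powr (a + 1) / (a + 1))) {0..R}"
    using assms by (rule has_integral_powr_from_0)
  have h2: "((\<lambda>x. x powr a) has_integral (R powr (a + 1) / (a + 1))) {0<..<R}"
    using h has_integral_Icc_iff_Ioo by blast
  have "set_integrable lebesgue {0<..<R} (\<lambda>x. x powr a)"
    using h2 by (intro nonnegative_absolutely_integrable_1) (auto simp: integrable_on_def)
  then show i: "set_integrable lborel {0<..<R} (\<lambda>y. y powr a)"
    unfolding set_integrable_def by (subst (asm) integrable_completion) auto
  then show "(LBINT y:{0<..<R}. y powr a) = R powr (a + 1) / (a + 1)"
    using set_borel_integral_eq_integral(2)[OF i] h2 by (simp add: integral_unique)
qed

lemma indicator_L2:
  assumes "c > -1" "0 \<le> s"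
  shows "(\<lambda>y. indicator {0<..<s} y) \<in> L2 c" "L2_norm c (\<lambda>y. indicator {0<..<s} y) = sqrt (s powr (c + 1) / (c + 1))"
proof -
  have *: "(norm (indicator {0<..<s} y :: complex))\<^sup>2 = indicator {0<..<s} y" for y
    by (auto simp: indicator_def)
  have **: "indicator {0<..} y *\<^sub>R (y powr c *\<^sub>R indicator {0<..<s} y) = indicator {0<..<s} y *\<^sub>R y powr c" for y
    by (auto simp: indicator_def)
  show "(\<lambda>y. indicator {0<..<s} y) \<in> L2 c"
    unfolding L2_iff * integrable_weighted
  proof
    show "(\<lambda>y. indicator {0<..<s} y :: complex) \<in> borel_measurable (weighted c)"
      by (rule measurable_weightedI) simp
    show "set_integrable lborel {0<..} (\<lambda>y. y powr c *\<^sub>R (indicator {0<..<s} y :: real))"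
      using powr_Ioo_integral(1)[OF assms] by (simp only: set_integrable_def **)
  qed
  show "L2_norm c (\<lambda>y. indicator {0<..<s} y) = sqrt (s powr (c + 1) / (c + 1))"
    unfolding L2_norm_def * integral_weighted using powr_Ioo_integral(2)[OF assms] 
    by (simp only: set_lebesgue_integral_def **)
qed

lemma L2_integral_near_0:
  assumes "f \<in> L2 c" "c > -1" "0 \<le> s"
  shows "set_integrable lborel {0<..<s} (\<lambda>y. y powr c *\<^sub>R f y)"
    "(LBINT y:{0<..<s}. norm (y powr c *\<^sub>R f y)) \<le> L2_norm c f * sqrt (s powr (c + 1) / (c + 1))"
proof -
  have *: "indicator {0<..} y *\<^sub>R (y powr c *\<^sub>R (f y * indicator {0<..<s} y)) = indicator {0<..<s} y *\<^sub>R (y powr c *\<^sub>R f y)" for y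
    by (auto simp: indicator_def)
  have "integrable (weighted c) (\<lambda>y. f y * indicator {0<..<s} y)"
    using L2_mult_integrable[OF assms(1) indicator_L2(1)[OF assms(2,3)]] by simp
  then show "set_integrable lborel {0<..<s} (\<lambda>y. y powr c *\<^sub>R f y)"
    by (simp only: integrable_weighted set_integrable_def *)
  have **: "indicator {0<..} y *\<^sub>R (y powr c *\<^sub>R (norm (f y) * norm (indicator {0<..<s} y :: complex))) = indicator {0<..<s} y *\<^sub>R norm (y powr c *\<^sub>R f y)" for y
    by (auto simp: indicator_def)
  show "(LBINT y:{0<..<s}. norm (y powr c *\<^sub>R f y)) \<le> L2_norm c f * sqrt (s powr (c + 1) / (c + 1))"
    using L2_Cauchy_Schwarz[OF assms(1) indicator_L2(1)[OF assms(2,3)]]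
    unfolding integral_weighted set_lebesgue_integral_def ** indicator_L2(2)[OF assms(2,3)] .
qed

section \<open>The form and its operator\<close>

lemma AE_zero_imp_zero:
  fixes f :: "real \<Rightarrow> complex"
  assumes c: "continuous_on {0<..} f" and z: "AE y in lborel. r < y \<longrightarrow> f y = 0" and r: "0 < r" "r \<le> y"
  shows "f y = 0"
proof -
  have *: "f x = 0" if "r < x" for x
  proof (rule ccontr)
    assume "f x \<noteq> 0"
    moreover have "isCont f x"
      using c r that by (simp add: continuous_on_eq_continuous_at)
    ultimately obtain e where e: "e > 0" "\<And>y. dist x y < e \<Longrightarrow> f y \<noteq> 0"
      using continuous_at_avoid[of x f 0] by blast
    define d where "d = min e (x - r)"
    have d: "d > 0" using e that by (simp add: d_def)
    have "AE y in lborel. y \<notin> {x-d<..<x+d}"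
      using z
    proof eventually_elim
      fix y assume "r < y \<longrightarrow> f y = 0"
      moreover have "r < y" "dist x y < e" if "y \<in> {x-d<..<x+d}"
        using that by (auto simp: d_def dist_real_def)
      ultimately show "y \<notin> {x-d<..<x+d}" using e(2) by blast
    qed
    then have "emeasure lborel {x-d<..<x+d} = 0"
      by (subst (asm) AE_iff_measurable[of "{x-d<..<x+d}"]) auto
    with d show False by simp
  qed
  show ?thesis
  proof (cases "r < y")
    case False
    then have y: "y = r" using r by simp
    have "isCont f r" using c r(1) by (simp add: continuous_on_eq_continuous_at)
    then have "(f \<longlongrightarrow> f r) (at_right r)"
      unfolding isCont_def by (simp add: filterlim_at_split)
    moreover have "eventually (\<lambda>x. f x = 0) (at_right r)"
      using * by (auto simp: eventually_at_filter)
    then have "(f \<longlongrightarrow> 0) (at_right r)"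
      by (rule tendsto_eventually)
    ultimately show ?thesis
      using tendsto_unique[OF trivial_limit_at_right_real] y by blast
  qed (use * in auto)
qed

lemma locally_integrable_mult_continuous:
  assumes "locally_integrable h" "continuous_on {0<..} k"
  shows "locally_integrable (\<lambda>y. h y * k y)"
  unfolding locally_integrable_def
proof (intro allI impI)
  fix a b :: real assume ab: "0 < a" "a < b"
  have c: "continuous_on {a..b} k" by (rule continuous_on_subset[OF assms(2)]) (use ab in auto)
  then have "bounded (k ` {a..b})"
    by (intro compact_imp_bounded compact_continuous_image) auto
  then obtain B where "\<And>y. y \<in> {a..b} \<Longrightarrow> norm (k y) \<le> B"
    unfolding bounded_iff by blast
  then show "set_integrable lborel {a..b} (\<lambda>y. h y * k y)"
    using locally_integrableD(1)[OF assms(1) ab(1)] continuous_set_measurable[OF c]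
    by (intro set_integrable_mult_bounded) auto
qed

lemma locally_integrable_weighted:
  assumes "\<And>a b. 0 < a \<Longrightarrow> a < b \<Longrightarrow> integrable (weighted c) (\<lambda>y. indicator {a..b} y *\<^sub>R f y)"
  shows "locally_integrable (\<lambda>y. complex_of_real (y powr c) * f y)"
  unfolding locally_integrable_def
proof (intro allI impI)
  fix a b :: real assume ab: "0 < a" "a < b"
  have *: "indicator {0<..} y *\<^sub>R y powr c *\<^sub>R indicator {a..b} y *\<^sub>R f y = indicator {a..b} y *\<^sub>R (complex_of_real (y powr c) * f y)" for y
    using ab by (auto simp: indicator_def scaleR_conv_of_real)
  show "set_integrable lborel {a..b} (\<lambda>y. complex_of_real (y powr c) * f y)"
    using assms[OF ab] by (simp only: integrable_weighted set_integrable_def *)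
qed

lemma L2_imp_locally_integrable_weighted:
  assumes "u \<in> L2 c"
  shows "locally_integrable (\<lambda>y. complex_of_real (y powr c) * u y)"
proof -
  have "continuous_on {0<..} (\<lambda>y. complex_of_real (y powr c))"
    by (intro continuous_intros) auto
  from locally_integrable_mult_continuous[OF L2_imp_locally_integrable[OF assms] this]
  show ?thesis by (simp only: mult.commute)
qed

text \<open>The second function is a weak derivative of the first; keeping it explicit avoids the chosen
  representative in the definition of the form.\<close>

definition H1 :: "real \<Rightarrow> (real \<Rightarrow> complex) \<Rightarrow> (real \<Rightarrow> complex) \<Rightarrow> bool" where
  "H1 c u u' \<longleftrightarrow> u \<in> L2 c \<and> u' \<in> L2 c \<and> has_weak_derivative u u'"

lemma H1_weak_deriv:
  assumes "H1 c u u'"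
  shows "AE y in weighted c. weak_deriv u y = u' y" "weak_deriv u \<in> borel_measurable (weighted c)"
proof -
  have w: "has_weak_derivative u (weak_deriv u)"
    unfolding weak_deriv_def using assms by (intro someI[of "has_weak_derivative u" u']) (simp add: H1_def)
  then show "AE y in weighted c. weak_deriv u y = u' y"
    unfolding AE_weighted using assms by (intro weak_derivative_unique) (auto simp: H1_def)
  show "weak_deriv u \<in> borel_measurable (weighted c)"
    unfolding borel_measurable_weighted
    using w by (intro locally_integrable_measurable) (auto simp: has_weak_derivative_def)
qed

lemma H1_primitive:
  assumes "H1 c u u'"
  obtains v where "is_primitive v u'" "AE y in weighted c. u y = v y" "H1 c v u'"
proof -
  obtain v where v: "is_primitive v u'" "AE x in lborel. 0 < x \<longrightarrow> u x = v x"
    using weak_derivative_imp_primitive assms unfolding H1_def by metis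
  have ae: "AE y in weighted c. u y = v y" using v(2) by (simp add: AE_weighted)
  have "v \<in> borel_measurable (weighted c)"
    by (rule measurable_weighted_continuous[OF primitive_continuous[OF v(1)]])
  then have "v \<in> L2 c" using assms ae L2_cong_AE unfolding H1_def by blast
  with assms have "H1 c v u'"
    using primitive_imp_weak_derivative[OF v(1)] by (simp add: H1_def)
  with v(1) ae that show ?thesis by blast
qed

lemma primitive_H1: "is_primitive u u' \<Longrightarrow> u \<in> L2 c \<Longrightarrow> u' \<in> L2 c \<Longrightarrow> H1 c u u'"
  by (simp add: H1_def primitive_imp_weak_derivative)

lemma H1_diff:
  assumes "H1 c u u'" "H1 c v v'"
  shows "H1 c (\<lambda>y. u y - v y) (\<lambda>y. u' y - v' y)"
  unfolding H1_def
proof (intro conjI)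
  show "has_weak_derivative (\<lambda>y. u y - v y) (\<lambda>y. u' y - v' y)"
    unfolding has_weak_derivative_def
  proof (intro conjI ballI)
    have l: "locally_integrable u" "locally_integrable v" "locally_integrable u'" "locally_integrable v'"
      using assms by (auto simp: H1_def has_weak_derivative_def)
    then show "locally_integrable (\<lambda>y. u y - v y)" "locally_integrable (\<lambda>y. u' y - v' y)"
      by (auto intro: locally_integrable_diff)
    fix \<phi> assume \<phi>: "\<phi> \<in> Cc_infty {0<..}"
    obtain \<phi>' where \<phi>': "\<phi>' \<in> Cc_infty {0<..}" "\<And>x. 0 < x \<Longrightarrow> vector_derivative \<phi> (at x) = \<phi>' x"
      by (rule test_function_derivative[OF \<phi>]) (use vector_derivative_at in blast)
    have *: "(LBINT x:{0<..}. h x * vector_derivative \<phi> (at x)) = (LBINT x:{0<..}. h x * \<phi>' x)" for h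
      by (intro set_lebesgue_integral_cong) (auto simp: \<phi>'(2))
    have "(LBINT x:{0<..}. (u x - v x) * \<phi>' x) = (LBINT x:{0<..}. u x * \<phi>' x) - (LBINT x:{0<..}. v x * \<phi>' x)"
      unfolding left_diff_distrib by (intro set_integral_diff integrable_mult_test l \<phi>')
    also have "\<dots> = - (LBINT x:{0<..}. u' x * \<phi> x) - - (LBINT x:{0<..}. v' x * \<phi> x)"
      using assms \<phi> unfolding H1_def has_weak_derivative_def by (simp add: *[symmetric])
    also have "\<dots> = - (LBINT x:{0<..}. (u' x - v' x) * \<phi> x)"
      unfolding left_diff_distrib by (subst set_integral_diff(2)) (auto intro!: integrable_mult_test l \<phi>)
    finally show "(LBINT x:{0<..}. (u x - v x) * vector_derivative \<phi> (at x)) = - (LBINT x:{0<..}. (u' x - v' x) * \<phi> x)"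
      by (simp only: *)
  qed
qed (use assms in \<open>auto simp: H1_def intro: L2_diff\<close>)

lemma bounded_support_L2:
  assumes c: "c > -1" and m: "v \<in> borel_measurable (weighted c)"
    and B: "\<And>y. 0 < y \<Longrightarrow> y < R \<Longrightarrow> norm (v y) \<le> B" and z: "\<And>y. R \<le> y \<Longrightarrow> v y = 0" and R: "0 \<le> R"
  shows "v \<in> L2 c"
proof (rule L2_bound(1)[OF L2_cmult(1)[OF indicator_L2(1)[OF c R], of "complex_of_real B"] m])
  show "AE y in weighted c. norm (v y) \<le> norm (complex_of_real B * indicator {0<..<R} y)"
    unfolding AE_weighted
  proof (intro AE_I2 impI)
    fix y :: real assume "0 < y"
    then show "norm (v y) \<le> norm (complex_of_real B * indicator {0<..<R} y)"
      using B[of y] z[of y] by (cases "y < R") (auto simp: norm_mult intro: order_trans)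
  qed
qed

text \<open>The standing hypotheses hold for \<open>V\<close> and for the zero potential, so that each result
  in the locale is available for both operators.\<close>

locale potential =
  fixes c :: real and V :: "real \<Rightarrow> real"
  assumes c: "c > -1"
    and V_nonneg: "AE y in weighted c. 0 \<le> V y"
    and V_measurable: "V \<in> borel_measurable (weighted c)"
    and V_integrable: "\<And>R. 0 < R \<Longrightarrow> integrable (weighted c) (\<lambda>y. indicator {0<..R} y * V y)"
begin

definition finite_energy :: "(real \<Rightarrow> complex) \<Rightarrow> bool" where
  "finite_energy u \<longleftrightarrow> integrable (weighted c) (\<lambda>y. V y * (norm (u y))\<^sup>2)"

lemma finite_energy_iff:
  assumes "u \<in> borel_measurable (weighted c)"
  shows "(\<lambda>y. complex_of_real (sqrt (V y)) * u y) \<in> L2 c \<longleftrightarrow> finite_energy u"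
proof -
  have m: "(\<lambda>y. complex_of_real (sqrt (V y)) * u y) \<in> borel_measurable (weighted c)"
    using assms V_measurable by measurable
  have "(norm (complex_of_real (sqrt (V y)) * u y))\<^sup>2 = \<bar>V y\<bar> * (norm (u y))\<^sup>2" for y
    by (simp add: norm_mult power_mult_distrib power2_eq_square)
  then have "(\<lambda>y. complex_of_real (sqrt (V y)) * u y) \<in> L2 c \<longleftrightarrow> integrable (weighted c) (\<lambda>y. \<bar>V y\<bar> * (norm (u y))\<^sup>2)"
    using m by (simp add: L2_iff)
  also have "\<dots> \<longleftrightarrow> finite_energy u"
    unfolding finite_energy_def
  proof (rule integrable_cong_AE)
    show "(\<lambda>y. \<bar>V y\<bar> * (norm (u y))\<^sup>2) \<in> borel_measurable (weighted c)" "(\<lambda>y. V y * (norm (u y))\<^sup>2) \<in> borel_measurable (weighted c)"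
      using assms V_measurable by measurable
    show "AE y in weighted c. \<bar>V y\<bar> * (norm (u y))\<^sup>2 = V y * (norm (u y))\<^sup>2"
      using V_nonneg by eventually_elim simp
  qed
  finally show ?thesis .
qed

lemma form_dom_iff: "u \<in> form_dom c V \<longleftrightarrow> (\<exists>u'. H1 c u u') \<and> finite_energy u"
  using finite_energy_iff[OF L2_measurable] by (auto simp: form_dom_def H1_def)

lemma potential_term_integrable:
  assumes "finite_energy u" "finite_energy v"
    and m: "u \<in> borel_measurable (weighted c)" "v \<in> borel_measurable (weighted c)"
  shows "integrable (weighted c) (\<lambda>y. complex_of_real (V y) * u y * cnj (v y))"
proof -
  have "integrable (weighted c) (\<lambda>y. (complex_of_real (sqrt (V y)) * u y) * cnj (complex_of_real (sqrt (V y)) * v y))"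
    using assms finite_energy_iff by (intro L2_mult_cnj_integrable) auto
  then show ?thesis
  proof (rule integrable_cong_AE_imp)
    have "(\<lambda>y. cnj (v y)) \<in> borel_measurable (weighted c)"
      by (intro measurable_compose[OF m(2) borel_measurable_continuous_onI] continuous_intros)
    then show "(\<lambda>y. complex_of_real (V y) * u y * cnj (v y)) \<in> borel_measurable (weighted c)"
      using m V_measurable by measurable
    show "AE y in weighted c. complex_of_real (sqrt (V y)) * u y * cnj (complex_of_real (sqrt (V y)) * v y) =
         complex_of_real (V y) * u y * cnj (v y)"
      using V_nonneg
    proof eventually_elim
      fix y assume "0 \<le> V y"
      then have "complex_of_real (V y) = complex_of_real (sqrt (V y)) * complex_of_real (sqrt (V y))"
        by (simp flip: of_real_mult)
      then show "complex_of_real (sqrt (V y)) * u y * cnj (complex_of_real (sqrt (V y)) * v y) =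
         complex_of_real (V y) * u y * cnj (v y)" by simp
    qed
  qed
qed

lemma form_V_eq:
  assumes u: "H1 c u u'" "finite_energy u" and v: "H1 c v v'" "finite_energy v"
  shows "form_V c V u v = (\<integral>y. u' y * cnj (v' y) \<partial>weighted c) + (\<integral>y. complex_of_real (V y) * u y * cnj (v y) \<partial>weighted c)"
proof -
  have m: "u \<in> borel_measurable (weighted c)" "v \<in> borel_measurable (weighted c)"
    "u' \<in> borel_measurable (weighted c)" "v' \<in> borel_measurable (weighted c)"
    using u v by (auto simp: H1_def L2_measurable)
  have cm: "(\<lambda>y. cnj (w y)) \<in> borel_measurable (weighted c)" if "w \<in> borel_measurable (weighted c)" for w
    by (intro measurable_compose[OF that borel_measurable_continuous_onI] continuous_intros)
  note i = L2_mult_cnj_integrable[of u' c v'] potential_term_integrable[OF u(2) v(2) m(1,2)]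
  have "form_V c V u v = (\<integral>y. u' y * cnj (v' y) + complex_of_real (V y) * u y * cnj (v y) \<partial>weighted c)"
    unfolding form_V_def
  proof (rule integral_cong_AE)
    have "(\<lambda>y. weak_deriv u y * cnj (weak_deriv v y)) \<in> borel_measurable (weighted c)"
      by (intro borel_measurable_times cm H1_weak_deriv(2)[OF u(1)] H1_weak_deriv(2)[OF v(1)])
    then show "(\<lambda>y. weak_deriv u y * cnj (weak_deriv v y) + complex_of_real (V y) * u y * cnj (v y)) \<in> borel_measurable (weighted c)"
      by (intro borel_measurable_add borel_measurable_integrable[OF i(2)])
    show "(\<lambda>y. u' y * cnj (v' y) + complex_of_real (V y) * u y * cnj (v y)) \<in> borel_measurable (weighted c)"
      by (intro borel_measurable_add borel_measurable_integrable[OF i(2)] borel_measurable_times cm m)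
    show "AE y in weighted c. weak_deriv u y * cnj (weak_deriv v y) + complex_of_real (V y) * u y * cnj (v y) =
           u' y * cnj (v' y) + complex_of_real (V y) * u y * cnj (v y)"
      using H1_weak_deriv(1)[OF u(1)] H1_weak_deriv(1)[OF v(1)] by eventually_elim simp
  qed
  also have "\<dots> = (\<integral>y. u' y * cnj (v' y) \<partial>weighted c) + (\<integral>y. complex_of_real (V y) * u y * cnj (v y) \<partial>weighted c)"
    using u v by (intro Bochner_Integration.integral_add i) (auto simp: H1_def)
  finally show ?thesis .
qed

lemma is_BV_I:
  assumes "H1 c u u'" "finite_energy u" "g \<in> L2 c"
    and "\<And>v v'. H1 c v v' \<Longrightarrow> finite_energy v \<Longrightarrow>
      (\<integral>y. u' y * cnj (v' y) \<partial>weighted c) + (\<integral>y. complex_of_real (V y) * u y * cnj (v y) \<partial>weighted c)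
        = - (\<integral>y. g y * cnj (v y) \<partial>weighted c)"
  shows "is_BV c V u g"
  unfolding is_BV_def
proof (intro conjI ballI)
  show "u \<in> form_dom c V" using assms by (auto simp: form_dom_iff)
  fix v assume "v \<in> form_dom c V"
  then obtain v' where v: "H1 c v v'" "finite_energy v" by (auto simp: form_dom_iff)
  show "form_V c V u v = (\<integral>y. - g y * cnj (v y) \<partial>weighted c)"
    using form_V_eq[OF assms(1,2) v] assms(4)[OF v] by simp
qed fact

lemma is_BV_D:
  assumes "is_BV c V u g"
  shows "\<exists>u'. H1 c u u'" "finite_energy u" "g \<in> L2 c" "u \<in> L2 c"
    and "\<And>u' v v'. H1 c u u' \<Longrightarrow> H1 c v v' \<Longrightarrow> finite_energy v \<Longrightarrow>
      (\<integral>y. u' y * cnj (v' y) \<partial>weighted c) + (\<integral>y. complex_of_real (V y) * u y * cnj (v y) \<partial>weighted c)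
        = - (\<integral>y. g y * cnj (v y) \<partial>weighted c)"
proof -
  show e: "\<exists>u'. H1 c u u'" "finite_energy u" and "g \<in> L2 c"
    using assms by (auto simp: is_BV_def form_dom_iff)
  then show "u \<in> L2 c" by (auto simp: H1_def)
  fix u' v v' assume *: "H1 c u u'" "H1 c v v'" "finite_energy v"
  then have "v \<in> form_dom c V" by (auto simp: form_dom_iff)
  with assms have "form_V c V u v = (\<integral>y. - g y * cnj (v y) \<partial>weighted c)" by (auto simp: is_BV_def)
  with form_V_eq[OF *(1) e(2) *(2,3)]
  show "(\<integral>y. u' y * cnj (v' y) \<partial>weighted c) + (\<integral>y. complex_of_real (V y) * u y * cnj (v y) \<partial>weighted c)
        = - (\<integral>y. g y * cnj (v y) \<partial>weighted c)" by simp
qed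

lemma finite_energy_cong_AE:
  assumes "AE y in weighted c. u y = v y" "u \<in> borel_measurable (weighted c)" "v \<in> borel_measurable (weighted c)"
  shows "finite_energy u \<longleftrightarrow> finite_energy v"
  unfolding finite_energy_def
proof (rule integrable_cong_AE)
  show "(\<lambda>y. V y * (norm (u y))\<^sup>2) \<in> borel_measurable (weighted c)" "(\<lambda>y. V y * (norm (v y))\<^sup>2) \<in> borel_measurable (weighted c)"
    using assms(2,3) V_measurable by measurable
  show "AE y in weighted c. V y * (norm (u y))\<^sup>2 = V y * (norm (v y))\<^sup>2"
    using assms(1) by eventually_elim simp
qed

lemma finite_energy_diff:
  assumes "finite_energy u" "finite_energy v" "u \<in> L2 c" "v \<in> L2 c"
  shows "finite_energy (\<lambda>y. u y - v y)"
proof -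
  have "(\<lambda>y. complex_of_real (sqrt (V y)) * u y - complex_of_real (sqrt (V y)) * v y) \<in> L2 c"
    using assms by (intro L2_diff) (auto simp: finite_energy_iff L2_measurable)
  then show ?thesis
    using assms by (subst finite_energy_iff[symmetric]) (auto simp: right_diff_distrib intro: L2_measurable L2_diff)
qed

lemma finite_energy_bounded_support:
  assumes m: "v \<in> borel_measurable (weighted c)"
    and B: "\<And>y. 0 < y \<Longrightarrow> y < R \<Longrightarrow> norm (v y) \<le> B" and z: "\<And>y. R \<le> y \<Longrightarrow> v y = 0" and R: "0 < R"
  shows "finite_energy v"
  unfolding finite_energy_def
proof (rule Bochner_Integration.integrable_bound)
  show "integrable (weighted c) (\<lambda>y. B\<^sup>2 * (indicator {0<..R} y * V y))"
    by (intro integrable_mult_right V_integrable R)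
  show "(\<lambda>y. V y * (norm (v y))\<^sup>2) \<in> borel_measurable (weighted c)"
    using m V_measurable by measurable
  show "AE y in weighted c. norm (V y * (norm (v y))\<^sup>2) \<le> norm (B\<^sup>2 * (indicator {0<..R} y * V y))"
    unfolding AE_weighted
  proof (intro AE_I2 impI)
    fix y :: real assume y: "0 < y"
    show "norm (V y * (norm (v y))\<^sup>2) \<le> norm (B\<^sup>2 * (indicator {0<..R} y * V y))"
    proof (cases "y < R")
      case True
      have "(norm (v y))\<^sup>2 \<le> B\<^sup>2" using B[OF y True] by (intro power_mono) auto
      then have "\<bar>V y\<bar> * (norm (v y))\<^sup>2 \<le> \<bar>V y\<bar> * B\<^sup>2" by (intro mult_left_mono) auto
      with y True show ?thesis by (auto simp: abs_mult mult.commute)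
    qed (use z in auto)
  qed
qed

lemma H1_bounded_support:
  assumes "continuous_on {0<..} v" "finite S" "\<And>y. 0 < y \<Longrightarrow> y \<notin> S \<Longrightarrow> (v has_vector_derivative v' y) (at y)"
    and "v' \<in> borel_measurable (weighted c)"
    and "\<And>y. 0 < y \<Longrightarrow> y < R \<Longrightarrow> norm (v y) \<le> B" "\<And>y. 0 < y \<Longrightarrow> y < R \<Longrightarrow> norm (v' y) \<le> B"
    and "\<And>y. R \<le> y \<Longrightarrow> v y = 0" "\<And>y. R \<le> y \<Longrightarrow> v' y = 0" and R: "0 < R"
  shows "H1 c v v'" "finite_energy v"
proof -
  have m: "v \<in> borel_measurable (weighted c)" by (rule measurable_weighted_continuous[OF assms(1)])
  have v: "v \<in> L2 c" and v': "v' \<in> L2 c"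
    using bounded_support_L2[OF c] m assms by (blast intro: less_imp_le)+
  then show "H1 c v v'"
    by (intro primitive_H1 primitiveI[OF assms(1) L2_imp_locally_integrable[OF v'] assms(2,3)])
  show "finite_energy v"
    using finite_energy_bounded_support[OF m] assms by blast
qed

lemma test_function_H1:
  assumes \<phi>: "\<phi> \<in> Cc_infty {0<..}" and d: "\<And>x. 0 < x \<Longrightarrow> (\<phi> has_vector_derivative \<phi>' x) (at x)"
  shows "H1 c (\<lambda>y. cnj (\<phi> y)) (\<lambda>y. cnj (\<phi>' y))" "finite_energy (\<lambda>y. cnj (\<phi> y))"
proof -
  obtain q a b where ab: "0 < a" "a < b" and q: "q \<in> Cc_infty {0<..}" "\<And>x. 0 < x \<Longrightarrow> (\<phi> has_vector_derivative q x) (at x)"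
    "\<And>x. 0 < x \<Longrightarrow> x \<notin> {a<..<b} \<Longrightarrow> \<phi> x = 0" "\<And>x. 0 < x \<Longrightarrow> x \<notin> {a<..<b} \<Longrightarrow> q x = 0"
    by (rule test_function_derivative[OF \<phi>]) (rule that; assumption)
  have q': "\<phi>' x = q x" if "0 < x" for x using d q(2) that vector_derivative_unique_at by blast
  have c\<phi>: "continuous_on {0<..} \<phi>" "continuous_on {0<..} q" using \<phi> q by (auto intro: Cc_infty_continuous)
  have "bounded (\<phi> ` {a..b})" "bounded (q ` {a..b})"
    using ab by (auto intro!: compact_imp_bounded compact_continuous_image continuous_on_subset[OF c\<phi>(1)] continuous_on_subset[OF c\<phi>(2)])
  then obtain B1 B2 where "\<And>x. x \<in> {a..b} \<Longrightarrow> norm (\<phi> x) \<le> B1" "\<And>x. x \<in> {a..b} \<Longrightarrow> norm (q x) \<le> B2"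
    unfolding bounded_iff by blast
  then have B: "norm (\<phi> x) \<le> max 0 (max B1 B2)" "norm (q x) \<le> max 0 (max B1 B2)" if "0 < x" for x
    using q(3,4)[OF that] by (cases "x \<in> {a..b}"; force simp: le_max_iff_disj)+
  have q'm: "(\<lambda>y. cnj (\<phi>' y)) \<in> borel_measurable (weighted c)"
    by (intro measurable_weighted_continuous continuous_on_cnj) (use c\<phi>(2) q' continuous_on_cong[of "{0<..}" "{0<..}" \<phi>' q] in simp)
  have dd: "((\<lambda>y. cnj (\<phi> y)) has_vector_derivative cnj (\<phi>' y)) (at y)" if "0 < y" "y \<notin> {}" for y
    using d[OF that(1)] by (rule has_vector_derivative_cnj)
  show "H1 c (\<lambda>y. cnj (\<phi> y)) (\<lambda>y. cnj (\<phi>' y))" "finite_energy (\<lambda>y. cnj (\<phi> y))"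
    by (rule H1_bounded_support[OF continuous_on_cnj[OF c\<phi>(1)] finite.emptyI dd q'm, where R = b and B = "max 0 (max B1 B2)"];
        use ab B q' q in auto)+
qed

lemma is_BV_diff:
  assumes u: "is_BV c V u g" and v: "is_BV c V v h"
  shows "is_BV c V (\<lambda>y. u y - v y) (\<lambda>y. g y - h y)"
proof -
  obtain u' v' where d: "H1 c u u'" "H1 c v v'" using is_BV_D(1)[OF u] is_BV_D(1)[OF v] by blast
  then have L: "u \<in> L2 c" "v \<in> L2 c" "u' \<in> L2 c" "v' \<in> L2 c" by (auto simp: H1_def)
  show ?thesis
  proof (rule is_BV_I[OF H1_diff[OF d]])
    show "finite_energy (\<lambda>y. u y - v y)"
      by (intro finite_energy_diff is_BV_D(2)[OF u] is_BV_D(2)[OF v] L)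
    show "(\<lambda>y. g y - h y) \<in> L2 c" by (intro L2_diff is_BV_D(3)[OF u] is_BV_D(3)[OF v])
    fix w w' assume w: "H1 c w w'" "finite_energy w"
    then have Lw: "w \<in> L2 c" "w' \<in> L2 c" by (auto simp: H1_def)
    note i = L2_mult_cnj_integrable potential_term_integrable[OF is_BV_D(2)[OF u] w(2)] potential_term_integrable[OF is_BV_D(2)[OF v] w(2)]
    have "(\<integral>y. (u' y - v' y) * cnj (w' y) \<partial>weighted c) = (\<integral>y. u' y * cnj (w' y) \<partial>weighted c) - (\<integral>y. v' y * cnj (w' y) \<partial>weighted c)"
      unfolding left_diff_distrib by (intro Bochner_Integration.integral_diff i L Lw)
    moreover have "(\<integral>y. complex_of_real (V y) * (u y - v y) * cnj (w y) \<partial>weighted c) =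
       (\<integral>y. complex_of_real (V y) * u y * cnj (w y) \<partial>weighted c) - (\<integral>y. complex_of_real (V y) * v y * cnj (w y) \<partial>weighted c)"
      unfolding left_diff_distrib right_diff_distrib by (intro Bochner_Integration.integral_diff i L2_measurable L Lw)
    moreover have "(\<integral>y. (g y - h y) * cnj (w y) \<partial>weighted c) = (\<integral>y. g y * cnj (w y) \<partial>weighted c) - (\<integral>y. h y * cnj (w y) \<partial>weighted c)"
      unfolding left_diff_distrib by (intro Bochner_Integration.integral_diff i is_BV_D(3)[OF u] is_BV_D(3)[OF v] Lw)
    ultimately have "(\<integral>y. (u' y - v' y) * cnj (w' y) \<partial>weighted c) +
       (\<integral>y. complex_of_real (V y) * (u y - v y) * cnj (w y) \<partial>weighted c) =
       ((\<integral>y. u' y * cnj (w' y) \<partial>weighted c) + (\<integral>y. complex_of_real (V y) * u y * cnj (w y) \<partial>weighted c)) -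
       ((\<integral>y. v' y * cnj (w' y) \<partial>weighted c) + (\<integral>y. complex_of_real (V y) * v y * cnj (w y) \<partial>weighted c))"
      "- (\<integral>y. (g y - h y) * cnj (w y) \<partial>weighted c) =
       - (\<integral>y. g y * cnj (w y) \<partial>weighted c) - - (\<integral>y. h y * cnj (w y) \<partial>weighted c)"
      by (simp_all only: diff_minus_eq_add minus_diff_eq) (simp_all add: algebra_simps)
    then show "(\<integral>y. (u' y - v' y) * cnj (w' y) \<partial>weighted c) +
       (\<integral>y. complex_of_real (V y) * (u y - v y) * cnj (w y) \<partial>weighted c) = - (\<integral>y. (g y - h y) * cnj (w y) \<partial>weighted c)"
      by (simp only: is_BV_D(5)[OF u d(1) w] is_BV_D(5)[OF v d(2) w])
  qed
qed

text \<open>Test functions belong to the form domain because \<open>V\<close> is locally integrable.\<close>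

lemma is_BV_unique:
  assumes "is_BV c V u g" "is_BV c V u h"
  shows "AE y in weighted c. g y = h y"
proof -
  obtain u' where u': "H1 c u u'" using is_BV_D(1)[OF assms(1)] by blast
  define k where "k y = complex_of_real (y powr c) * (g y - h y)" for y
  have gh: "(\<lambda>y. g y - h y) \<in> L2 c" by (intro L2_diff is_BV_D(3)[OF assms(1)] is_BV_D(3)[OF assms(2)])
  have "AE y in lborel. 0 < y \<longrightarrow> k y = 0"
  proof (rule AE_zero_of_test_functions)
    show "locally_integrable k" unfolding k_def by (rule L2_imp_locally_integrable_weighted[OF gh])
    fix \<phi> assume \<phi>: "\<phi> \<in> Cc_infty {0<..}"
    obtain \<phi>' where d: "\<And>x. 0 < x \<Longrightarrow> (\<phi> has_vector_derivative \<phi>' x) (at x)"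
      by (rule test_function_derivative[OF \<phi>]) blast
    note t = test_function_H1[OF \<phi> d]
    then have tL: "(\<lambda>y. cnj (\<phi> y)) \<in> L2 c" by (simp add: H1_def)
    have "(LBINT y:{0<..}. k y * \<phi> y) = (\<integral>y. (g y - h y) * cnj (cnj (\<phi> y)) \<partial>weighted c)"
      unfolding integral_weighted k_def by (simp add: scaleR_conv_of_real mult.assoc)
    also have "\<dots> = (\<integral>y. g y * cnj (cnj (\<phi> y)) \<partial>weighted c) - (\<integral>y. h y * cnj (cnj (\<phi> y)) \<partial>weighted c)"
      unfolding left_diff_distrib
      by (intro Bochner_Integration.integral_diff L2_mult_cnj_integrable is_BV_D(3)[OF assms(1)] is_BV_D(3)[OF assms(2)] tL)
    also have "\<dots> = 0"
      using is_BV_D(5)[OF assms(1) u' t] is_BV_D(5)[OF assms(2) u' t] by simp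
    finally show "(LBINT y:{0<..}. k y * \<phi> y) = 0" .
  qed
  then show ?thesis unfolding AE_weighted by eventually_elim (auto simp: k_def)
qed

lemma graph_norm_eq:
  assumes "is_BV c V u g"
  shows "graph_norm c V u = L2_norm c u + L2_norm c g"
proof -
  have o: "is_BV c V u (op_BV c V u)"
    unfolding op_BV_def by (rule someI[of "is_BV c V u"]) fact
  have "L2_norm c (op_BV c V u) = L2_norm c g"
    by (rule L2_norm_cong_AE[OF is_BV_D(3)[OF o] is_BV_D(3)[OF assms] is_BV_unique[OF o assms]])
  then show ?thesis by (simp add: graph_norm_def)
qed

lemma is_BV_cong_AE:
  assumes "is_BV c V u g" "AE y in weighted c. u y = v y" "H1 c u u'" "H1 c v u'"
  shows "is_BV c V v g"
proof -
  have m: "u \<in> borel_measurable (weighted c)" "v \<in> borel_measurable (weighted c)"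
    using assms(3,4) by (auto simp: H1_def L2_measurable)
  have e: "finite_energy v"
    using is_BV_D(2)[OF assms(1)] finite_energy_cong_AE[OF assms(2) m] by simp
  show ?thesis
  proof (rule is_BV_I[OF assms(4) e is_BV_D(3)[OF assms(1)]])
    fix f f' assume f: "H1 c f f'" "finite_energy f"
    then have fm: "f \<in> borel_measurable (weighted c)" by (simp add: H1_def L2_measurable)
    have "(\<integral>y. complex_of_real (V y) * v y * cnj (f y) \<partial>weighted c) = (\<integral>y. complex_of_real (V y) * u y * cnj (f y) \<partial>weighted c)"
      by (rule integral_cong_AE)
         (use assms(2) potential_term_integrable[OF e f(2) m(2) fm]
            potential_term_integrable[OF is_BV_D(2)[OF assms(1)] f(2) m(1) fm] in
          \<open>auto intro: borel_measurable_integrable elim!: eventually_mono\<close>)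
    then show "(\<integral>y. u' y * cnj (f' y) \<partial>weighted c) + (\<integral>y. complex_of_real (V y) * v y * cnj (f y) \<partial>weighted c) =
       - (\<integral>y. g y * cnj (f y) \<partial>weighted c)"
      using is_BV_D(5)[OF assms(1,3) f] by simp
  qed
qed

end

section \<open>Regularity in the domain of the operator\<close>

lemma locally_integrable_add:
  "locally_integrable f \<Longrightarrow> locally_integrable g \<Longrightarrow> locally_integrable (\<lambda>x. f x + g x)"
  unfolding locally_integrable_def by (auto intro: set_integral_add)

lemma is_primitive_cong_AE:
  assumes "is_primitive u g" "locally_integrable h" "AE x in lborel. 0 < x \<longrightarrow> g x = h x"
  shows "is_primitive u h"
  unfolding is_primitive_def
proof (intro conjI allI impI assms(2))
  fix a b :: real assume ab: "0 < a" "a < b"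
  have g: "locally_integrable g" using assms(1) by (simp add: is_primitive_def)
  have "(LBINT t:{a<..<b}. g t) = (LBINT t:{a<..<b}. h t)"
    unfolding set_lebesgue_integral_def
  proof (rule integral_cong_AE)
    show "(\<lambda>t. indicator {a<..<b} t *\<^sub>R g t) \<in> borel_measurable lborel"
      "(\<lambda>t. indicator {a<..<b} t *\<^sub>R h t) \<in> borel_measurable lborel"
      using locally_integrableD(2)[OF g ab(1)] locally_integrableD(2)[OF assms(2) ab(1)]
      unfolding set_integrable_def by (auto intro: borel_measurable_integrable)
    show "AE t in lborel. indicator {a<..<b} t *\<^sub>R g t = indicator {a<..<b} t *\<^sub>R h t"
      using assms(3) by eventually_elim (use ab in \<open>auto simp: indicator_def\<close>)
  qed
  with assms(1) ab show "u b - u a = (LBINT t:{a<..<b}. h t)" by (simp add: is_primitive_def)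
qed

lemma derivative_zero_beyond:
  fixes w w1 :: "real \<Rightarrow> complex"
  assumes "\<And>y. 0 < y \<Longrightarrow> (w has_vector_derivative w1 y) (at y)" "continuous_on {0<..} w1"
    and "\<And>y. r \<le> y \<Longrightarrow> w y = 0" "0 < r" "r \<le> y"
  shows "w1 y = 0"
proof (rule AE_zero_imp_zero[OF assms(2) AE_I2 assms(4,5)])
  show "r < y \<longrightarrow> w1 y = 0" for y
  proof
    assume "r < y"
    have "(w has_vector_derivative 0) (at y)"
      by (rule has_vector_derivative_transform_within_open[of "\<lambda>_. 0" _ _ "{r<..}"]) (use assms(3) \<open>r < y\<close> in auto)
    moreover have "(w has_vector_derivative w1 y) (at y)"
      by (rule assms(1)) (use assms(4) \<open>r < y\<close> in linarith)
    ultimately show "w1 y = 0" by (rule vector_derivative_unique_at[symmetric])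
  qed
qed

context potential
begin

lemma potential_times_integrable:
  assumes "finite_energy u" "u \<in> borel_measurable (weighted c)" "0 < R"
  shows "integrable (weighted c) (\<lambda>y. indicator {0<..R} y *\<^sub>R (complex_of_real (V y) * u y))"
proof (rule Bochner_Integration.integrable_bound)
  show "integrable (weighted c) (\<lambda>y. indicator {0<..R} y * V y + V y * (norm (u y))\<^sup>2)"
    using assms by (intro Bochner_Integration.integrable_add V_integrable) (auto simp: finite_energy_def)
  have "(\<lambda>y. indicator {0<..R} y :: real) \<in> borel_measurable (weighted c)"
    by (rule measurable_weightedI) simp
  then show "(\<lambda>y. indicator {0<..R} y *\<^sub>R (complex_of_real (V y) * u y)) \<in> borel_measurable (weighted c)"
    using assms(2) V_measurable by measurable
  show "AE y in weighted c. norm (indicator {0<..R} y *\<^sub>R (complex_of_real (V y) * u y)) \<le>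
      norm (indicator {0<..R} y * V y + V y * (norm (u y))\<^sup>2)"
    using V_nonneg
  proof eventually_elim
    fix y assume V: "0 \<le> V y"
    have "norm (u y) \<le> 1 + (norm (u y))\<^sup>2"
      using zero_le_power2[of "norm (u y) - 1"] norm_ge_zero[of "u y"] unfolding power2_diff by (simp, linarith)
    then have "V y * norm (u y) \<le> V y * (1 + (norm (u y))\<^sup>2)"
      using V by (intro mult_left_mono)
    with V show "norm (indicator {0<..R} y *\<^sub>R (complex_of_real (V y) * u y)) \<le>
      norm (indicator {0<..R} y * V y + V y * (norm (u y))\<^sup>2)"
      by (auto simp: indicator_def norm_mult distrib_left)
  qed
qed

lemma source_locally_integrable:
  assumes "is_BV c V u g"
  shows "locally_integrable (\<lambda>y. complex_of_real (y powr c) * (g y + complex_of_real (V y) * u y))"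
    "locally_integrable (\<lambda>y. complex_of_real (y powr c) * (complex_of_real (V y) * u y))"
proof -
  note um = L2_measurable[OF is_BV_D(4)[OF assms]]
  show 2: "locally_integrable (\<lambda>y. complex_of_real (y powr c) * (complex_of_real (V y) * u y))"
  proof (rule locally_integrable_weighted)
    fix a b :: real assume ab: "0 < a" "a < b"
    have "integrable (weighted c) (\<lambda>y. indicator {0<..b} y *\<^sub>R (complex_of_real (V y) * u y))"
      using potential_times_integrable[OF is_BV_D(2)[OF assms] um] ab by simp
    then have "integrable (weighted c) (\<lambda>y. indicator ({a..b} \<inter> {0<..}) y *\<^sub>R (indicator {0<..b} y *\<^sub>R (complex_of_real (V y) * u y)))"
      by (rule integrable_mult_indicator[rotated]) (simp add: weighted_def sets_restrict_space_iff)
    moreover have "indicator ({a..b} \<inter> {0<..}) y *\<^sub>R (indicator {0<..b} y *\<^sub>R (complex_of_real (V y) * u y)) = indicator {a..b} y *\<^sub>R (complex_of_real (V y) * u y)" for y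
      using ab by (auto simp: indicator_def)
    ultimately show "integrable (weighted c) (\<lambda>y. indicator {a..b} y *\<^sub>R (complex_of_real (V y) * u y))"
      by (simp only:)
  qed
  show "locally_integrable (\<lambda>y. complex_of_real (y powr c) * (g y + complex_of_real (V y) * u y))"
    unfolding distrib_left by (intro locally_integrable_add 2 L2_imp_locally_integrable_weighted is_BV_D(3)[OF assms])
qed

text \<open>Testing with functions from \<open>C\<^sub>c\<^sup>\<infinity>(0,\<infinity>)\<close> shows that \<open>y\<^sup>c u'\<close> has the locally integrable weak derivative
  \<open>y\<^sup>c (g + Vu)\<close>.  Therefore \<open>u'\<close> has a continuous representative, and \<open>u\<close> has a \<open>C\<^sup>1\<close> representative \<open>w\<close>.\<close>

lemma regularity:
  assumes u: "is_BV c V u g"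
  obtains w w1 where "is_BV c V w g" "AE y in weighted c. u y = w y" "H1 c w w1"
    "\<And>y. 0 < y \<Longrightarrow> (w has_vector_derivative w1 y) (at y)" "continuous_on {0<..} w1"
    "is_primitive (\<lambda>y. complex_of_real (y powr c) * w1 y)
        (\<lambda>y. complex_of_real (y powr c) * (g y + complex_of_real (V y) * w y))"
proof -
  obtain u' where u': "H1 c u u'" using is_BV_D(1)[OF u] by blast
  define F where "F y = complex_of_real (y powr c) * (g y + complex_of_real (V y) * u y)" for y
  have F: "locally_integrable F" unfolding F_def by (rule source_locally_integrable[OF u])
  have "has_weak_derivative (\<lambda>y. complex_of_real (y powr c) * u' y) F"
    unfolding has_weak_derivative_def
  proof (intro conjI ballI F)
    show lu': "locally_integrable (\<lambda>y. complex_of_real (y powr c) * u' y)"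
      using u' by (intro L2_imp_locally_integrable_weighted) (simp add: H1_def)
    fix \<phi> assume \<phi>: "\<phi> \<in> Cc_infty {0<..}"
    obtain \<phi>' where d: "\<And>x. 0 < x \<Longrightarrow> (\<phi> has_vector_derivative \<phi>' x) (at x)"
      by (rule test_function_derivative[OF \<phi>]) blast
    note t = test_function_H1[OF \<phi> d]
    have "(LBINT y:{0<..}. F y * \<phi> y) =
       (LBINT y:{0<..}. complex_of_real (y powr c) * g y * \<phi> y) + (LBINT y:{0<..}. complex_of_real (y powr c) * (complex_of_real (V y) * u y) * \<phi> y)"
      unfolding F_def distrib_left distrib_right
      by (intro set_integral_add integrable_mult_test \<phi> source_locally_integrable[OF u]
            L2_imp_locally_integrable_weighted is_BV_D(3)[OF u])
    also have "\<dots> = (\<integral>y. g y * cnj (cnj (\<phi> y)) \<partial>weighted c) + (\<integral>y. complex_of_real (V y) * u y * cnj (cnj (\<phi> y)) \<partial>weighted c)"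
      unfolding integral_weighted by (simp add: scaleR_conv_of_real mult.assoc)
    also have "\<dots> = - (\<integral>y. u' y * cnj (cnj (\<phi>' y)) \<partial>weighted c)"
    proof -
      have *: "g' + b = - a" if "a + b = - g'" for a b g' :: complex
      proof -
        have "g' = - (a + b)" using that by simp
        then show ?thesis by simp
      qed
      show ?thesis by (rule *[OF is_BV_D(5)[OF u u' t]])
    qed
    also have "(\<integral>y. u' y * cnj (cnj (\<phi>' y)) \<partial>weighted c) = (LBINT x:{0<..}. complex_of_real (x powr c) * u' x * vector_derivative \<phi> (at x))"
      unfolding integral_weighted
      by (intro set_lebesgue_integral_cong) (auto simp: scaleR_conv_of_real mult.assoc vector_derivative_at[OF d])
    finally show "(LBINT x:{0<..}. complex_of_real (x powr c) * u' x * vector_derivative \<phi> (at x)) = - (LBINT y:{0<..}. F y * \<phi> y)"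
      by simp
  qed
  then obtain P where P: "is_primitive P F" "AE x in lborel. 0 < x \<longrightarrow> complex_of_real (x powr c) * u' x = P x"
    using weak_derivative_imp_primitive by blast
  define w1 where "w1 y = complex_of_real (y powr (-c)) * P y" for y
  have w1c: "continuous_on {0<..} w1"
    unfolding w1_def by (intro continuous_intros primitive_continuous[OF P(1)]) auto
  have w1u': "AE x in lborel. 0 < x \<longrightarrow> u' x = w1 x"
    using P(2)
  proof eventually_elim
    fix x assume "0 < x \<longrightarrow> complex_of_real (x powr c) * u' x = P x"
    then show "0 < x \<longrightarrow> u' x = w1 x"
      by (auto simp: w1_def powr_minus field_simps)
  qed
  obtain w where w: "is_primitive w u'" "AE y in weighted c. u y = w y" "H1 c w u'"
    by (rule H1_primitive[OF u'])
  have w': "is_primitive w w1"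
    by (rule is_primitive_cong_AE[OF w(1) locally_integrable_continuous[OF w1c] w1u'])
  have w1L: "w1 \<in> L2 c"
    by (rule L2_cong_AE[of u']) (use u' w1u' w1c in \<open>auto simp: H1_def AE_weighted intro: measurable_weighted_continuous\<close>)
  have BV: "is_BV c V w g" by (rule is_BV_cong_AE[OF u w(2) u' w(3)])
  have Fw: "is_primitive P (\<lambda>y. complex_of_real (y powr c) * (g y + complex_of_real (V y) * w y))"
  proof (rule is_primitive_cong_AE[OF P(1) source_locally_integrable(1)[OF BV]])
    show "AE x in lborel. 0 < x \<longrightarrow> F x = complex_of_real (x powr c) * (g x + complex_of_real (V x) * w x)"
      using w(2) unfolding AE_weighted by eventually_elim (simp add: F_def)
  qed
  show ?thesis
  proof (rule that[OF BV w(2)])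
    show "H1 c w w1" using w(3) w1L by (intro primitive_H1[OF w']) (simp_all add: H1_def)
    show "(w has_vector_derivative w1 y) (at y)" if "0 < y" for y
      by (rule primitive_has_derivative[OF w' w1c that])
    have "complex_of_real (y powr c) * w1 y = P y" if "0 < y" for y
      using that by (simp add: w1_def powr_minus flip: mult.assoc of_real_mult)
    then show "is_primitive (\<lambda>y. complex_of_real (y powr c) * w1 y)
        (\<lambda>y. complex_of_real (y powr c) * (g y + complex_of_real (V y) * w y))"
      using Fw unfolding is_primitive_def by (simp add: less_trans)
  qed fact
qed

end

section \<open>Kato's inequality and the Green function\<close>

definition antideriv :: "real \<Rightarrow> real \<Rightarrow> real" where
  "antideriv c t = (if c = 1 then ln t else t powr (1 - c) / (1 - c))"

lemma antideriv_has_derivative: "0 < t \<Longrightarrow> (antideriv c has_real_derivative t powr (-c)) (at t)"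
  by (cases "c = 1")
     (auto simp: antideriv_def[abs_def] powr_minus inverse_eq_divide intro!: derivative_eq_intros)

lemma antideriv_mono:
  assumes "0 < s" "s \<le> t"
  shows "antideriv c s \<le> antideriv c t"
proof (rule DERIV_nonneg_imp_nondecreasing[OF assms(2)])
  fix x assume "s \<le> x"
  with assms show "\<exists>y. (antideriv c has_real_derivative y) (at x) \<and> 0 \<le> y"
    by (intro exI[of _ "x powr (-c)"] conjI antideriv_has_derivative) auto
qed

text \<open>The integral of \<open>t\<^sup>-\<^sup>c\<close> from \<open>max y s\<close> to \<open>r\<close>, for \<open>y < r\<close>; it is zero for \<open>s \<ge> r\<close>.  As a function of \<open>s\<close> it is constant
  below \<open>y\<close> (the Neumann condition) and satisfies \<open>s\<^sup>c G'(s) = -1\<close> between \<open>y\<close> and \<open>r\<close>.\<close>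

definition green :: "real \<Rightarrow> real \<Rightarrow> real \<Rightarrow> real \<Rightarrow> real" where
  "green c r y s = antideriv c r - antideriv c (max y (min s r))"

lemma continuous_antideriv: "continuous_on {0<..} (antideriv c)"
  by (intro continuous_at_imp_continuous_on ballI DERIV_isCont[OF antideriv_has_derivative]) auto

lemma green_bounds:
  assumes "0 < y" "y < r"
  shows "0 \<le> green c r y s" "green c r y s \<le> antideriv c r - antideriv c y"
  using assms by (auto simp: green_def intro!: antideriv_mono)

lemma green_beyond: "y < r \<Longrightarrow> r \<le> s \<Longrightarrow> green c r y s = 0"
  by (simp add: green_def)

lemma continuous_green: "0 < y \<Longrightarrow> continuous_on S (green c r y)"
  unfolding green_def[abs_def]
  by (intro continuous_intros continuous_on_compose2[OF continuous_antideriv]) auto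

lemma green_has_derivative:
  assumes "0 < y" "y < r" "s \<notin> {y, r}"
  shows "(green c r y has_real_derivative - (indicator {y<..<r} s * s powr (-c))) (at s)"
proof -
  consider "s < y" | "y < s" "s < r" | "r < s" using assms by fastforce
  then show ?thesis
  proof cases
    case 1
    have "(green c r y has_real_derivative 0) (at s)"
      by (rule has_field_derivative_transform_within_open[of "\<lambda>_. antideriv c r - antideriv c y" _ _ "{..<y}"])
         (use 1 assms in \<open>auto simp: green_def\<close>)
    with 1 show ?thesis by simp
  next
    case 2
    have "((\<lambda>s. antideriv c r - antideriv c s) has_real_derivative 0 - s powr (-c)) (at s)"
      using 2 assms by (intro derivative_intros antideriv_has_derivative) auto
    then have "(green c r y has_real_derivative 0 - s powr (-c)) (at s)"
      by (rule has_field_derivative_transform_within_open[of _ _ _ "{y<..<r}"])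
         (use 2 in \<open>auto simp: green_def\<close>)
    with 2 show ?thesis by simp
  next
    case 3
    have "(green c r y has_real_derivative 0) (at s)"
      by (rule has_field_derivative_transform_within_open[of "\<lambda>_. 0" _ _ "{r<..}"])
         (use 3 assms in \<open>auto simp: green_def\<close>)
    with 3 show ?thesis by simp
  qed
qed

lemma kato_derivative:
  fixes w :: "real \<Rightarrow> complex"
  assumes w: "(w has_vector_derivative w1) (at s)" and e: "e > 0"
  defines "f \<equiv> \<lambda>s. sqrt ((norm (w s))\<^sup>2 + e\<^sup>2)"
  shows "(f has_real_derivative Re (cnj (w s) * w1) / f s) (at s)"
    and "((\<lambda>s. w s / complex_of_real (f s)) has_vector_derivative
          w1 / complex_of_real (f s) - w s * complex_of_real (Re (cnj (w s) * w1) / f s ^ 3)) (at s)"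
proof -
  have fpos: "f s > 0" for s using e by (simp add: f_def add_nonneg_pos)
  have re: "((\<lambda>s. Re (w s)) has_real_derivative Re w1) (at s)" "((\<lambda>s. Im (w s)) has_real_derivative Im w1) (at s)"
    using bounded_linear.has_vector_derivative[OF bounded_linear_Re w] bounded_linear.has_vector_derivative[OF bounded_linear_Im w]
    by (simp_all add: has_real_derivative_iff_has_vector_derivative)
  have "((\<lambda>s. (Re (w s))\<^sup>2 + (Im (w s))\<^sup>2 + e\<^sup>2) has_real_derivative 2 * Re (cnj (w s) * w1)) (at s)"
    using DERIV_add[OF DERIV_add[OF DERIV_power[OF re(1), of 2] DERIV_power[OF re(2), of 2]] DERIV_const[of "e\<^sup>2"]]
    by (simp add: algebra_simps)
  note inner = this
  have "(Re (w s))\<^sup>2 + (Im (w s))\<^sup>2 + e\<^sup>2 > 0" using e by (simp add: add_nonneg_pos)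
  from DERIV_chain2[OF DERIV_real_sqrt[OF this] inner]
  have "((\<lambda>s. sqrt ((Re (w s))\<^sup>2 + (Im (w s))\<^sup>2 + e\<^sup>2)) has_real_derivative
      Re (cnj (w s) * w1) * inverse (sqrt ((Re (w s))\<^sup>2 + (Im (w s))\<^sup>2 + e\<^sup>2))) (at s)"
    by (rule DERIV_cong) simp
  then show f: "(f has_real_derivative Re (cnj (w s) * w1) / f s) (at s)"
    by (simp add: f_def[abs_def] cmod_power2 divide_inverse)
  have "((\<lambda>s. inverse (f s)) has_real_derivative - (inverse (f s) * (Re (cnj (w s) * w1) / f s) * inverse (f s))) (at s)"
    by (rule DERIV_inverse'[OF f]) (use fpos[of s] in simp)
  then have "((\<lambda>s. complex_of_real (inverse (f s))) has_vector_derivative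
      complex_of_real (- (inverse (f s) * (Re (cnj (w s) * w1) / f s) * inverse (f s)))) (at s)"
    by (intro has_vector_derivative_of_real) (simp only: has_real_derivative_iff_has_vector_derivative)
  from has_vector_derivative_mult[OF w this]
  show "((\<lambda>s. w s / complex_of_real (f s)) has_vector_derivative
          w1 / complex_of_real (f s) - w s * complex_of_real (Re (cnj (w s) * w1) / f s ^ 3)) (at s)"
    by (simp add: divide_inverse power3_eq_cube algebra_simps)
qed

text \<open>For complex valued \<open>w\<close> the derivative of the sign \<open>w/f\<close> is \<open>w'/f\<close> minus a real multiple of \<open>w\<close>, and the
  claim reduces to \<open>\<bar>Re (cnj w * w')\<bar> \<le> f * \<bar>w'\<bar>\<close>.\<close>

lemma kato_inequality:
  fixes w w1 :: complex
  assumes "norm w \<le> f" "f > 0"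
  shows "0 \<le> Re (w1 * cnj (w1 / complex_of_real f - w * complex_of_real (Re (cnj w * w1) / f ^ 3)))"
proof -
  define \<rho> where "\<rho> = Re (cnj w * w1)"
  have "\<bar>\<rho>\<bar> \<le> norm (cnj w * w1)" unfolding \<rho>_def by (rule abs_Re_le_cmod)
  also have "\<dots> \<le> f * norm w1" using assms by (simp add: norm_mult mult_right_mono)
  finally have "\<rho>\<^sup>2 \<le> (f * norm w1)\<^sup>2" by (rule abs_le_square_iff[THEN iffD1, OF order_trans[OF _ abs_ge_self]])
  then have "\<rho>\<^sup>2 / f ^ 3 \<le> (f * norm w1)\<^sup>2 / f ^ 3" using assms by (intro divide_right_mono) auto
  also have "\<dots> = (norm w1)\<^sup>2 / f" using assms by (simp add: power2_eq_square power3_eq_cube)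
  finally have "\<rho>\<^sup>2 / f ^ 3 \<le> (norm w1)\<^sup>2 / f" .
  moreover have "Re (w1 * cnj (w1 / complex_of_real f - w * complex_of_real (\<rho> / f ^ 3))) = (norm w1)\<^sup>2 / f - \<rho>\<^sup>2 / f ^ 3"
  proof -
    have "Re (w1 * cnj (w1 / complex_of_real f)) = (norm w1)\<^sup>2 / f"
      unfolding cmod_power2 by (simp add: power2_eq_square add_divide_distrib)
    moreover have "Re (w1 * cnj (w * complex_of_real (\<rho> / f ^ 3))) = \<rho> * (\<rho> / f ^ 3)"
      by (simp add: \<rho>_def algebra_simps)
    ultimately show ?thesis
      by (simp only: complex_cnj_diff right_diff_distrib minus_complex.simps) (simp add: power2_eq_square)
  qed
  ultimately show ?thesis by (simp add: \<rho>_def)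
qed

lemma green_L2:
  assumes "c > -1" "0 < y" "y < r"
  shows "(\<lambda>s. complex_of_real (green c r y s)) \<in> L2 c"
  by (rule bounded_support_L2[where R = r and B = "antideriv c r - antideriv c y"])
     (use assms green_bounds[OF assms(2,3)] green_beyond[OF assms(3)] in
       \<open>auto intro!: measurable_weighted_continuous continuous_on_of_real continuous_green simp: abs_of_nonneg\<close>)

context potential
begin

text \<open>The test function is \<open>v = \<beta> \<psi>\<close> with \<open>\<beta> = w/f\<close>, \<open>f = sqrt(\<bar>w\<bar>\<^sup>2 + e\<^sup>2)\<close> and the Green function \<open>\<psi>\<close>.  In the
  real part of the form, the terms with \<open>\<beta>' \<psi>\<close> and with \<open>V\<close> are nonnegative and can be dropped.  What
  remains is the integral of \<open>f' \<psi>' s\<^sup>c\<close>, and as \<open>\<psi>' s\<^sup>c = -1\<close> on \<open>(y,r)\<close> this is \<open>f(y) - f(r) = f(y) - e\<close>.  On the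
  other side \<open>\<bar>\<beta>\<bar> \<le> 1\<close>.\<close>

lemma kato_estimate:
  assumes w: "is_BV c V w g" "H1 c w w1" and d: "\<And>y. 0 < y \<Longrightarrow> (w has_vector_derivative w1 y) (at y)"
    and w1c: "continuous_on {0<..} w1" and r: "\<And>y. r \<le> y \<Longrightarrow> w y = 0" and y: "0 < y" "y < r"
  shows "norm (w y) \<le> (\<integral>s. norm (g s) * green c r y s \<partial>weighted c)"
proof (rule field_le_epsilon)
  fix e :: real assume e: "e > 0"
  let ?M = "weighted c"
  define f where "f s = sqrt ((norm (w s))\<^sup>2 + e\<^sup>2)" for s
  \<comment> \<open>The sign of \<open>w\<close>, regularized.\<close>
  define \<beta> where "\<beta> s = w s / complex_of_real (f s)" for s
  define \<beta>' where "\<beta>' s = w1 s / complex_of_real (f s) - w s * complex_of_real (Re (cnj (w s) * w1 s) / f s ^ 3)" for s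
  define \<psi> where "\<psi> s = complex_of_real (green c r y s)" for s
  define D where "D s = complex_of_real (- (indicator {y<..<r} s * s powr (-c)))" for s
  define v where "v s = \<beta> s * \<psi> s" for s
  define v' where "v' s = \<beta> s * D s + \<beta>' s * \<psi> s" for s
  define B where "B = antideriv c r - antideriv c y"
  have B: "0 \<le> B" "norm (\<psi> s) \<le> B" for s
    using green_bounds[OF y, of c s] by (auto simp: B_def \<psi>_def)
  have fe: "e \<le> f s" "norm (w s) \<le> f s" for s
    unfolding f_def using e by (auto intro!: real_le_rsqrt)
  then have fpos: "f s > 0" for s using e less_le_trans by blast
  have f0: "f s \<noteq> 0" for s using fpos[of s] by simp
  have \<beta>1: "norm (\<beta> s) \<le> 1" for s
    using fe[of s] fpos[of s] by (simp add: \<beta>_def norm_divide)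
  have wc: "continuous_on {0<..} w"
    using d by (intro continuous_at_imp_continuous_on ballI has_vector_derivative_continuous) auto
  have fc: "continuous_on {0<..} f" unfolding f_def by (intro continuous_intros wc)
  have \<beta>c: "continuous_on {0<..} \<beta>" unfolding \<beta>_def by (intro continuous_intros wc fc) (simp add: f0)
  have \<beta>'c: "continuous_on {0<..} \<beta>'" unfolding \<beta>'_def by (intro continuous_intros wc fc w1c) (simp_all add: f0)
  have \<psi>c: "continuous_on {0<..} \<psi>" unfolding \<psi>_def by (intro continuous_intros continuous_green y)
  have Dm: "D \<in> borel_measurable ?M" unfolding D_def by (intro measurable_weightedI) measurable
  have wL: "w \<in> L2 c" "w1 \<in> L2 c" using w(2) by (auto simp: H1_def)
  have \<beta>'b: "norm (\<beta>' s) \<le> 2 / e * norm (w1 s)" for s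
  proof -
    have "norm (w s * complex_of_real (Re (cnj (w s) * w1 s) / f s ^ 3)) = norm (w s) * (\<bar>Re (cnj (w s) * w1 s)\<bar> / f s ^ 3)"
      using fpos[of s] by (simp only: norm_mult norm_of_real abs_divide abs_of_pos zero_less_power)
    also have "\<dots> \<le> f s * ((f s * norm (w1 s)) / f s ^ 3)"
    proof (intro mult_mono divide_right_mono)
      have "\<bar>Re (cnj (w s) * w1 s)\<bar> \<le> norm (cnj (w s) * w1 s)" by (rule abs_Re_le_cmod)
      also have "\<dots> \<le> f s * norm (w1 s)" using fe(2)[of s] by (simp add: norm_mult mult_right_mono)
      finally show "\<bar>Re (cnj (w s) * w1 s)\<bar> \<le> f s * norm (w1 s)" .
    qed (use fpos[of s] fe(2)[of s] in auto)
    also have "\<dots> = norm (w1 s) / f s" using f0[of s] by (simp add: power3_eq_cube)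
    finally have "norm (\<beta>' s) \<le> norm (w1 s) / f s + norm (w1 s) / f s"
      unfolding \<beta>'_def using norm_triangle_ineq4[of "w1 s / complex_of_real (f s)" "w s * complex_of_real (Re (cnj (w s) * w1 s) / f s ^ 3)"] fpos[of s]
      by (simp add: norm_divide)
    also have "\<dots> \<le> norm (w1 s) / e + norm (w1 s) / e"
      using fe(1)[of s] e by (intro add_mono divide_left_mono) auto
    finally show ?thesis by simp
  qed
  have vc: "continuous_on {0<..} v" unfolding v_def by (intro continuous_intros \<beta>c \<psi>c)
  have vm: "v \<in> borel_measurable ?M" by (rule measurable_weighted_continuous[OF vc])
  have vB: "norm (v s) \<le> B" for s
    using mult_mono[OF \<beta>1[of s] B(2)[of s]] by (simp add: v_def norm_mult)
  have vr: "v s = 0" if "r \<le> s" for s using green_beyond[OF y(2) that] by (simp add: v_def \<psi>_def)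
  have vL: "v \<in> L2 c" by (rule bounded_support_L2[OF c vm, of r B]) (use vB vr y in auto)
  have vE: "finite_energy v" by (rule finite_energy_bounded_support[OF vm, of r B]) (use vB vr y in auto)
  have "continuous_on {y..r} (\<lambda>s. s powr (-c))" using y by (intro continuous_intros) auto
  then have "bounded ((\<lambda>s. s powr (-c)) ` {y..r})"
    by (intro compact_imp_bounded compact_continuous_image) auto
  then obtain C where C: "\<And>s. s \<in> {y..r} \<Longrightarrow> norm (s powr (-c)) \<le> C" unfolding bounded_iff by blast
  then have C0: "0 \<le> C" using y by (metis atLeastAtMost_iff less_eq_real_def norm_ge_zero order_trans order_refl)
  have DC: "norm (D s) \<le> C" for s
    using C[of s] C0 by (auto simp: D_def indicator_def)
  have \<beta>DL: "(\<lambda>s. \<beta> s * D s) \<in> L2 c"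
  proof (rule bounded_support_L2[OF c])
    show "(\<lambda>s. \<beta> s * D s) \<in> borel_measurable ?M"
      by (intro borel_measurable_times Dm measurable_weighted_continuous \<beta>c)
    show "norm (\<beta> s * D s) \<le> C" for s
      using mult_mono[OF \<beta>1[of s] DC[of s]] by (simp add: norm_mult)
    show "\<beta> s * D s = 0" if "r \<le> s" for s using that by (simp add: D_def)
  qed (use y in auto)
  have \<beta>'\<psi>L: "(\<lambda>s. \<beta>' s * \<psi> s) \<in> L2 c"
  proof (rule L2_bound(1)[OF L2_cmult(1)[OF wL(2), of "complex_of_real (2 / e * B)"]])
    show "(\<lambda>s. \<beta>' s * \<psi> s) \<in> borel_measurable ?M"
      by (intro measurable_weighted_continuous continuous_intros \<beta>'c \<psi>c)
    show "AE s in ?M. norm (\<beta>' s * \<psi> s) \<le> norm (complex_of_real (2 / e * B) * w1 s)"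
    proof (rule AE_I2)
      fix s
      have "norm (\<beta>' s) * norm (\<psi> s) \<le> (2 / e * norm (w1 s)) * B"
        using B e by (intro mult_mono \<beta>'b) auto
      then show "norm (\<beta>' s * \<psi> s) \<le> norm (complex_of_real (2 / e * B) * w1 s)"
        using B e by (simp add: norm_mult norm_divide mult.commute mult.left_commute)
    qed
  qed
  have v'L: "v' \<in> L2 c" unfolding v'_def by (rule L2_add[OF \<beta>DL \<beta>'\<psi>L])
  have vd: "(v has_vector_derivative v' s) (at s)" if "0 < s" "s \<notin> {y, r}" for s
  proof -
    have "(\<psi> has_vector_derivative D s) (at s)"
      unfolding \<psi>_def D_def using green_has_derivative[OF y that(2), of c]
      by (intro has_vector_derivative_of_real) (simp add: has_real_derivative_iff_has_vector_derivative)
    moreover have "(\<beta> has_vector_derivative \<beta>' s) (at s)"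
      unfolding \<beta>_def \<beta>'_def f_def by (rule kato_derivative(2)[OF d[OF that(1)] e])
    ultimately show ?thesis unfolding v_def v'_def by (intro has_vector_derivative_mult)
  qed
  have "is_primitive v v'"
    by (rule primitiveI[OF vc L2_imp_locally_integrable[OF v'L], of "{y, r}"]) (use vd in auto)
  then have vH: "H1 c v v'" by (rule primitive_H1[OF _ vL v'L])
  have i1: "integrable ?M (\<lambda>s. w1 s * cnj (v' s))" by (intro L2_mult_cnj_integrable wL v'L)
  have i2: "integrable ?M (\<lambda>s. complex_of_real (V s) * w s * cnj (v s))"
    by (intro potential_term_integrable is_BV_D(2)[OF w(1)] vE vm L2_measurable wL)
  have i3: "integrable ?M (\<lambda>s. w1 s * cnj (\<beta> s * D s))" by (intro L2_mult_cnj_integrable wL \<beta>DL)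
  have gL: "g \<in> L2 c" by (rule is_BV_D(3)[OF w(1)])
  \<comment> \<open>Dropping the two nonnegative terms; this is where \<open>V \<ge> 0\<close> enters.\<close>
  have le: "AE s in ?M. Re (w1 s * cnj (\<beta> s * D s)) \<le> Re (w1 s * cnj (v' s)) + Re (complex_of_real (V s) * w s * cnj (v s))"
    using V_nonneg
  proof eventually_elim
    fix s assume V: "0 \<le> V s"
    have "0 \<le> Re (w1 s * cnj (\<beta>' s))"
      unfolding \<beta>'_def by (rule kato_inequality[OF fe(2) fpos])
    then have "0 \<le> Re (w1 s * cnj (\<beta>' s)) * green c r y s"
      using green_bounds(1)[OF y] by (intro mult_nonneg_nonneg)
    moreover have "Re (w1 s * cnj (v' s)) = Re (w1 s * cnj (\<beta> s * D s)) + Re (w1 s * cnj (\<beta>' s)) * green c r y s"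
      by (simp add: v'_def \<psi>_def algebra_simps)
    moreover have "Re (complex_of_real (V s) * w s * cnj (v s)) = V s * (norm (w s))\<^sup>2 / f s * green c r y s"
    proof -
      have "complex_of_real (V s) * w s * cnj (v s) = complex_of_real (V s / f s * green c r y s) * (w s * cnj (w s))"
        by (simp add: v_def \<beta>_def \<psi>_def field_simps f0)
      also have "\<dots> = complex_of_real (V s / f s * green c r y s * (norm (w s))\<^sup>2)"
        by (simp only: complex_norm_square[symmetric] of_real_mult)
      finally show ?thesis by (simp add: mult_ac)
    qed
    moreover have "0 \<le> V s * (norm (w s))\<^sup>2 / f s * green c r y s"
      using V fpos[of s] green_bounds(1)[OF y, of c s] by simp
    ultimately show "Re (w1 s * cnj (\<beta> s * D s)) \<le> Re (w1 s * cnj (v' s)) + Re (complex_of_real (V s) * w s * cnj (v s))"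
      by linarith
  qed
  have "f y - e \<le> (\<integral>s. norm (g s) * green c r y s \<partial>?M)"
  proof -
    have "(\<integral>s. Re (w1 s * cnj (\<beta> s * D s)) \<partial>?M) = f y - e"
    proof -
      have "(\<integral>s. complex_of_real (Re (w1 s * cnj (\<beta> s * D s))) \<partial>?M) =
          (LBINT s:{y<..<r}. - complex_of_real (Re (cnj (w s) * w1 s) / f s))"
        unfolding integral_weighted set_lebesgue_integral_def
      proof (intro Bochner_Integration.integral_cong refl)
        fix s
        show "indicator {0<..} s *\<^sub>R s powr c *\<^sub>R complex_of_real (Re (w1 s * cnj (\<beta> s * D s))) =
          indicator {y<..<r} s *\<^sub>R (- complex_of_real (Re (cnj (w s) * w1 s) / f s))"
        proof (cases "s \<in> {y<..<r}")
          case True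
          then have "s powr c * s powr (-c) = 1" using y by (simp flip: powr_add)
          moreover have "Re (w1 s * cnj (\<beta> s * D s)) = - (s powr (-c)) * (Re (cnj (w s) * w1 s) / f s)"
            using True by (simp add: \<beta>_def D_def field_simps f0)
          ultimately have "s powr c * Re (w1 s * cnj (\<beta> s * D s)) = - (Re (cnj (w s) * w1 s) / f s)"
            by (metis (no_types, lifting) mult.assoc mult_minus_left mult_minus_right mult_1)
          then have "s powr c *\<^sub>R complex_of_real (Re (w1 s * cnj (\<beta> s * D s))) = - complex_of_real (Re (cnj (w s) * w1 s) / f s)"
            by (simp only: scaleR_conv_of_real of_real_mult[symmetric] of_real_minus[symmetric])
          moreover have "indicator {0<..} s = (1 :: real)" "indicator {y<..<r} s = (1 :: real)" using True y by auto
          ultimately show ?thesis by (simp only: scaleR_one)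
        qed (simp add: D_def)
      qed
      also have "\<dots> = - complex_of_real (f r) - - complex_of_real (f y)"
      proof (rule set_integral_FTC)
        show "continuous_on {y..r} (\<lambda>s. - complex_of_real (Re (cnj (w s) * w1 s) / f s))"
          by (rule continuous_on_subset[of "{0<..}"]) (use y f0 in \<open>auto intro!: continuous_intros wc w1c fc\<close>)
        show "((\<lambda>s. - complex_of_real (f s)) has_vector_derivative - complex_of_real (Re (cnj (w s) * w1 s) / f s)) (at s)" if "y \<le> s" for s
          using kato_derivative(1)[OF d e, of s] that y unfolding f_def
          by (intro has_vector_derivative_minus has_vector_derivative_of_real)
             (simp add: has_real_derivative_iff_has_vector_derivative)
      qed (use y in auto)
      also have "f r = e" using r[of r] e by (simp add: f_def)
      finally have "complex_of_real (\<integral>s. Re (w1 s * cnj (\<beta> s * D s)) \<partial>?M) = complex_of_real (f y - e)"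
        by (simp only: integral_complex_of_real) simp
      then show ?thesis by (simp only: of_real_eq_iff)
    qed
    moreover have "(\<integral>s. Re (w1 s * cnj (\<beta> s * D s)) \<partial>?M) \<le>
        (\<integral>s. Re (w1 s * cnj (v' s)) + Re (complex_of_real (V s) * w s * cnj (v s)) \<partial>?M)"
      by (intro integral_mono_AE integrable_Re i3 Bochner_Integration.integrable_add i1 i2 le)
    moreover have "\<dots> = Re ((\<integral>s. w1 s * cnj (v' s) \<partial>?M) + (\<integral>s. complex_of_real (V s) * w s * cnj (v s) \<partial>?M))"
      unfolding Bochner_Integration.integral_add[OF integrable_Re[OF i1] integrable_Re[OF i2]] integral_Re[OF i1] integral_Re[OF i2]
      by (rule plus_complex.simps(1)[symmetric])
    moreover have "\<dots> = Re (- (\<integral>s. g s * cnj (v s) \<partial>?M))"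
      by (simp only: is_BV_D(5)[OF w vH vE])
    moreover have "\<dots> \<le> norm (\<integral>s. g s * cnj (v s) \<partial>?M)"
      using complex_Re_le_cmod[of "- (\<integral>s. g s * cnj (v s) \<partial>?M)"] by simp
    moreover have "\<dots> \<le> (\<integral>s. norm (g s * cnj (v s)) \<partial>?M)" by (rule integral_norm_bound)
    moreover have "\<dots> \<le> (\<integral>s. norm (g s) * green c r y s \<partial>?M)"
    proof (rule integral_mono)
      show "integrable ?M (\<lambda>s. norm (g s * cnj (v s)))"
        by (intro integrable_norm L2_mult_cnj_integrable gL vL)
      show "integrable ?M (\<lambda>s. norm (g s) * green c r y s)"
        using L2_norm_mult_integrable[OF gL green_L2[OF c y]] green_bounds(1)[OF y] by simp
      show "norm (g s * cnj (v s)) \<le> norm (g s) * green c r y s" for s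
        using mult_right_mono[OF \<beta>1[of s] green_bounds(1)[OF y, of c s]] green_bounds(1)[OF y, of c s]
        by (simp add: v_def \<psi>_def norm_mult mult_left_mono)
    qed
    ultimately show ?thesis by linarith
  qed
  with fe(2)[of y] show "norm (w y) \<le> (\<integral>s. norm (g s) * green c r y s \<partial>?M) + e" by linarith
qed

lemma pointwise_estimate:
  assumes "is_BV c V w g" "H1 c w w1" and "\<And>y. 0 < y \<Longrightarrow> (w has_vector_derivative w1 y) (at y)"
    and "continuous_on {0<..} w1" and "\<And>y. r \<le> y \<Longrightarrow> w y = 0" and y: "0 < y" "y < r"
  shows "norm (w y) \<le> L2_norm c g * L2_norm c (\<lambda>s. complex_of_real (green c r y s))"
proof -
  have "norm (w y) \<le> (\<integral>s. norm (g s) * green c r y s \<partial>weighted c)"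
    by (rule kato_estimate[OF assms])
  also have "\<dots> = (\<integral>s. norm (g s) * norm (complex_of_real (green c r y s)) \<partial>weighted c)"
    using green_bounds(1)[OF y] by simp
  also have "\<dots> \<le> L2_norm c g * L2_norm c (\<lambda>s. complex_of_real (green c r y s))"
    by (intro L2_Cauchy_Schwarz is_BV_D(3)[OF assms(1)] green_L2 c y)
  finally show ?thesis .
qed

end

section \<open>The size of the Green function and the multiplier bound\<close>

lemma has_weak_derivative_cong_AE:
  assumes "has_weak_derivative w w1" "AE x in lborel. 0 < x \<longrightarrow> u x = w x" "locally_integrable u"
  shows "has_weak_derivative u w1"
  unfolding has_weak_derivative_def
proof (intro conjI ballI assms(3))
  show "locally_integrable w1" using assms(1) by (simp add: has_weak_derivative_def)
  have lw: "locally_integrable w" using assms(1) by (simp add: has_weak_derivative_def)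
  fix \<phi> assume \<phi>: "\<phi> \<in> Cc_infty {0<..}"
  obtain \<phi>' where \<phi>': "\<phi>' \<in> Cc_infty {0<..}" "\<And>x. 0 < x \<Longrightarrow> vector_derivative \<phi> (at x) = \<phi>' x"
    by (rule test_function_derivative[OF \<phi>]) (use vector_derivative_at in blast)
  have *: "(LBINT x:{0<..}. h x * vector_derivative \<phi> (at x)) = (LBINT x:{0<..}. h x * \<phi>' x)" for h
    by (intro set_lebesgue_integral_cong) (auto simp: \<phi>'(2))
  have "(LBINT x:{0<..}. u x * \<phi>' x) = (LBINT x:{0<..}. w x * \<phi>' x)"
    unfolding set_lebesgue_integral_def
  proof (rule integral_cong_AE)
    show "(\<lambda>x. indicator {0<..} x *\<^sub>R (u x * \<phi>' x)) \<in> borel_measurable lborel"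
      "(\<lambda>x. indicator {0<..} x *\<^sub>R (w x * \<phi>' x)) \<in> borel_measurable lborel"
      using integrable_mult_test[OF assms(3) \<phi>'(1)] integrable_mult_test[OF lw \<phi>'(1)]
      unfolding set_integrable_def by (auto intro: borel_measurable_integrable)
    show "AE x in lborel. indicator {0<..} x *\<^sub>R (u x * \<phi>' x) = indicator {0<..} x *\<^sub>R (w x * \<phi>' x)"
      using assms(2) by eventually_elim (auto simp: indicator_def)
  qed
  moreover have "(LBINT x:{0<..}. w x * vector_derivative \<phi> (at x)) = - (LBINT x:{0<..}. w1 x * \<phi> x)"
    using assms(1) \<phi> by (simp add: has_weak_derivative_def)
  ultimately show "(LBINT x:{0<..}. u x * vector_derivative \<phi> (at x)) = - (LBINT x:{0<..}. w1 x * \<phi> x)"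
    by (simp only: *)
qed

lemma H1_cong_AE:
  assumes "H1 c w w1" "AE y in weighted c. u y = w y" "u \<in> borel_measurable (weighted c)"
  shows "H1 c u w1"
proof -
  have ae: "AE y in weighted c. w y = u y" using assms(2) by eventually_elim simp
  have u: "u \<in> L2 c"
    by (rule L2_cong_AE[OF _ assms(3) ae]) (use assms(1) in \<open>simp add: H1_def\<close>)
  have "has_weak_derivative u w1"
    by (rule has_weak_derivative_cong_AE[OF _ _ L2_imp_locally_integrable[OF u]])
       (use assms(1,2) in \<open>auto simp: H1_def AE_weighted\<close>)
  with u assms(1) show ?thesis by (simp add: H1_def)
qed

text \<open>For \<open>t \<le> r\<close> the integrand \<open>t\<^sup>-\<^sup>c\<close> is at most \<open>r\<^sup>b\<^sup>-\<^sup>c t\<^sup>-\<^sup>b\<close>, whose primitive is a negative power.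
  The free exponent \<open>b > 1\<close> makes it possible to treat \<open>c \<le> 1\<close> without a separate logarithmic case.\<close>

lemma green_le:
  assumes "1 < b" "c \<le> b" "0 < y" "0 < s" "y < r" "s < r"
  shows "green c r y s \<le> r powr (b - c) / (b - 1) * max y s powr (1 - b)"
proof -
  define h where "h t = r powr (b - c) / (b - 1) * t powr (1 - b) + antideriv c t" for t
  define m where "m = max y s"
  have m: "0 < m" "m < r" using assms by (auto simp: m_def)
  have "h r \<le> h m"
  proof (rule DERIV_nonpos_imp_nonincreasing[where f = h])
    show "m \<le> r" using m by simp
    fix t assume t: "m \<le> t" "t \<le> r"
    then have t0: "0 < t" using m by linarith
    have "((\<lambda>t. t powr (1 - b)) has_real_derivative (1 - b) * t powr (- b)) (at t)"
      using t0 by (auto intro!: derivative_eq_intros)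
    from DERIV_add[OF DERIV_cmult[OF this, of "r powr (b - c) / (b - 1)"] antideriv_has_derivative[OF t0, of c]]
    have "(h has_real_derivative r powr (b - c) / (b - 1) * ((1 - b) * t powr (- b)) + t powr (- c)) (at t)"
      unfolding h_def .
    moreover have "r powr (b - c) / (b - 1) * ((1 - b) * t powr (- b)) = - (r powr (b - c) * t powr (- b))"
      using assms(1) by (simp add: field_simps)
    moreover have "t powr (- c) = t powr (b - c) * t powr (- b)" by (simp flip: powr_add)
    moreover have "t powr (b - c) * t powr (- b) \<le> r powr (b - c) * t powr (- b)"
      using t t0 assms(2) by (intro mult_right_mono powr_mono2) auto
    ultimately have "(h has_real_derivative r powr (b - c) / (b - 1) * ((1 - b) * t powr (- b)) + t powr (- c)) (at t)"
      "r powr (b - c) / (b - 1) * ((1 - b) * t powr (- b)) + t powr (- c) \<le> 0" by linarith+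
    then show "\<exists>y. (h has_real_derivative y) (at t) \<and> y \<le> 0" by blast
  qed
  moreover have "antideriv c r \<le> h r" using assms by (simp add: h_def)
  ultimately have "antideriv c r - antideriv c m \<le> r powr (b - c) / (b - 1) * m powr (1 - b)"
    by (simp add: h_def)
  then show ?thesis using assms by (simp add: green_def m_def)
qed

lemma powr_Ioo_integral_pos:
  fixes y r :: real
  assumes "0 < y" "y < r"
  shows "set_integrable lborel {y<..<r} (\<lambda>s. s powr (-a))" "(LBINT s:{y<..<r}. s powr (-a)) = antideriv a r - antideriv a y"
proof -
  have c: "continuous_on {y..r} (\<lambda>s. s powr (-a))" using assms by (intro continuous_intros) auto
  then have "set_integrable lborel {y..r} (\<lambda>s. s powr (-a))"
    unfolding set_integrable_def by (intro borel_integrable_compact) auto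
  then show "set_integrable lborel {y<..<r} (\<lambda>s. s powr (-a))" by (rule set_integrable_subset) auto
  have "(LBINT s:{y<..<r}. complex_of_real (s powr (-a))) = complex_of_real (antideriv a r) - complex_of_real (antideriv a y)"
  proof (rule set_integral_FTC)
    show "((\<lambda>s. complex_of_real (antideriv a s)) has_vector_derivative complex_of_real (s powr (-a))) (at s)" if "y \<le> s" for s
      using antideriv_has_derivative[of s a] that assms
      by (intro has_vector_derivative_of_real) (simp add: has_real_derivative_iff_has_vector_derivative)
  qed (use assms c in \<open>auto intro: continuous_on_of_real\<close>)
  then have "complex_of_real (LBINT s:{y<..<r}. s powr (-a)) = complex_of_real (antideriv a r - antideriv a y)"
    by (simp only: set_integral_complex_of_real of_real_diff)
  then show "(LBINT s:{y<..<r}. s powr (-a)) = antideriv a r - antideriv a y"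
    by (simp only: of_real_eq_iff)
qed

text \<open>The order of magnitude, as \<open>y\<close> tends to \<open>0\<close>, of the integral of \<open>G(y,s)\<^sup>2 s\<^sup>c\<close> over \<open>s\<close>.\<close>

definition kernel_weight :: "real \<Rightarrow> real \<Rightarrow> real" where
  "kernel_weight c y = (if c < 3 then 1 else if c = 3 then 1 + \<bar>ln y\<bar> else y powr (3 - c))"

lemma kernel_weight_nonneg: "0 \<le> kernel_weight c y"
  by (simp add: kernel_weight_def)

lemma green_L2_norm_eq:
  "(L2_norm c (\<lambda>s. complex_of_real (green c r y s)))\<^sup>2 = (LBINT s:{0<..}. s powr c * (green c r y s)\<^sup>2)"
  unfolding L2_norm_square integral_weighted by simp

lemma green_square_integrable:
  assumes "c > -1" "0 < y" "y < r"
  shows "set_integrable lborel {0<..} (\<lambda>s. s powr c * (green c r y s)\<^sup>2)"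
  using L2_square_integrable[OF green_L2[OF assms]] by (simp add: integrable_weighted)

text \<open>For \<open>c < 3\<close> the exponent \<open>b\<close> is chosen between \<open>max 1 c\<close> and \<open>(c+3)/2\<close>, which is possible because \<open>-1 < c < 3\<close>;
  then the square of the bound is integrable against \<open>s\<^sup>c\<close> up to \<open>0\<close>.  For \<open>c \<ge> 3\<close> the choice \<open>b = c\<close> is
  sharp, and the integral is split at \<open>s = y\<close>.\<close>

lemma green_norm_estimate:
  assumes c: "c > -1" and r: "r > 0"
  shows "\<exists>C\<ge>0. \<forall>y. 0 < y \<longrightarrow> y < r \<longrightarrow> (L2_norm c (\<lambda>s. complex_of_real (green c r y s)))\<^sup>2 \<le> C * kernel_weight c y"
proof (cases "c < 3")
  case True
  \<comment> \<open>The midpoint of the admissible range.\<close>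
  define b where "b = (max 1 c + (c + 3) / 2) / 2"
  have b: "1 < b" "c \<le> b" "2 - 2 * b + c > -1" using True c by (auto simp: b_def max_def field_simps)
  define K where "K = r powr (b - c) / (b - 1)"
  have K: "K \<ge> 0" using b by (simp add: K_def)
  define C where "C = K\<^sup>2 * (r powr (2 - 2 * b + c + 1) / (2 - 2 * b + c + 1))"
  note p = powr_Ioo_integral[OF b(3) less_imp_le[OF r]]
  show ?thesis
  proof (intro exI conjI allI impI)
    show "0 \<le> C" unfolding C_def using b by (intro mult_nonneg_nonneg divide_nonneg_nonneg) auto
    fix y assume y: "0 < y" "y < r"
    have "(LBINT s:{0<..}. s powr c * (green c r y s)\<^sup>2) \<le> (LBINT s:{0<..<r}. K\<^sup>2 * s powr (2 - 2 * b + c))"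
      unfolding set_lebesgue_integral_def
    proof (rule integral_mono)
      show "integrable lborel (\<lambda>s. indicator {0<..} s *\<^sub>R (s powr c * (green c r y s)\<^sup>2))"
        using green_square_integrable[OF c y] by (simp add: set_integrable_def)
      show "integrable lborel (\<lambda>s. indicator {0<..<r} s *\<^sub>R (K\<^sup>2 * s powr (2 - 2 * b + c)))"
        using set_integrable_mult_right[OF p(1), of "K\<^sup>2"] by (simp add: set_integrable_def)
      fix s
      show "indicator {0<..} s *\<^sub>R (s powr c * (green c r y s)\<^sup>2) \<le> indicator {0<..<r} s *\<^sub>R (K\<^sup>2 * s powr (2 - 2 * b + c))"
      proof (cases "0 < s \<and> s < r")
        case True
        have "green c r y s \<le> K * max y s powr (1 - b)"
          unfolding K_def by (rule green_le) (use b y True in auto)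
        also have "\<dots> \<le> K * s powr (1 - b)"
          using K b True by (intro mult_left_mono powr_mono2') auto
        finally have "(green c r y s)\<^sup>2 \<le> (K * s powr (1 - b))\<^sup>2"
          using green_bounds(1)[OF y] by (intro power_mono)
        then have "s powr c * (green c r y s)\<^sup>2 \<le> s powr c * (K * s powr (1 - b))\<^sup>2"
          by (intro mult_left_mono) auto
        also have "\<dots> = K\<^sup>2 * (s powr c * s powr (1 - b) * s powr (1 - b))"
          by (simp add: power2_eq_square)
        also have "s powr c * s powr (1 - b) * s powr (1 - b) = s powr (2 - 2 * b + c)"
          by (simp add: powr_add[symmetric] algebra_simps)
        finally show ?thesis using True by simp
      next
        case False
        then show ?thesis using green_beyond[OF y(2), of s] by (auto simp: indicator_def)
      qed
    qed
    also have "\<dots> = C" using p(2) by (simp add: C_def)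
    finally show "(L2_norm c (\<lambda>s. complex_of_real (green c r y s)))\<^sup>2 \<le> C * kernel_weight c y"
      using True by (simp add: green_L2_norm_eq kernel_weight_def)
  qed
next
  case False
  then have c3: "c \<ge> 3" by simp
  have main: "(L2_norm c (\<lambda>s. complex_of_real (green c r y s)))\<^sup>2 \<le> y powr (3 - c) + (antideriv (c - 2) r - antideriv (c - 2) y)"
    if y: "0 < y" "y < r" for y
  proof -
    note p = powr_Ioo_integral[OF c less_imp_le[OF y(1)]]
    note q = powr_Ioo_integral_pos[OF y, of "c - 2"]
    \<comment> \<open>Here \<open>max y s\<close> is \<open>y\<close> on \<open>(0,y)\<close> and \<open>s\<close> on \<open>(y,r)\<close>.\<close>
    have p': "set_integrable lborel {0<..<y} (\<lambda>s. y powr (2 - 2 * c) * s powr c)"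
      by (rule set_integrable_mult_right[OF p(1)])
    have "(LBINT s:{0<..}. s powr c * (green c r y s)\<^sup>2) \<le>
        (\<integral>s. indicator {0<..<y} s *\<^sub>R (y powr (2 - 2 * c) * s powr c) + indicator {y<..<r} s *\<^sub>R s powr (- (c - 2)) \<partial>lborel)"
      unfolding set_lebesgue_integral_def
    proof (rule integral_mono_AE)
      show "integrable lborel (\<lambda>s. indicator {0<..} s *\<^sub>R (s powr c * (green c r y s)\<^sup>2))"
        using green_square_integrable[OF c y] by (simp add: set_integrable_def)
      show "integrable lborel (\<lambda>s. indicator {0<..<y} s *\<^sub>R (y powr (2 - 2 * c) * s powr c) + indicator {y<..<r} s *\<^sub>R s powr (- (c - 2)))"
        using p' q(1) unfolding set_integrable_def by (rule Bochner_Integration.integrable_add)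
      show "AE s in lborel. indicator {0<..} s *\<^sub>R (s powr c * (green c r y s)\<^sup>2) \<le>
          indicator {0<..<y} s *\<^sub>R (y powr (2 - 2 * c) * s powr c) + indicator {y<..<r} s *\<^sub>R s powr (- (c - 2))"
        using AE_lborel_singleton[of y]
      proof eventually_elim
        fix s assume "s \<noteq> y"
        show "indicator {0<..} s *\<^sub>R (s powr c * (green c r y s)\<^sup>2) \<le>
          indicator {0<..<y} s *\<^sub>R (y powr (2 - 2 * c) * s powr c) + indicator {y<..<r} s *\<^sub>R s powr (- (c - 2))"
        proof (cases "0 < s \<and> s < r")
          case True
          define m where "m = max y s"
          have "green c r y s \<le> r powr (c - c) / (c - 1) * max y s powr (1 - c)"
            by (rule green_le) (use c3 y True in auto)
          also have "\<dots> \<le> 1 * m powr (1 - c)"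
            using c3 y unfolding m_def by (intro mult_right_mono) auto
          finally have "(green c r y s)\<^sup>2 \<le> (m powr (1 - c))\<^sup>2"
            using green_bounds(1)[OF y] by (intro power_mono) auto
          then have "s powr c * (green c r y s)\<^sup>2 \<le> s powr c * (m powr (1 - c))\<^sup>2"
            by (intro mult_left_mono) auto
          also have "(m powr (1 - c))\<^sup>2 = m powr (2 - 2 * c)"
            by (simp add: power2_eq_square powr_add[symmetric])
          finally have *: "s powr c * (green c r y s)\<^sup>2 \<le> s powr c * m powr (2 - 2 * c)" .
          show ?thesis
          proof (cases "s < y")
            case True
            with * \<open>0 < s \<and> s < r\<close> y show ?thesis by (simp add: m_def mult.commute)
          next
            case False
            then have "m = s" by (simp add: m_def)
            with * have "s powr c * (green c r y s)\<^sup>2 \<le> s powr (2 - c)"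
              by (simp add: powr_add[symmetric])
            with False \<open>s \<noteq> y\<close> \<open>0 < s \<and> s < r\<close> show ?thesis by (simp add: indicator_def)
          qed
        next
          case False
          then show ?thesis using green_beyond[OF y(2), of s] by (auto simp: indicator_def)
        qed
      qed
    qed
    also have "\<dots> = (LBINT s:{0<..<y}. y powr (2 - 2 * c) * s powr c) + (LBINT s:{y<..<r}. s powr (- (c - 2)))"
      unfolding set_lebesgue_integral_def
      by (rule Bochner_Integration.integral_add[OF p'[unfolded set_integrable_def] q(1)[unfolded set_integrable_def]])
    also have "\<dots> = y powr (2 - 2 * c) * (y powr (c + 1) / (c + 1)) + (antideriv (c - 2) r - antideriv (c - 2) y)"
      by (simp only: set_integral_mult_right p(2) q(2))
    also have "y powr (2 - 2 * c) * (y powr (c + 1) / (c + 1)) = y powr (3 - c) / (c + 1)"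
      by (simp add: powr_add[symmetric] algebra_simps)
    also have "\<dots> \<le> y powr (3 - c)" using c3 by (simp add: divide_le_eq mult_le_cancel_left1)
    finally show ?thesis by (simp add: green_L2_norm_eq)
  qed
  show ?thesis
  proof (cases "c = 3")
    case True
    show ?thesis
    proof (intro exI conjI allI impI)
      show "0 \<le> 1 + \<bar>ln r\<bar>" by simp
      fix y assume y: "0 < y" "y < r"
      have "(L2_norm c (\<lambda>s. complex_of_real (green c r y s)))\<^sup>2 \<le> 1 + (ln r - ln y)"
        using main[OF y] y True by (simp add: antideriv_def)
      also have "\<dots> \<le> (1 + \<bar>ln r\<bar>) * (1 + \<bar>ln y\<bar>)"
      proof -
        have "(1 + \<bar>ln r\<bar>) * (1 + \<bar>ln y\<bar>) = 1 + \<bar>ln r\<bar> + \<bar>ln y\<bar> + \<bar>ln r\<bar> * \<bar>ln y\<bar>" by (simp add: algebra_simps)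
        moreover have "0 \<le> \<bar>ln r\<bar> * \<bar>ln y\<bar>" by simp
        ultimately show ?thesis by linarith
      qed
      finally show "(L2_norm c (\<lambda>s. complex_of_real (green c r y s)))\<^sup>2 \<le> (1 + \<bar>ln r\<bar>) * kernel_weight c y"
        using True by (simp add: kernel_weight_def)
    qed
  next
    case False
    with c3 have c3': "c > 3" by simp
    show ?thesis
    proof (intro exI conjI allI impI)
      show "0 \<le> 1 + 1 / (c - 3)" using c3' by simp
      fix y assume y: "0 < y" "y < r"
      have "antideriv (c - 2) r - antideriv (c - 2) y = (y powr (3 - c) - r powr (3 - c)) / (c - 3)"
      proof -
        have "antideriv (c - 2) t = - (t powr (3 - c) / (c - 3))" for t
          using c3' by (simp add: antideriv_def minus_divide_right)
        then show ?thesis by (simp add: diff_divide_distrib)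
      qed
      also have "\<dots> \<le> y powr (3 - c) / (c - 3)" using c3' by (intro divide_right_mono) auto
      finally have "(L2_norm c (\<lambda>s. complex_of_real (green c r y s)))\<^sup>2 \<le> y powr (3 - c) + y powr (3 - c) / (c - 3)"
        using main[OF y] by linarith
      then show "(L2_norm c (\<lambda>s. complex_of_real (green c r y s)))\<^sup>2 \<le> (1 + 1 / (c - 3)) * kernel_weight c y"
        using c3' by (simp add: kernel_weight_def algebra_simps)
    qed
  qed
qed

text \<open>The constant is the same for all potentials.  It will be used with \<open>W = V\<close> for the operators with and without
  potential, and with \<open>W = 1\<close> as a Poincare inequality.\<close>

lemma multiplier_bound:
  fixes W :: "real \<Rightarrow> real"
  assumes c: "c > -1" and r: "r > 0" and Wm: "W \<in> borel_measurable (weighted c)"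
    and W: "integrable (weighted c) (\<lambda>y. indicator {0<..<r} y * ((W y)\<^sup>2 * kernel_weight c y))"
  shows "\<exists>C\<ge>0. \<forall>V u g. potential c V \<longrightarrow> is_BV c V u g \<longrightarrow> (AE y in weighted c. r < y \<longrightarrow> u y = 0) \<longrightarrow>
     (\<lambda>y. complex_of_real (W y) * u y) \<in> L2 c \<and> L2_norm c (\<lambda>y. complex_of_real (W y) * u y) \<le> C * L2_norm c g"
proof -
  obtain K where K: "K \<ge> 0" "\<And>y. 0 < y \<Longrightarrow> y < r \<Longrightarrow> (L2_norm c (\<lambda>s. complex_of_real (green c r y s)))\<^sup>2 \<le> K * kernel_weight c y"
    using green_norm_estimate[OF c r] by blast
  define I where "I = (\<integral>y. indicator {0<..<r} y * ((W y)\<^sup>2 * kernel_weight c y) \<partial>weighted c)"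
  have I: "I \<ge> 0" unfolding I_def by (intro integral_nonneg_AE) (simp add: kernel_weight_nonneg)
  show ?thesis
  proof (intro exI[of _ "sqrt (K * I)"] conjI allI impI)
    show "0 \<le> sqrt (K * I)" using K I by simp
    fix V u g assume V: "potential c V" and u: "is_BV c V u g" and supp: "AE y in weighted c. r < y \<longrightarrow> u y = 0"
    interpret potential c V by fact
    obtain w w1 where w: "is_BV c V w g" "AE y in weighted c. u y = w y" "H1 c w w1"
      "\<And>y. 0 < y \<Longrightarrow> (w has_vector_derivative w1 y) (at y)" "continuous_on {0<..} w1"
      by (rule regularity[OF u]) (rule that; assumption)
    have um: "u \<in> borel_measurable (weighted c)" by (rule L2_measurable[OF is_BV_D(4)[OF u]])
    have wc: "continuous_on {0<..} w"
      using w(4) by (intro continuous_at_imp_continuous_on ballI has_vector_derivative_continuous) auto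
    have "AE y in lborel. r < y \<longrightarrow> w y = 0"
      using w(2) supp unfolding AE_weighted by eventually_elim (use r in auto)
    then have w0: "w y = 0" if "r \<le> y" for y using AE_zero_imp_zero[OF wc _ r that] by blast
    have bound: "(norm (complex_of_real (W y) * w y))\<^sup>2 \<le> ((L2_norm c g)\<^sup>2 * K) * (indicator {0<..<r} y * ((W y)\<^sup>2 * kernel_weight c y))" if y: "0 < y" for y
    proof (cases "y < r")
      case True
      have "norm (w y) \<le> L2_norm c g * L2_norm c (\<lambda>s. complex_of_real (green c r y s))"
        by (rule pointwise_estimate[OF w(1,3,4,5) w0 y True])
      then have "(norm (w y))\<^sup>2 \<le> (L2_norm c g)\<^sup>2 * (L2_norm c (\<lambda>s. complex_of_real (green c r y s)))\<^sup>2"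
        unfolding power_mult_distrib[symmetric] by (intro power_mono) auto
      also have "\<dots> \<le> (L2_norm c g)\<^sup>2 * (K * kernel_weight c y)"
        by (intro mult_left_mono K y True) auto
      finally have "(W y)\<^sup>2 * (norm (w y))\<^sup>2 \<le> (W y)\<^sup>2 * ((L2_norm c g)\<^sup>2 * (K * kernel_weight c y))"
        by (intro mult_left_mono) auto
      with y True show ?thesis by (simp add: norm_mult power_mult_distrib mult_ac)
    next
      case False
      then show ?thesis using w0 y by simp
    qed
    have ae: "AE y in weighted c. (norm (complex_of_real (W y) * u y))\<^sup>2 \<le> ((L2_norm c g)\<^sup>2 * K) * (indicator {0<..<r} y * ((W y)\<^sup>2 * kernel_weight c y))"
      using w(2) unfolding AE_weighted by eventually_elim (use bound in auto)
    have Wum: "(\<lambda>y. complex_of_real (W y) * u y) \<in> borel_measurable (weighted c)"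
      using um Wm by measurable
    have Iint: "integrable (weighted c) (\<lambda>y. ((L2_norm c g)\<^sup>2 * K) * (indicator {0<..<r} y * ((W y)\<^sup>2 * kernel_weight c y)))"
      by (rule integrable_mult_right[OF W])
    have sq: "integrable (weighted c) (\<lambda>y. (norm (complex_of_real (W y) * u y))\<^sup>2)"
    proof (rule Bochner_Integration.integrable_bound[OF Iint])
      show "(\<lambda>y. (norm (complex_of_real (W y) * u y))\<^sup>2) \<in> borel_measurable (weighted c)"
        using Wum by measurable
      show "AE y in weighted c. norm ((norm (complex_of_real (W y) * u y))\<^sup>2) \<le> norm (((L2_norm c g)\<^sup>2 * K) * (indicator {0<..<r} y * ((W y)\<^sup>2 * kernel_weight c y)))"
        using ae by eventually_elim simp
    qed
    then show "(\<lambda>y. complex_of_real (W y) * u y) \<in> L2 c" using Wum by (simp add: L2_iff)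
    have "(L2_norm c (\<lambda>y. complex_of_real (W y) * u y))\<^sup>2 \<le> (L2_norm c g)\<^sup>2 * K * I"
      unfolding L2_norm_square[of c "\<lambda>y. complex_of_real (W y) * u y"] I_def
      using integral_mono_AE[OF sq Iint ae] by simp
    also have "\<dots> = (sqrt (K * I) * L2_norm c g)\<^sup>2"
      using K I by (simp add: power_mult_distrib)
    finally show "L2_norm c (\<lambda>y. complex_of_real (W y) * u y) \<le> sqrt (K * I) * L2_norm c g"
      by (rule power2_le_imp_le) (use K I in auto)
  qed
qed

section \<open>Adding and removing the potential\<close>

lemma set_integral_cnj: "(LBINT x:S. cnj (f x)) = cnj (LBINT x:S. f x)"
proof -
  have "indicator S x *\<^sub>R cnj (f x) = cnj (indicator S x *\<^sub>R f x)" for x by simp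
  then show ?thesis unfolding set_lebesgue_integral_def by (simp only: Bochner_Integration.integral_cnj)
qed

lemma is_primitive_cnj:
  assumes "is_primitive v v'"
  shows "is_primitive (\<lambda>y. cnj (v y)) (\<lambda>y. cnj (v' y))"
  using assms unfolding is_primitive_def locally_integrable_def
proof (elim conjE, intro conjI allI impI)
  fix a b :: real
  assume i: "\<forall>a b. 0 < a \<longrightarrow> a < b \<longrightarrow> set_integrable lborel {a..b} v'"
    and p: "\<forall>a b. 0 < a \<longrightarrow> a < b \<longrightarrow> v b - v a = (LBINT t:{a<..<b}. v' t)" and ab: "0 < a" "a < b"
  have "integrable lborel (\<lambda>x. cnj (indicator {a..b} x *\<^sub>R v' x))"
    by (rule integrable_cnj) (use i ab in \<open>simp only: set_integrable_def\<close>)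
  then show "set_integrable lborel {a..b} (\<lambda>y. cnj (v' y))" by (simp add: set_integrable_def)
  show "cnj (v b) - cnj (v a) = (LBINT t:{a<..<b}. cnj (v' t))"
    unfolding set_integral_cnj using p ab by (simp flip: complex_cnj_diff)
qed

lemma set_integral_Ioo_split_at:
  fixes p :: "real \<Rightarrow> complex"
  assumes "set_integrable lborel {a<..<b} p" "a < m" "m < b"
  shows "(LBINT t:{a<..<b}. p t) = (LBINT t:{a<..<m}. p t) + (LBINT t:{m<..<b}. p t)"
proof -
  have i: "set_integrable lborel {a<..<m} p" "set_integrable lborel {m<..<b} p"
    by (rule set_integrable_subset[OF assms(1)]; use assms in auto)+
  have "(LBINT t:{a<..<b}. p t) = (\<integral>t. indicator {a<..<m} t *\<^sub>R p t + indicator {m<..<b} t *\<^sub>R p t \<partial>lborel)"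
    unfolding set_lebesgue_integral_def
  proof (rule integral_cong_AE)
    show "AE t in lborel. indicator {a<..<b} t *\<^sub>R p t = indicator {a<..<m} t *\<^sub>R p t + indicator {m<..<b} t *\<^sub>R p t"
      using AE_lborel_singleton[of m] by eventually_elim (use assms in \<open>auto simp: indicator_def\<close>)
  qed (use assms(1) i in \<open>auto simp: set_integrable_def intro!: borel_measurable_add borel_measurable_integrable\<close>)
  also have "\<dots> = (LBINT t:{a<..<m}. p t) + (LBINT t:{m<..<b}. p t)"
    unfolding set_lebesgue_integral_def
    by (rule Bochner_Integration.integral_add[OF i[unfolded set_integrable_def]])
  finally show ?thesis .
qed

lemma powr_indicator_L2:
  assumes "c + 2 * a > -1" "0 < R"
  shows "(\<lambda>y. complex_of_real (indicator {0<..<R} y * y powr a)) \<in> L2 c"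
  unfolding L2_iff
proof
  show "(\<lambda>y. complex_of_real (indicator {0<..<R} y * y powr a)) \<in> borel_measurable (weighted c)"
    by (rule measurable_weightedI) measurable
  have *: "indicator {0<..} y *\<^sub>R y powr c *\<^sub>R (norm (complex_of_real (indicator {0<..<R} y * y powr a)))\<^sup>2 = indicator {0<..<R} y *\<^sub>R y powr (c + 2 * a)" for y
  proof (cases "y \<in> {0<..<R}")
    case True
    have "y powr c * (y powr a)\<^sup>2 = y powr (c + 2 * a)"
      by (simp add: power2_eq_square powr_add[symmetric])
    with True show ?thesis by (simp add: norm_mult abs_mult)
  qed simp
  show "integrable (weighted c) (\<lambda>y. (norm (complex_of_real (indicator {0<..<R} y * y powr a)))\<^sup>2)"
    using powr_Ioo_integral(1)[OF assms(1) less_imp_le[OF assms(2)]]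
    by (simp only: integrable_weighted set_integrable_def *)
qed

text \<open>Integration by parts up to the singular endpoint.  Since the weighted mean of \<open>f\<close> over \<open>(0,R)\<close> is zero
  and \<open>w1\<close> vanishes at \<open>R\<close>, the function \<open>y\<^sup>c w1\<close> is the integral of \<open>y\<^sup>c f\<close> from \<open>0\<close>.  By Cauchy-Schwarz it is at most a multiple of
  \<open>y\<^sup>(\<^sup>c\<^sup>+\<^sup>1\<^sup>)\<^sup>/\<^sup>2 = y\<^sup>c y\<^sup>(\<^sup>1\<^sup>-\<^sup>c\<^sup>)\<^sup>/\<^sup>2\<close>, and \<open>y\<^sup>(\<^sup>1\<^sup>-\<^sup>c\<^sup>)\<^sup>/\<^sup>2\<close> is square integrable near \<open>0\<close> against \<open>y\<^sup>c\<close>; this gives the absolute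
  convergence for every \<open>v\<close> in the form domain of the zero potential.\<close>

lemma weak_identity:
  assumes c: "c > -1" and f: "f \<in> L2 c" and fR: "AE y in weighted c. R < y \<longrightarrow> f y = 0" and R: "R > 0"
    and P: "is_primitive (\<lambda>y. complex_of_real (y powr c) * w1 y) (\<lambda>y. complex_of_real (y powr c) * f y)"
    and w1R: "\<And>y. R \<le> y \<Longrightarrow> w1 y = 0"
    and zero: "(LBINT y:{0<..<R}. complex_of_real (y powr c) * f y) = 0"
    and v: "H1 c v v'"
  shows "(\<integral>y. w1 y * cnj (v' y) \<partial>weighted c) = - (\<integral>y. f y * cnj (v y) \<partial>weighted c)"
proof -
  obtain z where z: "is_primitive z v'" "AE y in weighted c. v y = z y" "H1 c z v'" by (rule H1_primitive[OF v])
  define p where "p y = complex_of_real (y powr c) * f y" for y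
  have p_def': "p = (\<lambda>y. y powr c *\<^sub>R f y)" by (simp add: p_def[abs_def] scaleR_conv_of_real)
  have pi: "set_integrable lborel {0<..<s} p" if "0 \<le> s" for s
    unfolding p_def' by (rule L2_integral_near_0[OF f c that])
  have inner: "(LBINT t:{0<..<s}. p t) = complex_of_real (s powr c) * w1 s" if "0 < s" "s < R" for s
  proof -
    have "(LBINT t:{0<..<R}. p t) = (LBINT t:{0<..<s}. p t) + (LBINT t:{s<..<R}. p t)"
      by (rule set_integral_Ioo_split_at[OF pi]) (use that in auto)
    moreover have "(LBINT t:{s<..<R}. p t) = complex_of_real (R powr c) * w1 R - complex_of_real (s powr c) * w1 s"
      using P that unfolding is_primitive_def p_def by auto
    ultimately show ?thesis using zero w1R[of R] by (simp add: p_def)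
  qed
  have vL: "v' \<in> L2 c" "v \<in> L2 c" "z \<in> L2 c" using v z(3) by (auto simp: H1_def)
  have "(LBINT s:{0<..<R}. (LBINT t:{0<..<s}. p t) * cnj (v' s)) = - (LBINT t:{0<..<R}. p t * cnj (z t))"
  proof (rule primitive_by_parts[OF pi])
    show "(LBINT t:{0<..<R}. p t) = 0" using zero by (simp add: p_def)
    show "is_primitive (\<lambda>y. cnj (z y)) (\<lambda>y. cnj (v' y))" by (rule is_primitive_cnj[OF z(1)])
    \<comment> \<open>The majorant for Fubini's theorem.\<close>
    define N where "N s = (LBINT t:{0<..<s}. norm (p t))" for s
    have N0: "0 \<le> N s" for s unfolding N_def set_lebesgue_integral_def by (intro integral_nonneg_AE) auto
    have N: "N s \<le> L2_norm c f * sqrt (s powr (c + 1) / (c + 1))" if "0 \<le> s" for s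
      unfolding N_def p_def' by (rule L2_integral_near_0(2)[OF f c that])
    define K where "K = L2_norm c f * sqrt (1 / (c + 1))"
    have K: "K \<ge> 0" using c by (simp add: K_def)
    have N': "N s \<le> K * (s powr c * s powr ((1 - c) / 2))" if "0 < s" for s
    proof -
      have "sqrt (s powr (c + 1) / (c + 1)) = sqrt (1 / (c + 1)) * s powr ((c + 1) / 2)"
        by (simp add: real_sqrt_divide powr_half_sqrt[symmetric] powr_powr)
      also have "s powr ((c + 1) / 2) = s powr c * s powr ((1 - c) / 2)"
        by (simp add: powr_add[symmetric] field_simps)
      finally show ?thesis using N[of s] that by (simp add: K_def)
    qed
    have "integrable (weighted c) (\<lambda>s. norm (complex_of_real (indicator {0<..<R} s * s powr ((1 - c) / 2))) * norm (v' s))"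
      by (intro L2_norm_mult_integrable powr_indicator_L2 vL R) (simp add: field_simps)
    then have maj: "integrable lborel (\<lambda>s. K * (indicator {0<..} s *\<^sub>R (s powr c *\<^sub>R
        (norm (complex_of_real (indicator {0<..<R} s * s powr ((1 - c) / 2))) * norm (v' s)))))"
      unfolding integrable_weighted set_integrable_def by (rule integrable_mult_right)
    show "set_integrable lborel {0<..<R} (\<lambda>s. (LBINT t:{0<..<s}. norm (p t)) * norm (cnj (v' s)))"
      unfolding N_def[symmetric] set_integrable_def
    proof (rule Bochner_Integration.integrable_bound[OF maj])
      have lv: "locally_integrable v'" by (rule L2_imp_locally_integrable[OF vL(1)])
      have vm: "(\<lambda>s. indicator {0<..<R} s *\<^sub>R v' s) \<in> borel_measurable borel"
        using locally_integrable_measurable_Ioo[OF lv, of 0 R] by (simp add: set_borel_measurable_def)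
      have "(\<lambda>s. indicator {0<..<R} s * N s) \<in> borel_measurable borel"
      proof -
        define Q where "Q s = N (min s R)" for s
        have "mono Q"
        proof (rule monoI)
          fix s s' :: real assume "s \<le> s'"
          show "Q s \<le> Q s'"
            unfolding Q_def N_def set_lebesgue_integral_def
          proof (rule integral_mono)
            have *: "integrable lborel (\<lambda>t. indicator {0<..<min s R} t *\<^sub>R norm (p t))" for s
            proof (cases "0 \<le> min s R")
              case True
              from set_integrable_norm[OF pi[OF this]] show ?thesis by (simp add: set_integrable_def)
            next
              case False
              then have "{0<..<min s R} = {}" by auto
              then show ?thesis by simp
            qed
            show "integrable lborel (\<lambda>t. indicator {0<..<min s R} t *\<^sub>R norm (p t))"
              "integrable lborel (\<lambda>t. indicator {0<..<min s' R} t *\<^sub>R norm (p t))" by (rule *)+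
          qed (use \<open>s \<le> s'\<close> in \<open>auto simp: indicator_def\<close>)
        qed
        then have "Q \<in> borel_measurable borel" by (rule borel_measurable_mono)
        then have "(\<lambda>s. indicator {0<..<R} s * Q s) \<in> borel_measurable borel" by measurable
        also have "(\<lambda>s. indicator {0<..<R} s * Q s) = (\<lambda>s. indicator {0<..<R} s * N s)"
          by (auto simp: Q_def fun_eq_iff indicator_def)
        finally show ?thesis .
      qed
      then have "(\<lambda>s. (indicator {0<..<R} s * N s) * norm (indicator {0<..<R} s *\<^sub>R v' s)) \<in> borel_measurable lborel"
        using vm by measurable
      also have "(\<lambda>s. (indicator {0<..<R} s * N s) * norm (indicator {0<..<R} s *\<^sub>R v' s)) =
          (\<lambda>s. indicator {0<..<R} s *\<^sub>R (N s * norm (cnj (v' s))))"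
        by (auto simp: fun_eq_iff indicator_def)
      finally show "(\<lambda>s. indicator {0<..<R} s *\<^sub>R (N s * norm (cnj (v' s)))) \<in> borel_measurable lborel" .
      show "AE s in lborel. norm (indicator {0<..<R} s *\<^sub>R (N s * norm (cnj (v' s)))) \<le>
        norm (K * (indicator {0<..} s *\<^sub>R (s powr c *\<^sub>R
        (norm (complex_of_real (indicator {0<..<R} s * s powr ((1 - c) / 2))) * norm (v' s)))))"
      proof (rule AE_I2)
        fix s
        show "norm (indicator {0<..<R} s *\<^sub>R (N s * norm (cnj (v' s)))) \<le>
          norm (K * (indicator {0<..} s *\<^sub>R (s powr c *\<^sub>R
          (norm (complex_of_real (indicator {0<..<R} s * s powr ((1 - c) / 2))) * norm (v' s)))))"
        proof (cases "s \<in> {0<..<R}")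
          case True
          have "N s * norm (v' s) \<le> K * (s powr c * s powr ((1 - c) / 2)) * norm (v' s)"
            using N'[of s] True by (intro mult_right_mono) auto
          with True N0[of s] K show ?thesis by (simp add: abs_mult mult.assoc)
        qed simp
      qed
    qed
  qed (use R in auto)
  moreover have "(LBINT s:{0<..<R}. (LBINT t:{0<..<s}. p t) * cnj (v' s)) = (\<integral>y. w1 y * cnj (v' y) \<partial>weighted c)"
    unfolding integral_weighted set_lebesgue_integral_def[of _ "{0<..<R}"] set_lebesgue_integral_def[of _ "{0<..}"]
  proof (rule Bochner_Integration.integral_cong[OF refl])
    fix s
    show "indicator {0<..<R} s *\<^sub>R ((LBINT t:{0<..<s}. p t) * cnj (v' s)) = indicator {0<..} s *\<^sub>R s powr c *\<^sub>R (w1 s * cnj (v' s))"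
      using inner[of s] w1R[of s] by (auto simp: indicator_def scaleR_conv_of_real)
  qed
  moreover have "(LBINT t:{0<..<R}. p t * cnj (z t)) = (\<integral>y. f y * cnj (v y) \<partial>weighted c)"
  proof -
    have "(\<integral>y. f y * cnj (v y) \<partial>weighted c) = (\<integral>y. indicator {0<..<R} y *\<^sub>R (f y * cnj (z y)) \<partial>weighted c)"
    proof (rule integral_cong_AE)
      show "(\<lambda>y. f y * cnj (v y)) \<in> borel_measurable (weighted c)"
        by (intro borel_measurable_integrable L2_mult_cnj_integrable f vL)
      have "(\<lambda>y. indicator {0<..<R} y :: real) \<in> borel_measurable (weighted c)" by (rule measurable_weightedI) simp
      then show "(\<lambda>y. indicator {0<..<R} y *\<^sub>R (f y * cnj (z y))) \<in> borel_measurable (weighted c)"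
        by (rule borel_measurable_scaleR) (intro borel_measurable_integrable L2_mult_cnj_integrable f vL)
      have "AE y in weighted c. y \<noteq> R"
        unfolding AE_weighted using AE_lborel_singleton[of R] by eventually_elim simp
      moreover have "AE y in weighted c. 0 < y" unfolding AE_weighted by simp
      ultimately show "AE y in weighted c. f y * cnj (v y) = indicator {0<..<R} y *\<^sub>R (f y * cnj (z y))"
        using z(2) fR by eventually_elim (auto simp: indicator_def)
    qed
    also have "\<dots> = (LBINT t:{0<..<R}. p t * cnj (z t))"
      unfolding integral_weighted set_lebesgue_integral_def
      by (rule Bochner_Integration.integral_cong[OF refl]) (auto simp: indicator_def p_def scaleR_conv_of_real)
    finally show ?thesis by simp
  qed
  ultimately show ?thesis by simp
qed

context potential
begin

lemma zero_potential: "potential c (\<lambda>_. 0)"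
  using c by unfold_locales auto

text \<open>The form domain shrinks when \<open>V\<close> is added, so that no new test functions appear.\<close>

lemma add_potential:
  assumes u: "is_BV c (\<lambda>_. 0) u f" and Vu: "(\<lambda>y. complex_of_real (V y) * u y) \<in> L2 c"
  shows "is_BV c V u (\<lambda>y. f y - complex_of_real (V y) * u y)"
proof -
  interpret Z: potential c "\<lambda>_. 0" by (rule zero_potential)
  obtain u' where u': "H1 c u u'" using Z.is_BV_D(1)[OF u] by blast
  have uL: "u \<in> L2 c" by (rule Z.is_BV_D(4)[OF u])
  have fL: "f \<in> L2 c" by (rule Z.is_BV_D(3)[OF u])
  show ?thesis
  proof (rule is_BV_I[OF u'])
    have "integrable (weighted c) (\<lambda>y. norm (complex_of_real (V y) * u y) * norm (u y))"
      by (rule L2_norm_mult_integrable[OF Vu uL])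
    then show "finite_energy u"
      unfolding finite_energy_def
    proof (rule integrable_cong_AE_imp)
      show "(\<lambda>y. V y * (norm (u y))\<^sup>2) \<in> borel_measurable (weighted c)"
        using V_measurable L2_measurable[OF uL] by measurable
      show "AE y in weighted c. norm (complex_of_real (V y) * u y) * norm (u y) = V y * (norm (u y))\<^sup>2"
        using V_nonneg by eventually_elim (simp add: norm_mult power2_eq_square)
    qed
    show "(\<lambda>y. f y - complex_of_real (V y) * u y) \<in> L2 c" by (rule L2_diff[OF fL Vu])
    fix v v' assume v: "H1 c v v'" "finite_energy v"
    then have vL: "v \<in> L2 c" by (simp add: H1_def)
    have "Z.finite_energy v" by (simp add: Z.finite_energy_def)
    from Z.is_BV_D(5)[OF u u' v(1) this]
    have "(\<integral>y. u' y * cnj (v' y) \<partial>weighted c) = - (\<integral>y. f y * cnj (v y) \<partial>weighted c)" by simp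
    moreover have "(\<integral>y. (f y - complex_of_real (V y) * u y) * cnj (v y) \<partial>weighted c) =
       (\<integral>y. f y * cnj (v y) \<partial>weighted c) - (\<integral>y. complex_of_real (V y) * u y * cnj (v y) \<partial>weighted c)"
      unfolding left_diff_distrib
      by (intro Bochner_Integration.integral_diff L2_mult_cnj_integrable fL Vu vL)
    ultimately show "(\<integral>y. u' y * cnj (v' y) \<partial>weighted c) + (\<integral>y. complex_of_real (V y) * u y * cnj (v y) \<partial>weighted c) =
       - (\<integral>y. (f y - complex_of_real (V y) * u y) * cnj (v y) \<partial>weighted c)" by simp
  qed
qed

definition ramp :: "real \<Rightarrow> real \<Rightarrow> complex" where
  "ramp r y = complex_of_real (max 0 (min 1 (r + 1 - y)))"

lemma ramp_H1:
  assumes "r > 0"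
  defines "r' \<equiv> \<lambda>y. - complex_of_real (indicator {r<..<r+1} y)"
  shows "H1 c (ramp r) r'" "finite_energy (ramp r)"
proof -
  have d: "(ramp r has_vector_derivative r' y) (at y)" if "0 < y" "y \<notin> {r, r + 1}" for y
  proof -
    have "y \<noteq> r" "y \<noteq> r + 1" using that(2) by auto
    then consider "y < r" | "r < y \<and> y < r + 1" | "r + 1 < y" by atomize_elim linarith
    then show ?thesis
    proof cases
      case 1
      have "(ramp r has_vector_derivative 0) (at y)"
        by (rule has_vector_derivative_transform_within_open[of "\<lambda>_. 1" _ _ "{..<r}"]) (use 1 in \<open>auto simp: ramp_def\<close>)
      with 1 show ?thesis by (simp add: r'_def)
    next
      case 2
      have "((\<lambda>y. r + 1 - y) has_real_derivative -1) (at y)" by (auto intro!: derivative_eq_intros)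
      then have "((\<lambda>y. complex_of_real (r + 1 - y)) has_vector_derivative complex_of_real (-1)) (at y)"
        by (intro has_vector_derivative_of_real) (simp add: has_real_derivative_iff_has_vector_derivative)
      then have "(ramp r has_vector_derivative complex_of_real (-1)) (at y)"
        by (rule has_vector_derivative_transform_within_open[of _ _ _ "{r<..<r+1}"]) (use 2 in \<open>auto simp: ramp_def\<close>)
      with 2 show ?thesis by (simp add: r'_def)
    next
      case 3
      have "(ramp r has_vector_derivative 0) (at y)"
        by (rule has_vector_derivative_transform_within_open[of "\<lambda>_. 0" _ _ "{r+1<..}"]) (use 3 in \<open>auto simp: ramp_def\<close>)
      with 3 show ?thesis by (simp add: r'_def)
    qed
  qed
  have cont: "continuous_on {0<..} (ramp r)" unfolding ramp_def by (intro continuous_intros)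
  have m: "r' \<in> borel_measurable (weighted c)" unfolding r'_def by (rule measurable_weightedI) measurable
  have b: "norm (ramp r y) \<le> 1" "norm (r' y) \<le> 1" for y by (auto simp: ramp_def r'_def indicator_def)
  have z: "ramp r y = 0" "r' y = 0" if "r + 1 \<le> y" for y using that by (auto simp: ramp_def r'_def)
  show "H1 c (ramp r) r'" "finite_energy (ramp r)"
    by (rule H1_bounded_support[OF cont, of "{r, r+1}" r' "r + 1" 1]; use d m b z assms in auto)+
qed

text \<open>The new test functions are handled by \<open>weak_identity\<close>.  Its hypothesis that \<open>f = g + Vu\<close> has mean zero
  comes from testing the equation with a function that is \<open>1\<close> on the support of \<open>u\<close>: the term with the
  derivatives vanishes.\<close>

lemma remove_potential:
  assumes u: "is_BV c V u g" and r: "r > 0" and supp: "AE y in weighted c. r < y \<longrightarrow> u y = 0"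
    and Vu: "(\<lambda>y. complex_of_real (V y) * u y) \<in> L2 c"
  shows "is_BV c (\<lambda>_. 0) u (\<lambda>y. g y + complex_of_real (V y) * u y)"
    and "AE y in weighted c. r < y \<longrightarrow> g y + complex_of_real (V y) * u y = 0"
    and "(LBINT y:{0<..<r}. complex_of_real (y powr c) * (g y + complex_of_real (V y) * u y)) = 0"
proof -
  interpret Z: potential c "\<lambda>_. 0" by (rule zero_potential)
  obtain w w1 where w: "is_BV c V w g" "AE y in weighted c. u y = w y" "H1 c w w1"
      "\<And>y. 0 < y \<Longrightarrow> (w has_vector_derivative w1 y) (at y)" "continuous_on {0<..} w1"
      "is_primitive (\<lambda>y. complex_of_real (y powr c) * w1 y)
        (\<lambda>y. complex_of_real (y powr c) * (g y + complex_of_real (V y) * w y))"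
    by (rule regularity[OF u]) (rule that; assumption)
  have gL: "g \<in> L2 c" by (rule is_BV_D(3)[OF u])
  have uL: "u \<in> L2 c" by (rule is_BV_D(4)[OF u])
  define f where "f y = g y + complex_of_real (V y) * u y" for y
  have fL: "f \<in> L2 c" unfolding f_def by (rule L2_add[OF gL Vu])
  have wc: "continuous_on {0<..} w"
    using w(4) by (intro continuous_at_imp_continuous_on ballI has_vector_derivative_continuous) auto
  have "AE y in lborel. r < y \<longrightarrow> w y = 0"
    using w(2) supp unfolding AE_weighted by eventually_elim (use r in auto)
  then have w0: "w y = 0" if "r \<le> y" for y using AE_zero_imp_zero[OF wc _ r that] by blast
  have w10: "w1 y = 0" if "r \<le> y" for y
    by (rule derivative_zero_beyond[OF w(4,5) w0 r that])
  have P: "is_primitive (\<lambda>y. complex_of_real (y powr c) * w1 y) (\<lambda>y. complex_of_real (y powr c) * f y)"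
  proof (rule is_primitive_cong_AE[OF w(6)])
    show "locally_integrable (\<lambda>y. complex_of_real (y powr c) * f y)"
      by (rule L2_imp_locally_integrable_weighted[OF fL])
    show "AE x in lborel. 0 < x \<longrightarrow> complex_of_real (x powr c) * (g x + complex_of_real (V x) * w x) = complex_of_real (x powr c) * f x"
      using w(2) unfolding AE_weighted by eventually_elim (simp add: f_def)
  qed
  have "AE y in lborel. r < y \<longrightarrow> complex_of_real (y powr c) * f y = 0"
  proof (rule AE_zero_of_interval_integrals)
    fix a b :: real assume ab: "r < a" "a < b"
    show "set_integrable lborel {a..b} (\<lambda>y. complex_of_real (y powr c) * f y)"
      by (rule locally_integrableD) (use P ab r in \<open>auto simp: is_primitive_def\<close>)
    have "(LBINT y:{a<..<b}. complex_of_real (y powr c) * f y) = complex_of_real (b powr c) * w1 b - complex_of_real (a powr c) * w1 a"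
      using P ab r by (simp add: is_primitive_def)
    then show "(LBINT y:{a<..<b}. complex_of_real (y powr c) * f y) = 0" using w10 ab by simp
  qed
  then have f0: "AE y in weighted c. r < y \<longrightarrow> f y = 0"
    unfolding AE_weighted by eventually_elim (use r in auto)
  have tot: "(LBINT y:{0<..<r}. complex_of_real (y powr c) * f y) = 0"
  proof -
    \<comment> \<open>\<open>ramp r\<close> is \<open>1\<close> up to \<open>r\<close> and its derivative lives where \<open>w1\<close> vanishes.\<close>
    note \<rho> = ramp_H1[OF r]
    have \<rho>L: "ramp r \<in> L2 c" using \<rho>(1) by (simp add: H1_def)
    have wm: "w \<in> borel_measurable (weighted c)" using w(3) by (simp add: H1_def L2_measurable)
    have "(\<integral>y. w1 y * cnj (- complex_of_real (indicator {r<..<r+1} y)) \<partial>weighted c) = (\<integral>y. 0 \<partial>weighted c)"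
      by (rule Bochner_Integration.integral_cong[OF refl]) (use w10 in \<open>auto simp: indicator_def\<close>)
    then have "(\<integral>y. complex_of_real (V y) * w y * cnj (ramp r y) \<partial>weighted c) + (\<integral>y. g y * cnj (ramp r y) \<partial>weighted c) = 0"
      using is_BV_D(5)[OF w(1,3) \<rho>] by simp
    moreover have "(\<integral>y. complex_of_real (V y) * w y * cnj (ramp r y) \<partial>weighted c) = (\<integral>y. complex_of_real (V y) * u y * cnj (ramp r y) \<partial>weighted c)"
    proof (rule integral_cong_AE)
      show "(\<lambda>y. complex_of_real (V y) * w y * cnj (ramp r y)) \<in> borel_measurable (weighted c)"
        by (intro borel_measurable_integrable potential_term_integrable is_BV_D(2)[OF w(1)] \<rho>(2) wm L2_measurable \<rho>L)
      show "(\<lambda>y. complex_of_real (V y) * u y * cnj (ramp r y)) \<in> borel_measurable (weighted c)"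
        by (intro borel_measurable_integrable potential_term_integrable is_BV_D(2)[OF u] \<rho>(2) L2_measurable \<rho>L uL)
      show "AE y in weighted c. complex_of_real (V y) * w y * cnj (ramp r y) = complex_of_real (V y) * u y * cnj (ramp r y)"
        using w(2) by eventually_elim simp
    qed
    moreover have "(\<integral>y. f y * cnj (ramp r y) \<partial>weighted c) =
      (\<integral>y. g y * cnj (ramp r y) \<partial>weighted c) + (\<integral>y. complex_of_real (V y) * u y * cnj (ramp r y) \<partial>weighted c)"
      unfolding f_def distrib_right
      by (intro Bochner_Integration.integral_add L2_mult_cnj_integrable gL Vu \<rho>L)
    ultimately have "(\<integral>y. f y * cnj (ramp r y) \<partial>weighted c) = 0" by (simp add: add.commute)
    moreover have "(\<integral>y. f y * cnj (ramp r y) \<partial>weighted c) = (LBINT y:{0<..<r}. complex_of_real (y powr c) * f y)"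
    proof -
      have "(\<integral>y. f y * cnj (ramp r y) \<partial>weighted c) = (\<integral>y. indicator {0<..<r} y *\<^sub>R f y \<partial>weighted c)"
      proof (rule integral_cong_AE)
        show "(\<lambda>y. f y * cnj (ramp r y)) \<in> borel_measurable (weighted c)"
          by (intro borel_measurable_integrable L2_mult_cnj_integrable fL \<rho>L)
        have "(\<lambda>y. indicator {0<..<r} y :: real) \<in> borel_measurable (weighted c)" by (rule measurable_weightedI) simp
        then show "(\<lambda>y. indicator {0<..<r} y *\<^sub>R f y) \<in> borel_measurable (weighted c)"
          by (rule borel_measurable_scaleR[OF _ L2_measurable[OF fL]])
        have "AE y in weighted c. y \<noteq> r"
          unfolding AE_weighted using AE_lborel_singleton[of r] by eventually_elim simp
        moreover have "AE y in weighted c. 0 < y" unfolding AE_weighted by simp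
        ultimately show "AE y in weighted c. f y * cnj (ramp r y) = indicator {0<..<r} y *\<^sub>R f y"
          using f0 by eventually_elim (auto simp: indicator_def ramp_def)
      qed
      also have "\<dots> = (LBINT y:{0<..<r}. complex_of_real (y powr c) * f y)"
        unfolding integral_weighted set_lebesgue_integral_def
        by (rule Bochner_Integration.integral_cong[OF refl]) (auto simp: indicator_def scaleR_conv_of_real)
      finally show ?thesis .
    qed
    ultimately show ?thesis by simp
  qed
  show "AE y in weighted c. r < y \<longrightarrow> g y + complex_of_real (V y) * u y = 0"
    using f0 by (simp only: f_def)
  show "(LBINT y:{0<..<r}. complex_of_real (y powr c) * (g y + complex_of_real (V y) * u y)) = 0"
    using tot by (simp only: f_def)
  have uH: "H1 c u w1" by (rule H1_cong_AE[OF w(3,2) L2_measurable[OF uL]])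
  have "is_BV c (\<lambda>_. 0) u f"
  proof (rule Z.is_BV_I[OF uH _ fL])
    show "Z.finite_energy u" by (simp add: Z.finite_energy_def)
    fix v v' assume "H1 c v v'"
    from weak_identity[OF c fL f0 r P w10 tot this]
    show "(\<integral>y. w1 y * cnj (v' y) \<partial>weighted c) + (\<integral>y. complex_of_real 0 * u y * cnj (v y) \<partial>weighted c) =
       - (\<integral>y. f y * cnj (v y) \<partial>weighted c)" by simp
  qed
  then show "is_BV c (\<lambda>_. 0) u (\<lambda>y. g y + complex_of_real (V y) * u y)" by (simp only: f_def[abs_def])
qed

end

section \<open>Reduction to bounded support\<close>

lemma cutoff_exists:
  obtains e e' e'' :: "real \<Rightarrow> real" and B where
    "smooth_on UNIV (\<lambda>y. complex_of_real (e y))"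
    "\<And>y. (e has_real_derivative e' y) (at y)" "\<And>y. (e' has_real_derivative e'' y) (at y)"
    "continuous_on UNIV e''"
    "\<And>y. y \<le> 1 \<Longrightarrow> e y = 1" "\<And>y. 2 \<le> y \<Longrightarrow> e y = 0"
    "\<And>y. y \<notin> {1..2} \<Longrightarrow> e' y = 0" "\<And>y. y \<notin> {1..2} \<Longrightarrow> e'' y = 0"
    "\<And>y. \<bar>e y\<bar> \<le> B" "\<And>y. \<bar>e' y\<bar> \<le> B" "\<And>y. \<bar>e'' y\<bar> \<le> B"
proof -
  \<comment> \<open>The cutoff is one minus the normalized integral of a bump function.\<close>
  define q where "q y = complex_of_real (bump 1 2 0 y)" for y
  have q: "q \<in> Cc_infty {0<..}" unfolding q_def by (rule bump_Cc_infty) simp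
  have qs: "smooth_on UNIV q" unfolding q_def by (rule smooth_bump)
  have q0: "q y = 0" if "y \<notin> {1<..<2}" for y using bump_outside[OF that] by (simp add: q_def)
  obtain v where v: "is_primitive v q"
    using primitive_exists[OF locally_integrable_continuous[OF Cc_infty_continuous[OF q]]] .
  have vd: "(v has_vector_derivative q y) (at y)" if "0 < y" for y
    by (rule primitive_has_derivative[OF v Cc_infty_continuous[OF q] that])
  have vconst: "v b = v a" if "0 < a" "a < b" "\<And>t. a < t \<Longrightarrow> t < b \<Longrightarrow> q t = 0" for a b
  proof -
    have "v b - v a = (LBINT t:{a<..<b}. q t)" using v that by (simp add: is_primitive_def)
    also have "\<dots> = (LBINT t:{a<..<b}. 0)" by (intro set_lebesgue_integral_cong) (use that in auto)
    finally show ?thesis by simp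
  qed
  define I where "I = v 2 - v 1"
  have "I = (LBINT t:{1<..<2}. q t)" using v by (simp add: I_def is_primitive_def)
  also have "\<dots> = (LBINT t:{0<..}. q t)"
    unfolding set_lebesgue_integral_def by (intro Bochner_Integration.integral_cong) (use q0 in \<open>auto simp: indicator_def\<close>)
  finally have I: "I \<noteq> 0" using bump_integral_nonzero[of 1 2 0] by (simp add: q_def[abs_def])
  define \<eta> where "\<eta> y = 1 - ((if 1 < y then v y else v 1) - v 1) / I" for y
  have v1: "v y = v 1" if "0 < y" "y \<le> 1" for y
    using vconst[of y 1] q0 that by (cases "y = 1") auto
  have \<eta>d: "(\<eta> has_vector_derivative - q y / I) (at y)" for y
  proof (cases "y < 1")
    case True
    have "(\<eta> has_vector_derivative 0) (at y)"
      by (rule has_vector_derivative_transform_within_open[of "\<lambda>_. 1" _ _ "{..<1}"]) (use True in \<open>auto simp: \<eta>_def\<close>)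
    then show ?thesis using q0[of y] True by simp
  next
    case False
    then have y: "0 < y" by simp
    have "((\<lambda>y. 1 - (v y - v 1) / I) has_vector_derivative 0 - (q y - 0) / I) (at y)"
      by (rule has_vector_derivative_diff[OF has_vector_derivative_const
            has_vector_derivative_divide[OF has_vector_derivative_diff[OF vd[OF y] has_vector_derivative_const]]])
    then have "(\<eta> has_vector_derivative 0 - (q y - 0) / I) (at y)"
    proof (rule has_vector_derivative_transform_within_open[of _ _ _ "{0<..}"])
      show "1 - (v x - v 1) / I = \<eta> x" if "x \<in> {0<..}" for x
        using v1[of x] that by (cases "1 < x") (simp_all add: \<eta>_def)
    qed (use y in auto)
    then show ?thesis by simp
  qed
  have \<eta>s: "smooth_on UNIV \<eta>"
  proof (rule smooth_on_primitive[of UNIV "\<lambda>y. (- 1 / I) * q y"])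
    show "smooth_on UNIV (\<lambda>y. (- 1 / I) * q y)" by (rule smooth_on_cmult[OF qs])
    show "(\<eta> has_vector_derivative (- 1 / I) * q y) (at y within UNIV)" for y using \<eta>d[of y] by simp
  qed
  obtain q' where q': "smooth_on UNIV q'" "\<And>y. (q has_vector_derivative q' y) (at y)"
    using smooth_on_derivative[OF qs] by auto
  have q'0: "q' y = 0" if "y \<notin> {1..2}" for y
  proof -
    have "open (- {1..2::real})" by auto
    then have "(q has_vector_derivative 0) (at y)"
      by (rule has_vector_derivative_transform_within_open[of "\<lambda>_. 0", rotated 1]) (use that q0 in auto)
    with q'(2)[of y] show ?thesis by (rule vector_derivative_unique_at)
  qed
  have vRe: "v y - v 1 \<in> \<real>" if "1 < y" for y
  proof -
    have "v y - v 1 = (LBINT t:{1<..<y}. q t)" using v that by (simp add: is_primitive_def)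
    also have "\<dots> = complex_of_real (LBINT t:{1<..<y}. bump 1 2 0 t)"
      unfolding q_def by (rule set_integral_complex_of_real)
    finally show ?thesis by simp
  qed
  have \<eta>Re: "\<eta> y = complex_of_real (Re (\<eta> y))" for y
  proof -
    have "I \<in> \<real>" using vRe[of 2] by (simp add: I_def)
    then have "\<eta> y \<in> \<real>" using vRe[of y] by (auto simp: \<eta>_def)
    then show ?thesis by simp
  qed
  define e where "e y = Re (\<eta> y)" for y
  define e' where "e' y = Re (- q y / I)" for y
  define e'' where "e'' y = Re (- q' y / I)" for y
  have d1: "(e has_real_derivative e' y) (at y)" for y
    unfolding e_def e'_def has_real_derivative_iff_has_vector_derivative
    by (rule bounded_linear.has_vector_derivative[OF bounded_linear_Re \<eta>d])
  have d2: "(e' has_real_derivative e'' y) (at y)" for y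
  proof -
    have "((\<lambda>y. - q y / I) has_vector_derivative - q' y / I) (at y)"
      by (rule has_vector_derivative_divide[OF has_vector_derivative_minus[OF q'(2)]])
    then show ?thesis
      unfolding e'_def e''_def has_real_derivative_iff_has_vector_derivative
      by (rule bounded_linear.has_vector_derivative[OF bounded_linear_Re])
  qed
  have c'': "continuous_on UNIV e''"
    unfolding e''_def by (intro continuous_intros smooth_on_continuous[OF q'(1)] ballI I)
  have c: "continuous_on UNIV e" "continuous_on UNIV e'"
    using d1 d2 by (auto intro!: continuous_at_imp_continuous_on DERIV_isCont)
  have e1: "e y = 1" if "y \<le> 1" for y using that by (simp add: e_def \<eta>_def)
  have e0: "e y = 0" if "2 \<le> y" for y
  proof -
    have "v y = v 2" using vconst[of 2 y] q0 that by (cases "y = 2") auto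
    then have "\<eta> y = 1 - I / I" using that by (simp add: \<eta>_def I_def)
    then show ?thesis using I by (simp add: e_def)
  qed
  have e'0: "e' y = 0" "e'' y = 0" if "y \<notin> {1..2}" for y
    using q0[of y] q'0[OF that] that by (auto simp: e'_def e''_def)
  have "bounded (h ` {1..2})" if "continuous_on UNIV h" for h :: "real \<Rightarrow> real"
    using that by (intro compact_imp_bounded compact_continuous_image) (auto elim: continuous_on_subset)
  then obtain B1 B2 B3 where B: "\<And>y. y \<in> {1..2} \<Longrightarrow> \<bar>e y\<bar> \<le> B1" "\<And>y. y \<in> {1..2} \<Longrightarrow> \<bar>e' y\<bar> \<le> B2" "\<And>y. y \<in> {1..2} \<Longrightarrow> \<bar>e'' y\<bar> \<le> B3"
    using c c'' unfolding bounded_iff by (metis imageI real_norm_def)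
  define B where "B = max 1 (max B1 (max B2 B3))"
  show ?thesis
  proof (rule that[of e e' e'' B])
    show "smooth_on UNIV (\<lambda>y. complex_of_real (e y))" using \<eta>s \<eta>Re by (simp add: e_def)
    show "\<bar>e y\<bar> \<le> B" for y
      using B(1)[of y] e1[of y] e0[of y] by (cases "y \<in> {1..2}") (auto simp: B_def)
    show "\<bar>e' y\<bar> \<le> B" for y
      using B(2)[of y] e'0(1)[of y] by (cases "y \<in> {1..2}") (auto simp: B_def)
    show "\<bar>e'' y\<bar> \<le> B" for y
      using B(3)[of y] e'0(2)[of y] by (cases "y \<in> {1..2}") (auto simp: B_def)
  qed (fact d1 d2 c'' e1 e0 e'0)+
qed

lemma H1_mult_smooth:
  fixes k k' :: "real \<Rightarrow> real"
  assumes v: "H1 c v v'" and k: "smooth_on {0<..} (\<lambda>y. complex_of_real (k y))"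
    and d: "\<And>y. 0 < y \<Longrightarrow> (k has_real_derivative k' y) (at y)" and k'c: "continuous_on {0<..} k'"
    and B: "\<And>y. \<bar>k y\<bar> \<le> B" "\<And>y. \<bar>k' y\<bar> \<le> B"
  shows "H1 c (\<lambda>y. complex_of_real (k y) * v y) (\<lambda>y. complex_of_real (k y) * v' y + complex_of_real (k' y) * v y)"
proof -
  let ?k = "\<lambda>y. complex_of_real (k y)" and ?k' = "\<lambda>y. complex_of_real (k' y)"
  have kc: "continuous_on {0<..} ?k" by (rule smooth_on_continuous[OF k])
  have k'c': "continuous_on {0<..} ?k'" by (rule continuous_on_of_real[OF k'c])
  have L: "v \<in> L2 c" "v' \<in> L2 c" and w: "has_weak_derivative v v'" using v by (auto simp: H1_def)
  have l: "locally_integrable v" "locally_integrable v'" using w by (auto simp: has_weak_derivative_def)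
  have L1: "(\<lambda>y. ?k y * v y) \<in> L2 c" "(\<lambda>y. ?k y * v' y) \<in> L2 c" "(\<lambda>y. ?k' y * v y) \<in> L2 c"
    using B by (auto intro!: L2_bounded_mult(1)[where B = B] L measurable_weighted_continuous kc k'c')
  have "has_weak_derivative (\<lambda>y. ?k y * v y) (\<lambda>y. ?k y * v' y + ?k' y * v y)"
    unfolding has_weak_derivative_def
  proof (intro conjI ballI)
    show "locally_integrable (\<lambda>y. ?k y * v y)" by (rule L2_imp_locally_integrable[OF L1(1)])
    show "locally_integrable (\<lambda>y. ?k y * v' y + ?k' y * v y)"
      by (rule L2_imp_locally_integrable[OF L2_add[OF L1(2,3)]])
    fix \<phi> assume \<phi>: "\<phi> \<in> Cc_infty {0<..}"
    obtain \<phi>' where \<phi>': "\<phi>' \<in> Cc_infty {0<..}" "\<And>x. 0 < x \<Longrightarrow> (\<phi> has_vector_derivative \<phi>' x) (at x)"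
      by (rule test_function_derivative[OF \<phi>]) blast
    have k\<phi>: "(\<lambda>y. ?k y * \<phi> y) \<in> Cc_infty {0<..}" by (rule Cc_infty_mult_smooth[OF k \<phi>])
    have k\<phi>d: "((\<lambda>y. ?k y * \<phi> y) has_vector_derivative ?k y * \<phi>' y + ?k' y * \<phi> y) (at y)" if "0 < y" for y
    proof -
      have "(?k has_vector_derivative ?k' y) (at y)"
        using d[OF that] by (intro has_vector_derivative_of_real) (simp add: has_real_derivative_iff_has_vector_derivative)
      from has_vector_derivative_mult[OF this \<phi>'(2)[OF that]] show ?thesis by simp
    qed
    have i1: "set_integrable lborel {0<..} (\<lambda>y. v y * (?k y * \<phi>' y))"
      by (intro integrable_mult_test l Cc_infty_mult_smooth[OF k \<phi>'(1)])
    have i2: "set_integrable lborel {0<..} (\<lambda>y. (v y * ?k' y) * \<phi> y)"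
      by (intro integrable_mult_test \<phi> locally_integrable_mult_continuous l k'c')
    have i3: "set_integrable lborel {0<..} (\<lambda>y. v' y * (?k y * \<phi> y))"
      by (intro integrable_mult_test l k\<phi>)
    have "(LBINT y:{0<..}. v y * (?k y * \<phi>' y)) + (LBINT y:{0<..}. (v y * ?k' y) * \<phi> y) =
        (LBINT y:{0<..}. v y * vector_derivative (\<lambda>y. ?k y * \<phi> y) (at y))"
    proof (subst set_integral_add(2)[OF i1 i2, symmetric], intro set_lebesgue_integral_cong allI impI)
      fix y :: real assume "y \<in> {0<..}"
      then have "vector_derivative (\<lambda>y. ?k y * \<phi> y) (at y) = ?k y * \<phi>' y + ?k' y * \<phi> y"
        by (intro vector_derivative_at k\<phi>d) simp
      then show "v y * (?k y * \<phi>' y) + v y * ?k' y * \<phi> y = v y * vector_derivative (\<lambda>y. ?k y * \<phi> y) (at y)"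
        by (simp only: distrib_left mult.assoc)
    qed simp
    also have "\<dots> = - (LBINT y:{0<..}. v' y * (?k y * \<phi> y))"
      using w k\<phi> by (simp add: has_weak_derivative_def)
    finally have "(LBINT y:{0<..}. v y * (?k y * \<phi>' y)) =
       - ((LBINT y:{0<..}. v' y * (?k y * \<phi> y)) + (LBINT y:{0<..}. (v y * ?k' y) * \<phi> y))"
      by (simp add: eq_diff_eq[symmetric])
    moreover have "(LBINT y:{0<..}. ?k y * v y * vector_derivative \<phi> (at y)) = (LBINT y:{0<..}. v y * (?k y * \<phi>' y))"
      by (intro set_lebesgue_integral_cong) (auto simp: vector_derivative_at[OF \<phi>'(2)])
    moreover have "(LBINT y:{0<..}. (?k y * v' y + ?k' y * v y) * \<phi> y) =
        (LBINT y:{0<..}. v' y * (?k y * \<phi> y)) + (LBINT y:{0<..}. (v y * ?k' y) * \<phi> y)"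
      by (subst set_integral_add(2)[OF i3 i2, symmetric], intro set_lebesgue_integral_cong) (auto simp: algebra_simps)
    ultimately show "(LBINT y:{0<..}. ?k y * v y * vector_derivative \<phi> (at y)) = - (LBINT y:{0<..}. (?k y * v' y + ?k' y * v y) * \<phi> y)"
      by simp
  qed
  then show ?thesis using L1 L2_add[OF L1(2,3)] by (simp add: H1_def)
qed

context potential
begin

lemma finite_energy_bounded_mult:
  assumes v: "finite_energy v" "v \<in> borel_measurable (weighted c)" and k: "k \<in> borel_measurable (weighted c)" "\<And>y. norm (k y) \<le> B"
  shows "finite_energy (\<lambda>y. k y * v y)"
  unfolding finite_energy_def
proof (rule Bochner_Integration.integrable_bound)
  show "integrable (weighted c) (\<lambda>y. B\<^sup>2 * (V y * (norm (v y))\<^sup>2))"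
    using v by (intro integrable_mult_right) (simp add: finite_energy_def)
  show "(\<lambda>y. V y * (norm (k y * v y))\<^sup>2) \<in> borel_measurable (weighted c)"
    using v(2) k(1) V_measurable by measurable
  show "AE y in weighted c. norm (V y * (norm (k y * v y))\<^sup>2) \<le> norm (B\<^sup>2 * (V y * (norm (v y))\<^sup>2))"
  proof (rule AE_I2)
    fix y
    have "(norm (k y))\<^sup>2 * (\<bar>V y\<bar> * (norm (v y))\<^sup>2) \<le> B\<^sup>2 * (\<bar>V y\<bar> * (norm (v y))\<^sup>2)"
      using k(2)[of y] by (intro mult_right_mono power_mono) auto
    then show "norm (V y * (norm (k y * v y))\<^sup>2) \<le> norm (B\<^sup>2 * (V y * (norm (v y))\<^sup>2))"
      by (simp add: norm_mult power_mult_distrib abs_mult mult_ac)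
  qed
qed

text \<open>The cutoff \<open>k\<close> is moved from the solution to the test function, which changes the first part of the form by
  the integral of \<open>k' (w cnj v' - w1 cnj v)\<close>.  The term with \<open>v'\<close> is integrated by parts; this is
  harmless because \<open>k'\<close> is supported away from \<open>0\<close>.\<close>

lemma cutoff_is_BV:
  fixes k k' k'' :: "real \<Rightarrow> real"
  assumes w: "is_BV c V w g" "H1 c w w1" and wd: "\<And>y. 0 < y \<Longrightarrow> (w has_vector_derivative w1 y) (at y)"
    and w1c: "continuous_on {0<..} w1"
    and k: "smooth_on {0<..} (\<lambda>y. complex_of_real (k y))"
    and d: "\<And>y. (k has_real_derivative k' y) (at y)" "\<And>y. (k' has_real_derivative k'' y) (at y)" and k''c: "continuous_on UNIV k''"
    and z: "\<And>y. y \<notin> {a..R} \<Longrightarrow> k' y = 0" "\<And>y. y \<notin> {a..R} \<Longrightarrow> k'' y = 0" and aR: "0 < a" "a < R"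
    and B: "\<And>y. \<bar>k y\<bar> \<le> B" "\<And>y. \<bar>k' y\<bar> \<le> B" "\<And>y. \<bar>k'' y + c / y * k' y\<bar> \<le> B"
  shows "is_BV c V (\<lambda>y. complex_of_real (k y) * w y)
     (\<lambda>y. complex_of_real (k y) * g y + complex_of_real (2 * k' y) * w1 y + complex_of_real (k'' y + c / y * k' y) * w y)"
proof -
  let ?M = "weighted c"
  let ?k = "\<lambda>y. complex_of_real (k y)" and ?k' = "\<lambda>y. complex_of_real (k' y)"
  let ?l = "\<lambda>y. complex_of_real (k'' y + c / y * k' y)"
  have kc: "continuous_on {0<..} k" "continuous_on {0<..} k'"
    using d by (auto intro!: continuous_at_imp_continuous_on DERIV_isCont)
  have k''c': "continuous_on {0<..} k''" using k''c by (rule continuous_on_subset) simp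
  have km: "?k \<in> borel_measurable ?M" "?k' \<in> borel_measurable ?M" "?l \<in> borel_measurable ?M"
    by (intro measurable_weighted_continuous continuous_intros kc k''c'; simp)+
  have wL: "w \<in> L2 c" "w1 \<in> L2 c" and gL: "g \<in> L2 c" using w(2) is_BV_D(3)[OF w(1)] by (auto simp: H1_def)
  have wc: "continuous_on {0<..} w"
    using wd by (intro continuous_at_imp_continuous_on ballI has_vector_derivative_continuous) auto
  have kB: "AE y in ?M. norm (?k y) \<le> B" "AE y in ?M. norm (?k' y) \<le> B" "AE y in ?M. norm (?l y) \<le> B"
    using B by (auto simp del: of_real_add of_real_mult)
  note kL = L2_bounded_mult(1)[OF _ km(1) kB(1)] L2_bounded_mult(1)[OF _ km(2) kB(2)] L2_bounded_mult(1)[OF _ km(3) kB(3)]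
  have L: "(\<lambda>y. ?k y * g y) \<in> L2 c" "(\<lambda>y. ?k y * w1 y) \<in> L2 c" "(\<lambda>y. ?k' y * w y) \<in> L2 c" "(\<lambda>y. ?k' y * w1 y) \<in> L2 c" "(\<lambda>y. ?l y * w y) \<in> L2 c"
    by (intro kL gL wL)+
  have kw: "H1 c (\<lambda>y. ?k y * w y) (\<lambda>y. ?k y * w1 y + ?k' y * w y)"
    by (rule H1_mult_smooth[OF w(2) k d(1) kc(2) B(1,2)])
  define f where "f y = ?k' y * w1 y + ?l y * w y" for y
  have fL: "f \<in> L2 c" unfolding f_def by (rule L2_add[OF L(4,5)])
  have Pd: "((\<lambda>y. complex_of_real (y powr c) * (?k' y * w y)) has_vector_derivative complex_of_real (y powr c) * f y) (at y)" if "0 < y" for y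
  proof -
    have "((\<lambda>y. y powr c) has_real_derivative c * y powr (c - 1)) (at y)"
      using that by (auto intro!: derivative_eq_intros)
    then have 1: "((\<lambda>y. complex_of_real (y powr c)) has_vector_derivative complex_of_real (c * y powr (c - 1))) (at y)"
      by (intro has_vector_derivative_of_real) (simp add: has_real_derivative_iff_has_vector_derivative)
    have 2: "(?k' has_vector_derivative complex_of_real (k'' y)) (at y)"
      using d(2)[of y] by (intro has_vector_derivative_of_real) (simp add: has_real_derivative_iff_has_vector_derivative)
    have p: "y powr (c - 1) = y powr c / y" using that by (simp add: powr_diff)
    show ?thesis
      using has_vector_derivative_mult[OF 1 has_vector_derivative_mult[OF 2 wd[OF that]]]
      by (rule has_vector_derivative_eq_rhs) (simp add: f_def p algebra_simps)
  qed
  have P: "is_primitive (\<lambda>y. complex_of_real (y powr c) * (?k' y * w y)) (\<lambda>y. complex_of_real (y powr c) * f y)"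
  proof (rule primitiveI[of _ _ "{}"])
    show "continuous_on {0<..} (\<lambda>y. complex_of_real (y powr c) * (?k' y * w y))"
      by (intro continuous_intros kc wc) auto
    show "locally_integrable (\<lambda>y. complex_of_real (y powr c) * f y)"
      by (rule L2_imp_locally_integrable_weighted[OF fL])
  qed (use Pd in auto)
  define R' where "R' = R + 1"
  have fz: "f y = 0" if "y \<notin> {a..R}" for y using z[OF that] by (simp add: f_def)
  have tot: "(LBINT y:{0<..<R'}. complex_of_real (y powr c) * f y) = 0"
  proof -
    have "(LBINT y:{0<..<R'}. complex_of_real (y powr c) * f y) = (LBINT y:{a/2<..<R'}. complex_of_real (y powr c) * f y)"
      by (rule set_integral_vanishing_near_0) (use fz aR in auto)
    also have "\<dots> = complex_of_real (R' powr c) * (?k' R' * w R') - complex_of_real ((a/2) powr c) * (?k' (a/2) * w (a/2))"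
    proof -
      have "0 < a / 2" "a / 2 < R'" using aR by (auto simp: R'_def)
      with P show ?thesis unfolding is_primitive_def by simp
    qed
    also have "\<dots> = 0"
      using z(1)[of R'] z(1)[of "a/2"] aR by (simp add: R'_def)
    finally show ?thesis .
  qed
  show ?thesis
  proof (rule is_BV_I[OF kw])
    show "finite_energy (\<lambda>y. ?k y * w y)"
      by (rule finite_energy_bounded_mult[OF is_BV_D(2)[OF w(1)] L2_measurable[OF wL(1)] km(1)]) (use B in simp)
    have "(\<lambda>y. complex_of_real 2 * (?k' y * w1 y)) \<in> L2 c" by (rule L2_cmult[OF L(4)])
    then show "(\<lambda>y. ?k y * g y + complex_of_real (2 * k' y) * w1 y + ?l y * w y) \<in> L2 c"
      by (intro L2_add L) (simp add: mult.assoc)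
    fix v v' assume v: "H1 c v v'" "finite_energy v"
    then have vL: "v \<in> L2 c" "v' \<in> L2 c" by (auto simp: H1_def)
    have kv: "H1 c (\<lambda>y. ?k y * v y) (\<lambda>y. ?k y * v' y + ?k' y * v y)"
      by (rule H1_mult_smooth[OF v(1) k d(1) kc(2) B(1,2)])
    have kvE: "finite_energy (\<lambda>y. ?k y * v y)"
      by (rule finite_energy_bounded_mult[OF v(2) L2_measurable[OF vL(1)] km(1)]) (use B in simp)
    have wi: "(\<integral>y. ?k' y * w y * cnj (v' y) \<partial>?M) = - (\<integral>y. f y * cnj (v y) \<partial>?M)"
      by (rule weak_identity[OF c fL _ _ P _ tot v(1)]) (use fz z aR in \<open>auto simp: R'_def intro!: AE_I2\<close>)
    note i = L2_mult_cnj_integrable[OF _ vL(1)] L2_mult_cnj_integrable[OF _ vL(2)]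
    have e1: "(\<integral>y. w1 y * cnj (?k y * v' y + ?k' y * v y) \<partial>?M) = (\<integral>y. ?k y * w1 y * cnj (v' y) \<partial>?M) + (\<integral>y. ?k' y * w1 y * cnj (v y) \<partial>?M)"
    proof -
      have "(\<integral>y. ?k y * w1 y * cnj (v' y) \<partial>?M) + (\<integral>y. ?k' y * w1 y * cnj (v y) \<partial>?M) =
        (\<integral>y. ?k y * w1 y * cnj (v' y) + ?k' y * w1 y * cnj (v y) \<partial>?M)"
        by (simp only: Bochner_Integration.integral_add i L)
      also have "\<dots> = (\<integral>y. w1 y * cnj (?k y * v' y + ?k' y * v y) \<partial>?M)"
        by (intro Bochner_Integration.integral_cong refl) (simp add: algebra_simps)
      finally show ?thesis by simp
    qed
    have e2: "(\<integral>y. (?k y * w1 y + ?k' y * w y) * cnj (v' y) \<partial>?M) = (\<integral>y. ?k y * w1 y * cnj (v' y) \<partial>?M) + (\<integral>y. ?k' y * w y * cnj (v' y) \<partial>?M)"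
      unfolding distrib_right by (intro Bochner_Integration.integral_add i L)
    have e3: "(\<integral>y. (?k y * g y + complex_of_real (2 * k' y) * w1 y + ?l y * w y) * cnj (v y) \<partial>?M) =
      (\<integral>y. ?k y * g y * cnj (v y) \<partial>?M) + ((\<integral>y. ?k' y * w1 y * cnj (v y) \<partial>?M) + (\<integral>y. f y * cnj (v y) \<partial>?M))"
    proof -
      have "(\<integral>y. ?k y * g y * cnj (v y) \<partial>?M) + ((\<integral>y. ?k' y * w1 y * cnj (v y) \<partial>?M) + (\<integral>y. f y * cnj (v y) \<partial>?M)) =
        (\<integral>y. ?k y * g y * cnj (v y) + (?k' y * w1 y * cnj (v y) + f y * cnj (v y)) \<partial>?M)"
        by (simp only: Bochner_Integration.integral_add Bochner_Integration.integrable_add i L fL)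
      also have "\<dots> = (\<integral>y. (?k y * g y + complex_of_real (2 * k' y) * w1 y + ?l y * w y) * cnj (v y) \<partial>?M)"
        by (intro Bochner_Integration.integral_cong refl) (simp add: f_def algebra_simps)
      finally show ?thesis by simp
    qed
    have e4: "(\<integral>y. complex_of_real (V y) * (?k y * w y) * cnj (v y) \<partial>?M) = (\<integral>y. complex_of_real (V y) * w y * cnj (?k y * v y) \<partial>?M)"
      by (intro Bochner_Integration.integral_cong refl) simp
    have e5: "(\<integral>y. g y * cnj (?k y * v y) \<partial>?M) = (\<integral>y. ?k y * g y * cnj (v y) \<partial>?M)"
      by (intro Bochner_Integration.integral_cong refl) simp
    have *: "A + W + Q = - (G + (Bb + F))" if "A + Bb + Q = - G" "W = - F" for A Bb Q G W F :: complex
    proof -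
      from that(1) have "A = - G - Q - Bb" by (simp add: algebra_simps eq_neg_iff_add_eq_0)
      with that(2) show ?thesis by simp
    qed
    show "(\<integral>y. (?k y * w1 y + ?k' y * w y) * cnj (v' y) \<partial>?M) + (\<integral>y. complex_of_real (V y) * (?k y * w y) * cnj (v y) \<partial>?M) =
       - (\<integral>y. (?k y * g y + complex_of_real (2 * k' y) * w1 y + ?l y * w y) * cnj (v y) \<partial>?M)"
      unfolding e2 e3 e4
      by (rule *[OF _ wi]) (use is_BV_D(5)[OF w(1,2) kv kvE] in \<open>simp only: e1 e5\<close>)
  qed
qed

end

lemma L2_dominated_convergence:
  assumes h: "h \<in> L2 c" and m: "\<And>n. f n \<in> borel_measurable (weighted c)"
    and le: "\<And>n. AE y in weighted c. norm (f n y) \<le> norm (h y)"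
    and lim: "AE y in weighted c. (\<lambda>n. f n y) \<longlonglongrightarrow> 0"
  shows "(\<lambda>n. L2_norm c (f n)) \<longlonglongrightarrow> 0"
proof -
  have "(\<lambda>n. \<integral>y. (norm (f n y))\<^sup>2 \<partial>weighted c) \<longlonglongrightarrow> (\<integral>y. 0 \<partial>weighted c)"
  proof (rule integral_dominated_convergence[OF _ _ L2_square_integrable[OF h]])
    show "(\<lambda>y. (norm (f n y))\<^sup>2) \<in> borel_measurable (weighted c)" for n
      using m[of n] by measurable
    show "AE y in weighted c. (\<lambda>n. (norm (f n y))\<^sup>2) \<longlonglongrightarrow> 0"
      using lim by eventually_elim (use tendsto_norm_zero tendsto_power[of _ "0::real" _ 2] in fastforce)
    show "AE y in weighted c. norm ((norm (f n y))\<^sup>2) \<le> (norm (h y))\<^sup>2" for n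
      using le[of n] by eventually_elim (auto intro: power_mono)
  qed simp
  then have "(\<lambda>n. sqrt (\<integral>y. (norm (f n y))\<^sup>2 \<partial>weighted c)) \<longlonglongrightarrow> sqrt 0"
    by (intro tendsto_real_sqrt) simp
  then show ?thesis by (simp add: L2_norm_def)
qed

text \<open>With \<open>k(y) = e(y/n)\<close> the first derivative of the cutoff is of order \<open>1/n\<close> and the second of order
  \<open>1/n\<^sup>2\<close>.  The coefficient \<open>c/y\<close> is bounded on the support of \<open>k'\<close>, where \<open>y \<ge> n \<ge> 1\<close>.  The commutator terms
  therefore tend to zero.\<close>

lemma (in potential) cutoff_dense:
  assumes u: "is_BV c V u g" and \<epsilon>: "\<epsilon> > 0"
  obtains R w h where "R > 0" "is_BV c V w h" "\<And>y. R < y \<Longrightarrow> w y = 0"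
    "L2_norm c (\<lambda>y. u y - w y) + L2_norm c (\<lambda>y. g y - h y) < \<epsilon>"
proof -
  obtain w w1 where w: "is_BV c V w g" "AE y in weighted c. u y = w y" "H1 c w w1"
      "\<And>y. 0 < y \<Longrightarrow> (w has_vector_derivative w1 y) (at y)" "continuous_on {0<..} w1"
    by (rule regularity[OF u]) (rule that; assumption)
  have L: "w \<in> L2 c" "w1 \<in> L2 c" "g \<in> L2 c" "u \<in> L2 c"
    using w(3) is_BV_D(3,4)[OF u] by (auto simp: H1_def)
  obtain e e' e'' B where es: "smooth_on UNIV (\<lambda>y. complex_of_real (e y))"
    and ed: "\<And>y. (e has_real_derivative e' y) (at y)" "\<And>y. (e' has_real_derivative e'' y) (at y)"
    and e''c: "continuous_on UNIV e''"
    and e1: "\<And>y. y \<le> 1 \<Longrightarrow> e y = 1" and e2: "\<And>y. 2 \<le> y \<Longrightarrow> e y = 0"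
    and e0: "\<And>y. y \<notin> {1..2} \<Longrightarrow> e' y = 0" "\<And>y. y \<notin> {1..2} \<Longrightarrow> e'' y = 0"
    and eB: "\<And>y. \<bar>e y\<bar> \<le> B" "\<And>y. \<bar>e' y\<bar> \<le> B" "\<And>y. \<bar>e'' y\<bar> \<le> B"
    by (rule cutoff_exists) (rule that; assumption)
  have B0: "0 \<le> B" using eB(1)[of 0] by linarith
  define N where "N n = real (Suc n)" for n
  have N: "1 \<le> N n" "0 < N n" for n by (auto simp: N_def)
  define D where "D = B * (1 + \<bar>c\<bar>)"
  have BD: "B \<le> D" and D0: "0 \<le> D" using B0 by (auto simp: D_def mult_le_cancel_left1)
  define k where "k n y = e (y / N n)" for n y
  define k' where "k' n y = e' (y / N n) / N n" for n y
  define k'' where "k'' n y = e'' (y / N n) / (N n)\<^sup>2" for n y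
  have kd: "(k n has_real_derivative k' n y) (at y)" "(k' n has_real_derivative k'' n y) (at y)" for n y
  proof -
    have i: "((\<lambda>y. y / N n) has_real_derivative 1 / N n) (at y)"
      using N[of n] by (auto intro!: derivative_eq_intros)
    show "(k n has_real_derivative k' n y) (at y)"
      using DERIV_chain2[OF ed(1) i] by (simp add: k_def[abs_def] k'_def)
    show "(k' n has_real_derivative k'' n y) (at y)"
      using DERIV_cdivide[OF DERIV_chain2[OF ed(2) i], of "N n"]
      by (simp add: k'_def[abs_def] k''_def power2_eq_square)
  qed
  have kz: "k' n y = 0" "k'' n y = 0" if "y \<notin> {N n..2 * N n}" for n y
    using e0[of "y / N n"] that N[of n] by (auto simp: k'_def k''_def field_simps)
  have k'b: "\<bar>k' n y\<bar> \<le> B / N n" for n y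
    using divide_right_mono[OF eB(2)[of "y / N n"], of "N n"] N[of n] by (simp add: k'_def)
  have lb: "\<bar>k'' n y + c / y * k' n y\<bar> \<le> D / N n" for n y
  proof (cases "y \<in> {N n..2 * N n}")
    case True
    then have y: "1 \<le> y" using N(1)[of n] by auto
    have "\<bar>e'' (y / N n)\<bar> / (N n)\<^sup>2 \<le> B / N n"
      using eB(3)[of "y / N n"] N[of n] B0 by (intro frac_le) (auto simp: power2_eq_square)
    then have 1: "\<bar>k'' n y\<bar> \<le> B / N n" by (simp add: k''_def)
    have "\<bar>c / y\<bar> \<le> \<bar>c\<bar>" using y by (simp add: abs_divide divide_le_eq mult_le_cancel_left1)
    then have "\<bar>c / y\<bar> * \<bar>k' n y\<bar> \<le> \<bar>c\<bar> * (B / N n)"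
      using k'b[of n y] by (intro mult_mono) auto
    then have "\<bar>c / y * k' n y\<bar> \<le> \<bar>c\<bar> * (B / N n)" by (simp only: abs_mult)
    with 1 have "\<bar>k'' n y + c / y * k' n y\<bar> \<le> B / N n + \<bar>c\<bar> * (B / N n)" by linarith
    also have "\<dots> = D / N n" using N[of n] by (simp add: D_def add_divide_distrib distrib_left mult.commute)
    finally show ?thesis .
  next
    case False
    with kz[OF this] D0 N[of n] show ?thesis by simp
  qed
  have BV: "is_BV c V (\<lambda>y. complex_of_real (k n y) * w y)
     (\<lambda>y. complex_of_real (k n y) * g y + complex_of_real (2 * k' n y) * w1 y + complex_of_real (k'' n y + c / y * k' n y) * w y)" for n
  proof (rule cutoff_is_BV[OF w(1,3,4,5) _ kd, where a = "N n" and R = "2 * N n" and B = D])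
    have "smooth_on {0<..} (\<lambda>y. complex_of_real (e (1 / N n * y + 0)))"
      by (rule smooth_on_scaled[OF es])
    then show "smooth_on {0<..} (\<lambda>y. complex_of_real (k n y))" by (simp add: k_def)
    show "continuous_on UNIV (k'' n)"
      unfolding k''_def[abs_def] using N[of n]
      by (intro continuous_intros continuous_on_compose2[OF e''c]) auto
    show "\<bar>k n y\<bar> \<le> D" for y using eB(1)[of "y / N n"] BD by (simp add: k_def)
    have le: "x / N n \<le> x" if "0 \<le> x" for x using that N[of n] by (simp add: divide_le_eq mult_le_cancel_left1)
    show "\<bar>k' n y\<bar> \<le> D" for y using k'b[of n y] le[OF B0] BD by linarith
    show "\<bar>k'' n y + c / y * k' n y\<bar> \<le> D" for y using lb[of n y] le[OF D0] by linarith
  qed (use kz N[of n] in auto)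
  have km: "continuous_on {0<..} (k n)" "continuous_on {0<..} (k' n)" "continuous_on {0<..} (k'' n)" for n
  proof -
    show "continuous_on {0<..} (k n)" "continuous_on {0<..} (k' n)"
      using kd by (auto intro!: continuous_at_imp_continuous_on DERIV_isCont)
    show "continuous_on {0<..} (k'' n)"
      unfolding k''_def[abs_def] using N[of n]
      by (intro continuous_intros continuous_on_compose2[OF e''c]) auto
  qed
  define j where "j n y = complex_of_real (1 - k n y)" for n y
  have jm: "j n \<in> borel_measurable (weighted c)" for n
    unfolding j_def[abs_def] by (intro measurable_weighted_continuous continuous_intros km)
  have jb: "norm (j n y) \<le> 1 + B" for n y
    using eB(1)[of "y / N n"] by (simp add: j_def k_def del: of_real_diff)
  have tail: "(\<lambda>n. L2_norm c (\<lambda>y. j n y * x y)) \<longlonglongrightarrow> 0" if x: "x \<in> L2 c" for x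
  proof (rule L2_dominated_convergence[OF L2_cmult(1)[OF x, of "complex_of_real (1 + B)"]])
    show "(\<lambda>y. j n y * x y) \<in> borel_measurable (weighted c)" for n
      by (intro borel_measurable_times jm L2_measurable x)
    show "AE y in weighted c. norm (j n y * x y) \<le> norm (complex_of_real (1 + B) * x y)" for n
      using jb[of n] B0 by (intro AE_I2) (simp add: norm_mult mult_right_mono del: of_real_add)
    show "AE y in weighted c. (\<lambda>n. j n y * x y) \<longlonglongrightarrow> 0"
    proof (rule AE_I2)
      fix y
      obtain n0 :: nat where n0: "y < real n0" using reals_Archimedean2 by blast
      have "j n y = 0" if "n \<ge> n0" for n
      proof -
        have "y \<le> N n" using n0 that by (simp add: N_def)
        then have "y / N n \<le> 1" using N[of n] by simp
        then show ?thesis by (simp add: j_def k_def e1)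
      qed
      then have "eventually (\<lambda>n. j n y * x y = 0) sequentially"
        by (auto simp: eventually_sequentially intro!: exI[of _ n0])
      then show "(\<lambda>n. j n y * x y) \<longlonglongrightarrow> 0" by (rule tendsto_eventually)
    qed
  qed
  define h where "h n y = complex_of_real (k n y) * g y + complex_of_real (2 * k' n y) * w1 y + complex_of_real (k'' n y + c / y * k' n y) * w y" for n y
  have hL: "h n \<in> L2 c" for n using is_BV_D(3)[OF BV[of n]] by (simp add: h_def[abs_def])
  have est1: "L2_norm c (\<lambda>y. u y - complex_of_real (k n y) * w y) = L2_norm c (\<lambda>y. j n y * w y)" for n
  proof (rule L2_norm_cong_AE)
    show "(\<lambda>y. u y - complex_of_real (k n y) * w y) \<in> L2 c"
      by (rule L2_diff[OF L(4) is_BV_D(4)[OF BV[of n]]])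
    show "(\<lambda>y. j n y * w y) \<in> L2 c"
      by (rule L2_bounded_mult(1)[OF L(1) jm]) (use jb in auto)
    show "AE y in weighted c. u y - complex_of_real (k n y) * w y = j n y * w y"
      using w(2) by eventually_elim (simp add: j_def algebra_simps)
  qed
  have est2: "L2_norm c (\<lambda>y. g y - h n y) \<le> L2_norm c (\<lambda>y. j n y * g y) + (2 * B / N n * L2_norm c w1 + D / N n * L2_norm c w)" for n
  proof -
    let ?p = "\<lambda>y. complex_of_real (2 * k' n y) * w1 y" and ?q = "\<lambda>y. complex_of_real (k'' n y + c / y * k' n y) * w y"
    have pm: "(\<lambda>y. complex_of_real (2 * k' n y)) \<in> borel_measurable (weighted c)"
      by (intro measurable_weighted_continuous continuous_intros km)
    have qm: "(\<lambda>y. complex_of_real (k'' n y + c / y * k' n y)) \<in> borel_measurable (weighted c)"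
      by (intro measurable_weighted_continuous continuous_intros km) auto
    have p: "?p \<in> L2 c" "L2_norm c ?p \<le> \<bar>2 * B / N n\<bar> * L2_norm c w1"
    proof -
      have "AE y in weighted c. norm (complex_of_real (2 * k' n y)) \<le> 2 * B / N n"
      proof (rule AE_I2)
        fix y show "norm (complex_of_real (2 * k' n y)) \<le> 2 * B / N n"
          unfolding norm_of_real using k'b[of n y] by simp
      qed
      from L2_bounded_mult[OF L(2) pm this] show "?p \<in> L2 c" "L2_norm c ?p \<le> \<bar>2 * B / N n\<bar> * L2_norm c w1" .
    qed
    have q: "?q \<in> L2 c" "L2_norm c ?q \<le> \<bar>D / N n\<bar> * L2_norm c w"
    proof -
      have "AE y in weighted c. norm (complex_of_real (k'' n y + c / y * k' n y)) \<le> D / N n"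
        unfolding norm_of_real using lb by simp
      from L2_bounded_mult[OF L(1) qm this] show "?q \<in> L2 c" "L2_norm c ?q \<le> \<bar>D / N n\<bar> * L2_norm c w" .
    qed
    have jg: "(\<lambda>y. j n y * g y) \<in> L2 c"
      by (rule L2_bounded_mult(1)[OF L(3) jm]) (use jb in auto)
    have "L2_norm c (\<lambda>y. g y - h n y) = L2_norm c (\<lambda>y. j n y * g y - (?p y + ?q y))"
      by (intro arg_cong[where f = "L2_norm c"] ext) (simp add: h_def j_def algebra_simps)
    also have "\<dots> \<le> L2_norm c (\<lambda>y. j n y * g y) + L2_norm c (\<lambda>y. ?p y + ?q y)"
      by (rule L2_norm_triangle_diff[OF jg L2_add[OF p(1) q(1)]])
    also have "L2_norm c (\<lambda>y. ?p y + ?q y) \<le> L2_norm c ?p + L2_norm c ?q"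
      by (rule L2_norm_triangle[OF p(1) q(1)])
    finally show ?thesis using p(2) q(2) B0 D0 N[of n] by simp
  qed
  have "(\<lambda>n. L2_norm c (\<lambda>y. j n y * w y) + (L2_norm c (\<lambda>y. j n y * g y) + (2 * B / N n * L2_norm c w1 + D / N n * L2_norm c w)))
      \<longlonglongrightarrow> 0 + (0 + (0 * L2_norm c w1 + 0 * L2_norm c w))"
  proof (intro tendsto_add tail L tendsto_mult tendsto_const)
    have "(\<lambda>n. x / N n) \<longlonglongrightarrow> 0" for x
      using tendsto_mult[OF tendsto_const[of x] LIMSEQ_inverse_real_of_nat] by (simp add: N_def divide_inverse)
    then show "(\<lambda>n. 2 * B / N n) \<longlonglongrightarrow> 0" "(\<lambda>n. D / N n) \<longlonglongrightarrow> 0" by blast+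
  qed
  then have "eventually (\<lambda>n. L2_norm c (\<lambda>y. j n y * w y) + (L2_norm c (\<lambda>y. j n y * g y) + (2 * B / N n * L2_norm c w1 + D / N n * L2_norm c w)) < \<epsilon>) sequentially"
    using \<epsilon> by (intro order_tendstoD(2)) auto
  then obtain n where n: "L2_norm c (\<lambda>y. j n y * w y) + (L2_norm c (\<lambda>y. j n y * g y) + (2 * B / N n * L2_norm c w1 + D / N n * L2_norm c w)) < \<epsilon>"
    by (auto simp: eventually_sequentially)
  show ?thesis
  proof (rule that[of "2 * N n" "\<lambda>y. complex_of_real (k n y) * w y" "h n"])
    show "is_BV c V (\<lambda>y. complex_of_real (k n y) * w y) (h n)" using BV[of n] by (simp only: h_def[abs_def])
    show "complex_of_real (k n y) * w y = 0" if "2 * N n < y" for y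
    proof -
      have "2 \<le> y / N n" using that N[of n] by (simp add: le_divide_eq)
      then show ?thesis by (simp add: k_def e2)
    qed
    show "L2_norm c (\<lambda>y. u y - complex_of_real (k n y) * w y) + L2_norm c (\<lambda>y. g y - h n y) < \<epsilon>"
      using est1[of n] est2[of n] n by linarith
  qed (use N[of n] in simp)
qed

section \<open>Density of test functions\<close>

definition approximable :: "real \<Rightarrow> real \<Rightarrow> (real \<Rightarrow> complex) set" where
  "approximable c r = {f \<in> L2 c. \<forall>\<epsilon>>0. \<exists>\<phi>\<in>Cc_infty {0<..}. (\<forall>y\<ge>r. \<phi> y = 0) \<and> L2_norm c (\<lambda>y. f y - \<phi> y) < \<epsilon>}"

lemma Cc_infty_L2:
  assumes "c > -1" "\<phi> \<in> Cc_infty {0<..}"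
  shows "\<phi> \<in> L2 c"
proof -
  interpret potential c "\<lambda>_. 0" using assms(1) by unfold_locales auto
  obtain \<phi>' where "\<And>x. 0 < x \<Longrightarrow> (\<phi> has_vector_derivative \<phi>' x) (at x)"
    by (rule test_function_derivative[OF assms(2)]) blast
  from test_function_H1(1)[OF assms(2) this] have "(\<lambda>y. cnj (\<phi> y)) \<in> L2 c" by (simp add: H1_def)
  from L2_cnj[OF this] show ?thesis by simp
qed

lemma approximable_L2: "f \<in> approximable c r \<Longrightarrow> f \<in> L2 c"
  by (simp add: approximable_def)

lemma approximable_closed:
  assumes f: "f \<in> L2 c" and c: "c > -1"
    and ap: "\<And>\<epsilon>. \<epsilon> > 0 \<Longrightarrow> \<exists>h\<in>approximable c r. L2_norm c (\<lambda>y. f y - h y) < \<epsilon>"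
  shows "f \<in> approximable c r"
  unfolding approximable_def
proof (intro CollectI conjI f allI impI)
  fix \<epsilon> :: real assume \<epsilon>: "\<epsilon> > 0"
  obtain h where h: "h \<in> approximable c r" "L2_norm c (\<lambda>y. f y - h y) < \<epsilon> / 2"
    using ap[of "\<epsilon> / 2"] \<epsilon> by auto
  obtain \<phi> where \<phi>: "\<phi> \<in> Cc_infty {0<..}" "\<forall>y\<ge>r. \<phi> y = 0" "L2_norm c (\<lambda>y. h y - \<phi> y) < \<epsilon> / 2"
    using h(1) \<epsilon> unfolding approximable_def by (force dest: spec[of _ "\<epsilon> / 2"])
  have "L2_norm c (\<lambda>y. f y - \<phi> y) = L2_norm c (\<lambda>y. (f y - h y) + (h y - \<phi> y))" by simp
  also have "\<dots> \<le> L2_norm c (\<lambda>y. f y - h y) + L2_norm c (\<lambda>y. h y - \<phi> y)"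
    by (intro L2_norm_triangle L2_diff f approximable_L2[OF h(1)] Cc_infty_L2[OF c \<phi>(1)])
  finally show "\<exists>\<phi>\<in>Cc_infty {0<..}. (\<forall>y\<ge>r. \<phi> y = 0) \<and> L2_norm c (\<lambda>y. f y - \<phi> y) < \<epsilon>"
    using \<phi> h(2) by (intro bexI[of _ \<phi>]) auto
qed

lemma approximable_dominated_limit:
  assumes c: "c > -1" and F: "\<And>n. F n \<in> approximable c r" and h: "h \<in> L2 c"
    and le: "\<And>n y. 0 < y \<Longrightarrow> norm (F n y) \<le> norm (h y)"
    and lim: "\<And>y. 0 < y \<Longrightarrow> (\<lambda>n. F n y) \<longlonglongrightarrow> f y" and m: "f \<in> borel_measurable (weighted c)"
  shows "f \<in> approximable c r"
proof (rule approximable_closed)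
  have fle: "norm (f y) \<le> norm (h y)" if "0 < y" for y
    using lim[OF that] le[OF that] by (intro LIMSEQ_le_const2[OF tendsto_norm]) auto
  show fL: "f \<in> L2 c"
    by (rule L2_bound(1)[OF h m]) (auto simp: AE_weighted fle)
  have "(\<lambda>n. L2_norm c (\<lambda>y. f y - F n y)) \<longlonglongrightarrow> 0"
  proof (rule L2_dominated_convergence[OF L2_cmult(1)[OF h, of 2]])
    show "(\<lambda>y. f y - F n y) \<in> borel_measurable (weighted c)" for n
      by (intro L2_measurable L2_diff fL approximable_L2[OF F])
    show "AE y in weighted c. norm (f y - F n y) \<le> norm (2 * h y)" for n
      unfolding AE_weighted
    proof (intro AE_I2 impI)
      fix y :: real assume y: "0 < y"
      have "norm (f y - F n y) \<le> norm (f y) + norm (F n y)" by (rule norm_triangle_ineq4)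
      then show "norm (f y - F n y) \<le> norm (2 * h y)"
        using fle[OF y] le[OF y, of n] by (simp add: norm_mult)
    qed
    have "(\<lambda>n. f y - F n y) \<longlonglongrightarrow> 0" if "0 < y" for y
      using tendsto_diff[OF tendsto_const[of "f y"] lim[OF that]] by simp
    then show "AE y in weighted c. (\<lambda>n. f y - F n y) \<longlonglongrightarrow> 0"
      unfolding AE_weighted by simp
  qed
  then have "eventually (\<lambda>n. L2_norm c (\<lambda>y. f y - F n y) < \<epsilon>) sequentially" if "\<epsilon> > 0" for \<epsilon>
    by (rule order_tendstoD(2)) (rule that)
  then show "\<exists>h\<in>approximable c r. L2_norm c (\<lambda>y. f y - h y) < \<epsilon>" if "\<epsilon> > 0" for \<epsilon>
    using that F unfolding eventually_sequentially by blast
qed (fact c)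

lemma Cc_infty_approximable:
  assumes "c > -1" "\<phi> \<in> Cc_infty {0<..}" "\<And>y. r \<le> y \<Longrightarrow> \<phi> y = 0"
  shows "\<phi> \<in> approximable c r"
  unfolding approximable_def
proof (intro CollectI conjI allI impI)
  show "\<phi> \<in> L2 c" by (rule Cc_infty_L2[OF assms(1,2)])
  fix \<epsilon> :: real assume "\<epsilon> > 0"
  then show "\<exists>\<psi>\<in>Cc_infty {0<..}. (\<forall>y\<ge>r. \<psi> y = 0) \<and> L2_norm c (\<lambda>y. \<phi> y - \<psi> y) < \<epsilon>"
    using assms by (intro bexI[of _ \<phi>]) (auto simp: L2_norm_def)
qed

lemma approximable_diff_cmult:
  assumes c: "c > -1" and f: "f \<in> approximable c r" and g: "g \<in> approximable c r"
  shows "(\<lambda>y. f y - k * g y) \<in> approximable c r"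
  unfolding approximable_def
proof (intro CollectI conjI allI impI)
  have L: "f \<in> L2 c" "g \<in> L2 c" using f g by (auto simp: approximable_L2)
  show "(\<lambda>y. f y - k * g y) \<in> L2 c" by (intro L2_diff L2_cmult L)
  fix \<epsilon> :: real assume \<epsilon>: "\<epsilon> > 0"
  define \<delta> where "\<delta> = \<epsilon> / (1 + norm k)"
  have n1: "0 < 1 + norm k" by (simp add: add_pos_nonneg)
  then have \<delta>: "\<delta> > 0" using \<epsilon> by (simp add: \<delta>_def)
  obtain \<phi> where \<phi>: "\<phi> \<in> Cc_infty {0<..}" "\<forall>y\<ge>r. \<phi> y = 0" "L2_norm c (\<lambda>y. f y - \<phi> y) < \<delta>"
    using f \<delta> unfolding approximable_def by force
  obtain \<psi> where \<psi>: "\<psi> \<in> Cc_infty {0<..}" "\<forall>y\<ge>r. \<psi> y = 0" "L2_norm c (\<lambda>y. g y - \<psi> y) < \<delta>"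
    using g \<delta> unfolding approximable_def by force
  have PL: "(\<lambda>y. f y - \<phi> y) \<in> L2 c" "(\<lambda>y. g y - \<psi> y) \<in> L2 c"
    by (intro L2_diff L Cc_infty_L2[OF c] \<phi> \<psi>)+
  have "L2_norm c (\<lambda>y. (f y - k * g y) - (\<phi> y - k * \<psi> y)) = L2_norm c (\<lambda>y. (f y - \<phi> y) - k * (g y - \<psi> y))"
    by (intro arg_cong[where f = "L2_norm c"] ext) (simp add: algebra_simps)
  also have "\<dots> \<le> L2_norm c (\<lambda>y. f y - \<phi> y) + norm k * L2_norm c (\<lambda>y. g y - \<psi> y)"
    using L2_norm_triangle_diff[OF PL(1) L2_cmult(1)[OF PL(2)], of k] by (simp only: L2_cmult(2)[OF PL(2)])
  also have "\<dots> < \<delta> + norm k * \<delta>"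
    using \<phi>(3) \<psi>(3) by (intro add_less_le_mono mult_left_mono) auto
  also have "\<dots> = (1 + norm k) * \<delta>" by (simp add: distrib_right)
  also have "\<dots> = \<epsilon>" using n1 by (simp add: \<delta>_def)
  finally show "\<exists>\<phi>\<in>Cc_infty {0<..}. (\<forall>y\<ge>r. \<phi> y = 0) \<and> L2_norm c (\<lambda>y. (f y - k * g y) - \<phi> y) < \<epsilon>"
    using \<phi> \<psi> by (intro bexI[of _ "\<lambda>y. \<phi> y - k * \<psi> y"] conjI Cc_infty_diff_cmult) auto
qed

lemma approximable_zero: "c > -1 \<Longrightarrow> (\<lambda>_. 0) \<in> approximable c r"
proof (rule Cc_infty_approximable)
  show "(\<lambda>_. 0) \<in> Cc_infty {0<..}" unfolding Cc_infty_iff by (auto intro!: exI[of _ "{}"])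
qed auto

lemma approximable_sum:
  assumes "c > -1" "finite A" "\<And>a. a \<in> A \<Longrightarrow> F a \<in> approximable c r"
  shows "(\<lambda>y. \<Sum>a\<in>A. k a * F a y) \<in> approximable c r"
  using assms(2,3)
proof (induction A rule: finite_induct)
  case empty
  then show ?case using approximable_zero[OF assms(1)] by simp
next
  case (insert a A)
  have "(\<lambda>y. (\<Sum>a\<in>A. k a * F a y) - (- k a) * F a y) \<in> approximable c r"
    by (rule approximable_diff_cmult[OF assms(1)]) (use insert in auto)
  then show ?case using insert.hyps by (simp add: add.commute)
qed

lemma approximable_Ioo:
  assumes c: "c > -1" and r: "0 < r"
  shows "(\<lambda>y. indicator ({a<..<b} \<inter> {0<..<r}) y) \<in> approximable c r"
proof -
  note dom = indicator_L2(1)[OF c less_imp_le[OF r]]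
  have m: "(\<lambda>y. indicator S y :: complex) \<in> borel_measurable (weighted c)" if "S \<in> sets borel" for S
    by (rule measurable_weightedI) (use that in simp)
  have pos: "(\<lambda>y. indicator {a<..<b} y) \<in> approximable c r" if "0 < a" "b \<le> r" for a b
  proof (rule approximable_dominated_limit[OF c _ dom])
    show "(\<lambda>y. complex_of_real (bump a b n y)) \<in> approximable c r" for n
      by (rule Cc_infty_approximable[OF c bump_Cc_infty[OF that(1)]]) (use that in \<open>auto intro: bump_outside\<close>)
    show "norm (complex_of_real (bump a b n y)) \<le> norm (indicator {0<..<r} y :: complex)" for n y
      using bump_outside[of y a b n] bump_nonneg[of a b n y] bump_le_1[of a b n y] that
      by (cases "y \<in> {a<..<b}") auto
    show "(\<lambda>n. complex_of_real (bump a b n y)) \<longlonglongrightarrow> indicator {a<..<b} y" for y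
    proof -
      have "complex_of_real (indicator {a<..<b} y) = indicator {a<..<b} y" by (auto simp: indicator_def)
      then show ?thesis using tendsto_of_real[OF bump_tendsto[of a b y], where 'a = complex] by (simp only:)
    qed
  qed (rule m, simp)
  show ?thesis
  proof (rule approximable_dominated_limit[OF c _ dom])
    show "(\<lambda>y. indicator {max a (1 / real (Suc n))<..<min b r} y) \<in> approximable c r" for n
      by (rule pos) (auto simp: less_max_iff_disj)
    show "norm (indicator {max a (1 / real (Suc n))<..<min b r} y :: complex) \<le> norm (indicator {0<..<r} y :: complex)" if "0 < y" for n y
      using that by (auto simp: indicator_def)
    show "(\<lambda>n. indicator {max a (1 / real (Suc n))<..<min b r} y :: complex) \<longlonglongrightarrow> indicator ({a<..<b} \<inter> {0<..<r}) y" if y: "0 < y" for y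
    proof (rule tendsto_eventually)
      obtain n0 :: nat where n0: "1 / y < real n0" using reals_Archimedean2 by blast
      show "eventually (\<lambda>n. indicator {max a (1 / real (Suc n))<..<min b r} y = (indicator ({a<..<b} \<inter> {0<..<r}) y :: complex)) sequentially"
        using eventually_ge_at_top[of n0]
      proof eventually_elim
        fix n assume "n0 \<le> n"
        then have "1 / y < real (Suc n)" using n0 by linarith
        then have "1 / real (Suc n) < y" using y by (simp add: field_simps)
        then show "indicator {max a (1 / real (Suc n))<..<min b r} y = (indicator ({a<..<b} \<inter> {0<..<r}) y :: complex)"
          using y by (auto simp: indicator_def)
      qed
    qed
  qed (rule m, simp)
qed

lemma approximable_indicator:
  assumes c: "c > -1" and r: "0 < r" and S: "S \<in> sets borel"
  shows "(\<lambda>y. indicator (S \<inter> {0<..<r}) y) \<in> approximable c r"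
proof -
  note dom = indicator_L2(1)[OF c less_imp_le[OF r]]
  have S': "S \<in> sigma_sets UNIV (range (\<lambda>(a, b). {a<..<b :: real}))"
    using S sets_borel_Ioo by auto
  have *: "Int_stable (range (\<lambda>(a, b). {a<..<b :: real}))"
    by (auto simp: Int_stable_def Int_greaterThanLessThan image_iff)
  have **: "range (\<lambda>(a, b). {a<..<b :: real}) \<subseteq> Pow UNIV" by simp
  from * ** S' show ?thesis
  proof (induction rule: sigma_sets_induct_disjoint)
    case (basic S)
    then show ?case using approximable_Ioo[OF c r] by auto
  next
    case empty
    then show ?case using approximable_zero[OF c] by simp
  next
    case (compl S)
    have "(\<lambda>y. indicator ({0<..<r} \<inter> {0<..<r}) y - 1 * indicator (S \<inter> {0<..<r}) y) \<in> approximable c r"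
      by (rule approximable_diff_cmult[OF c approximable_Ioo[OF c r] compl.IH])
    moreover have "(\<lambda>y. indicator ({0<..<r} \<inter> {0<..<r}) y - 1 * indicator (S \<inter> {0<..<r}) y) = (\<lambda>y. indicator ((UNIV - S) \<inter> {0<..<r}) y :: complex)"
      by (auto simp: indicator_def fun_eq_iff)
    ultimately show ?case by simp
  next
    case (union S)
    then have Sb: "S i \<in> sets borel" for i using sets_borel_Ioo by auto
    \<comment> \<open>Partial unions are finite sums, by disjointness.\<close>
    have part: "(\<Sum>i<n. 1 * indicator (S i \<inter> {0<..<r}) y) = (indicator ((\<Union>i<n. S i) \<inter> {0<..<r}) y :: complex)" for n y
    proof (induction n)
      case (Suc n)
      have "S n \<inter> S i = {}" if "i < n" for i
        by (rule disjoint_family_onD[OF union.hyps(1)]) (use that in auto)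
      then have "S n \<inter> (\<Union>i<n. S i) = {}" by blast
      then have "(indicator ((\<Union>i<Suc n. S i) \<inter> {0<..<r}) y :: complex) =
          indicator ((\<Union>i<n. S i) \<inter> {0<..<r}) y + indicator (S n \<inter> {0<..<r}) y"
        unfolding lessThan_Suc by (cases "y \<in> S n"; cases "y \<in> {0<..<r}"; cases "y \<in> (\<Union>i<n. S i)") auto
      then show ?case using Suc by (simp only: sum.lessThan_Suc mult_1)
    qed simp
    show ?case
    proof (rule approximable_dominated_limit[OF c _ dom])
      show "(\<lambda>y. \<Sum>i<n. 1 * indicator (S i \<inter> {0<..<r}) y) \<in> approximable c r" for n
        by (rule approximable_sum[OF c]) (use union.IH in auto)
      show "norm (\<Sum>i<n. 1 * indicator (S i \<inter> {0<..<r}) y :: complex) \<le> norm (indicator {0<..<r} y :: complex)" for n y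
        unfolding part by (auto simp: indicator_def)
      show "(\<lambda>n. \<Sum>i<n. 1 * indicator (S i \<inter> {0<..<r}) y :: complex) \<longlonglongrightarrow> indicator ((\<Union>i. S i) \<inter> {0<..<r}) y" for y
        unfolding part
      proof (rule tendsto_eventually, cases "\<exists>i. y \<in> S i")
        case True
        then obtain i where i: "y \<in> S i" by blast
        show "eventually (\<lambda>n. indicator ((\<Union>i<n. S i) \<inter> {0<..<r}) y = (indicator ((\<Union>i. S i) \<inter> {0<..<r}) y :: complex)) sequentially"
          using eventually_gt_at_top[of i] by eventually_elim (use i in \<open>auto simp: indicator_def\<close>)
      qed (auto simp: indicator_def)
      show "(\<lambda>y. indicator ((\<Union>i. S i) \<inter> {0<..<r}) y :: complex) \<in> borel_measurable (weighted c)"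
        by (rule measurable_weightedI) (use Sb in simp)
    qed
  qed
qed

text \<open>The approximable functions are closed under linear combinations and dominated limits.  Intervals are limits of bump
  functions, Borel sets are reached by Dynkin's theorem, and square integrable functions by dominated simple functions.\<close>

theorem L2_approximable:
  assumes c: "c > -1" and r: "0 < r" and f: "f \<in> L2 c" and supp: "\<And>y. r \<le> y \<Longrightarrow> f y = 0"
  shows "f \<in> approximable c r"
proof -
  define f0 where "f0 y = indicator {0<..<r} y *\<^sub>R f y" for y
  have "set_borel_measurable lborel {0<..<r} f"
    by (rule locally_integrable_measurable[OF L2_imp_locally_integrable[OF f]]) auto
  then have "f0 \<in> borel_measurable borel" by (simp add: f0_def[abs_def] set_borel_measurable_def)
  from borel_measurable_implies_sequence_metric[OF this, of 0]
  obtain F where F: "\<And>i. simple_function borel (F i)" "\<And>x. (\<lambda>i. F i x) \<longlonglongrightarrow> f0 x"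
    "\<And>i x. norm (F i x) \<le> 2 * norm (f0 x)" by (auto simp: dist_norm)
  have F0: "F i x = 0" if "x \<notin> {0<..<r}" for i x
    using F(3)[of i x] that by (simp add: f0_def)
  show ?thesis
  proof (rule approximable_dominated_limit[OF c _ L2_cmult(1)[OF f, of 2]])
    fix i
    have fin: "finite (range (F i))" using simple_functionD(1)[OF F(1), of i] by simp
    have "F i = (\<lambda>y. \<Sum>z\<in>range (F i). z * indicator ((F i -` {z}) \<inter> {0<..<r}) y)"
    proof
      fix y
      show "F i y = (\<Sum>z\<in>range (F i). z * indicator ((F i -` {z}) \<inter> {0<..<r}) y)"
      proof (cases "y \<in> {0<..<r}")
        case True
        have "(\<Sum>z\<in>range (F i). z * indicator ((F i -` {z}) \<inter> {0<..<r}) y) = (\<Sum>z\<in>range (F i). if z = F i y then z else 0)"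
          by (intro sum.cong) (use True in \<open>auto simp: indicator_def\<close>)
        then show ?thesis using fin by (simp add: sum.delta)
      next
        case False
        then show ?thesis using F0 by simp
      qed
    qed
    moreover have "(\<lambda>y. \<Sum>z\<in>range (F i). z * indicator ((F i -` {z}) \<inter> {0<..<r}) y) \<in> approximable c r"
    proof (rule approximable_sum[OF c fin], rule approximable_indicator[OF c r])
      show "F i -` {z} \<in> sets borel" for z using simple_functionD(2)[OF F(1), of i "{z}"] by simp
    qed
    ultimately show "F i \<in> approximable c r" by simp
    show "norm (F i y) \<le> norm (2 * f y)" for y
    proof -
      have "norm (f0 y) \<le> norm (f y)" by (simp add: f0_def indicator_def)
      then show ?thesis using F(3)[of i y] by (simp add: norm_mult)
    qed
  next
    fix y :: real assume "0 < y"
    then have "f0 y = f y" using supp[of y] by (auto simp: f0_def indicator_def)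
    with F(2)[of y] show "(\<lambda>i. F i y) \<longlonglongrightarrow> f y" by simp
  qed (rule L2_measurable[OF f])
qed

section \<open>Approximation by core functions\<close>

text \<open>For a classical solution whose derivative vanishes near \<open>0\<close> there are no boundary terms.\<close>

lemma classical_is_BV_zero:
  assumes c: "c > -1" and aR: "0 < a" "a < R"
    and U: "\<And>y. 0 < y \<Longrightarrow> (U has_vector_derivative z y) (at y)"
    and P: "\<And>y. 0 < y \<Longrightarrow> ((\<lambda>y. complex_of_real (y powr c) * z y) has_vector_derivative complex_of_real (y powr c) * f y) (at y)"
    and cont: "continuous_on {0<..} z" "continuous_on {0<..} f"
    and near: "\<And>y. 0 < y \<Longrightarrow> y < a \<Longrightarrow> z y = 0" "\<And>y. 0 < y \<Longrightarrow> y < a \<Longrightarrow> f y = 0"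
    and far: "\<And>y. R \<le> y \<Longrightarrow> U y = 0" "\<And>y. R \<le> y \<Longrightarrow> z y = 0" "\<And>y. R \<le> y \<Longrightarrow> f y = 0"
  shows "is_BV c (\<lambda>_. 0) U f"
proof -
  interpret potential c "\<lambda>_. 0" using c by unfold_locales auto
  have Uc: "continuous_on {0<..} U"
    using U by (intro continuous_at_imp_continuous_on ballI has_vector_derivative_continuous) auto
  have Up: "is_primitive U z"
    by (rule primitiveI[OF Uc locally_integrable_continuous[OF cont(1)], of "{}"]) (use U in auto)
  have Uconst: "U y = U (a/2)" if "0 < y" "y < a" for y
  proof -
    have "U t = U s" if "0 < s" "s < t" "t < a" for s t
    proof -
      have "U t - U s = (LBINT x:{s<..<t}. z x)" using Up that by (simp add: is_primitive_def)
      also have "\<dots> = (LBINT x:{s<..<t}. 0)" by (intro set_lebesgue_integral_cong) (use that near in auto)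
      finally show ?thesis by simp
    qed
    from this[of y "a/2"] this[of "a/2" y] that aR show ?thesis by (cases y "a/2" rule: linorder_cases) auto
  qed
  have bnd: "\<exists>B. \<forall>y\<in>{a/2..R}. norm (h y) \<le> B" if "continuous_on {0<..} h" for h :: "real \<Rightarrow> complex"
  proof -
    have "bounded (h ` {a/2..R})"
      by (intro compact_imp_bounded compact_continuous_image continuous_on_subset[OF that]) (use aR in auto)
    then show ?thesis unfolding bounded_iff by blast
  qed
  obtain B1 where B1: "\<And>y. y \<in> {a/2..R} \<Longrightarrow> norm (U y) \<le> B1" using bnd[OF Uc] by blast
  obtain B2 where B2: "\<And>y. y \<in> {a/2..R} \<Longrightarrow> norm (z y) \<le> B2" using bnd[OF cont(1)] by blast
  obtain B3 where B3: "\<And>y. y \<in> {a/2..R} \<Longrightarrow> norm (f y) \<le> B3" using bnd[OF cont(2)] by blast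
  note B = B1 B2 B3
  define B where "B = max 0 (max B1 (max B2 B3))"
  have UB: "norm (U y) \<le> B" if "0 < y" "y < R" for y
  proof (cases "y < a/2")
    case True
    have "U y = U (a/2)" by (rule Uconst) (use True that aR in linarith)+
    then show ?thesis using B(1)[of "a/2"] aR by (auto simp: B_def)
  qed (use B(1)[of y] that in \<open>auto simp: B_def\<close>)
  have zB: "norm (z y) \<le> B" "norm (f y) \<le> B" if "0 < y" "y < R" for y
  proof -
    show "norm (z y) \<le> B" using B(2)[of y] near(1)[of y] that aR by (cases "y < a/2") (auto simp: B_def)
    show "norm (f y) \<le> B" using B(3)[of y] near(2)[of y] that aR by (cases "y < a/2") (auto simp: B_def)
  qed
  have fL: "f \<in> L2 c"
    by (rule bounded_support_L2[OF c measurable_weighted_continuous[OF cont(2)] zB(2) far(3)]) (use aR in auto)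
  have UH: "H1 c U z" "finite_energy U"
    by (rule H1_bounded_support[OF Uc finite.emptyI U measurable_weighted_continuous[OF cont(1)], where R = R and B = B];
        use UB zB(1) far(1,2) aR in simp)+
  have Pp: "is_primitive (\<lambda>y. complex_of_real (y powr c) * z y) (\<lambda>y. complex_of_real (y powr c) * f y)"
  proof (rule primitiveI[of _ _ "{}"])
    show "continuous_on {0<..} (\<lambda>y. complex_of_real (y powr c) * z y)"
      by (intro continuous_intros cont) auto
    show "locally_integrable (\<lambda>y. complex_of_real (y powr c) * f y)"
      by (rule L2_imp_locally_integrable_weighted[OF fL])
  qed (use P in auto)
  have tot: "(LBINT y:{0<..<R}. complex_of_real (y powr c) * f y) = 0"
  proof -
    have "(LBINT y:{0<..<R}. complex_of_real (y powr c) * f y) = (LBINT y:{a/2<..<R}. complex_of_real (y powr c) * f y)"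
      by (rule set_integral_vanishing_near_0) (use near aR in auto)
    also have "\<dots> = complex_of_real (R powr c) * z R - complex_of_real ((a/2) powr c) * z (a/2)"
    proof -
      have "0 < a / 2" "a / 2 < R" using aR by auto
      with Pp show ?thesis unfolding is_primitive_def by simp
    qed
    also have "\<dots> = 0" using near(1)[of "a/2"] far(2)[of R] aR by simp
    finally show ?thesis .
  qed
  show ?thesis
  proof (rule is_BV_I[OF UH fL])
    fix v v' assume v: "H1 c v v'"
    have "AE y in weighted c. R < y \<longrightarrow> f y = 0" using far(3) by (intro AE_I2) auto
    from weak_identity[OF c fL this _ Pp far(2) tot v] aR
    show "(\<integral>y. z y * cnj (v' y) \<partial>weighted c) + (\<integral>y. complex_of_real 0 * U y * cnj (v y) \<partial>weighted c) =
       - (\<integral>y. f y * cnj (v y) \<partial>weighted c)" by simp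
  qed
qed

lemma derivative_zero_on_open:
  fixes f :: "real \<Rightarrow> complex"
  assumes "(f has_vector_derivative d) (at y)" "open S" "y \<in> S" "\<And>x. x \<in> S \<Longrightarrow> f x = k"
  shows "d = 0"
proof -
  have "(f has_vector_derivative 0) (at y)"
    by (rule has_vector_derivative_transform_within_open[of "\<lambda>_. k" _ _ S]) (use assms in auto)
  with assms(1) show ?thesis by (rule vector_derivative_unique_at)
qed

lemma core_function_is_BV_zero:
  assumes c: "c > -1" and v: "v \<in> core_functions"
  obtains f R where "is_BV c (\<lambda>_. 0) v f" "R > 0" "\<And>y. R < y \<Longrightarrow> v y = 0"
proof -
  from v obtain \<delta> K where s: "smooth_on {0..} v" and K: "compact K" "K \<subseteq> {0..}" "\<And>y. y \<in> {0..} - K \<Longrightarrow> v y = 0"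
    and \<delta>: "\<delta> > 0" "\<And>y. 0 \<le> y \<Longrightarrow> y < \<delta> \<Longrightarrow> v y = v 0"
  proof -
    from v obtain \<delta> where d: "\<delta> > 0" "\<forall>y\<in>{0..<\<delta>}. v y = v 0" and "v \<in> Cc_infty {0..}"
      unfolding core_functions_def by blast
    from this(3) obtain K where "smooth_on {0..} v" "compact K" "K \<subseteq> {0..}" "\<forall>y\<in>{0..} - K. v y = 0"
      unfolding Cc_infty_iff by blast
    moreover have "v y = v 0" if "0 \<le> y" "y < \<delta>" for y
      using d(2) that unfolding Ball_def atLeastLessThan_iff by blast
    ultimately show ?thesis using d(1) that by blast
  qed
  obtain b where b: "\<And>y. y \<in> K \<Longrightarrow> \<bar>y\<bar> \<le> b"
    using compact_imp_bounded[OF K(1)] unfolding bounded_iff real_norm_def by blast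
  define R where "R = max b \<delta> + 1"
  have vR: "v y = 0" if "R - 1 < y" for y
  proof -
    have "y \<notin> K" using b[of y] that by (auto simp: R_def)
    moreover have "0 \<le> y" using that \<delta>(1) by (auto simp: R_def)
    ultimately show ?thesis using K(3) by auto
  qed
  have s': "smooth_on {0<..} v" by (rule smooth_on_subset[OF s]) auto
  obtain z where z: "smooth_on {0<..} z" "\<And>y. y \<in> {0<..} \<Longrightarrow> (v has_vector_derivative z y) (at y within {0<..})"
    by (rule smooth_on_derivative[OF s']) (rule that; assumption)
  obtain z' where z': "smooth_on {0<..} z'" "\<And>y. y \<in> {0<..} \<Longrightarrow> (z has_vector_derivative z' y) (at y within {0<..})"
    by (rule smooth_on_derivative[OF z(1)]) (rule that; assumption)
  have at: "at y within {0<..} = at y" if "0 < y" for y :: real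
    using that at_within_open[of y "{0<..}"] by simp
  have zd: "(v has_vector_derivative z y) (at y)" "(z has_vector_derivative z' y) (at y)" if "0 < y" for y
    using z(2)[of y] z'(2)[of y] that by (auto simp: at)
  have zn: "z y = 0" if "0 < y" "y < \<delta>" for y
  proof (rule derivative_zero_on_open[OF zd(1)[OF that(1)], of "{0<..<\<delta>}" "v 0"])
    show "v x = v 0" if "x \<in> {0<..<\<delta>}" for x by (rule \<delta>(2)) (use that in auto)
  qed (use that in auto)
  have z'n: "z' y = 0" if "0 < y" "y < \<delta>" for y
    by (rule derivative_zero_on_open[OF zd(2)[OF that(1)], of "{0<..<\<delta>}" 0]) (use that zn in auto)
  have R1: "0 < R - 1" using \<delta>(1) by (auto simp: R_def)
  have zf: "z y = 0" if "R - 1 < y" for y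
    by (rule derivative_zero_on_open[OF zd(1), of y "{R-1<..}" 0]) (use that R1 vR in auto)
  have z'f: "z' y = 0" if "R - 1 < y" for y
    by (rule derivative_zero_on_open[OF zd(2), of y "{R-1<..}" 0]) (use that R1 zf in auto)
  define f where "f y = z' y + complex_of_real (c / y) * z y" for y
  have "is_BV c (\<lambda>_. 0) v f"
  proof (rule classical_is_BV_zero[OF c \<delta>(1), of R v z f])
    show "\<delta> < R" by (auto simp: R_def)
    show "((\<lambda>y. complex_of_real (y powr c) * z y) has_vector_derivative complex_of_real (y powr c) * f y) (at y)" if "0 < y" for y
    proof -
      have "((\<lambda>y. y powr c) has_real_derivative c * y powr (c - 1)) (at y)"
        using that by (auto intro!: derivative_eq_intros)
      then have 1: "((\<lambda>y. complex_of_real (y powr c)) has_vector_derivative complex_of_real (c * y powr (c - 1))) (at y)"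
        by (intro has_vector_derivative_of_real) (simp add: has_real_derivative_iff_has_vector_derivative)
      have p: "y powr (c - 1) = y powr c / y" using that by (simp add: powr_diff)
      show ?thesis
        using has_vector_derivative_mult[OF 1 zd(2)[OF that]]
        by (rule has_vector_derivative_eq_rhs) (simp add: f_def p algebra_simps)
    qed
    show "continuous_on {0<..} z" by (rule smooth_on_continuous[OF z(1)])
    show "continuous_on {0<..} f"
      unfolding f_def by (intro continuous_intros smooth_on_continuous[OF z(1)] smooth_on_continuous[OF z'(1)]) auto
  qed (use zd zn z'n zf z'f vR in \<open>auto simp: f_def\<close>)
  then show ?thesis using R1 vR that[of f R] by auto
qed

text \<open>The complement of the essential support is a union of open null sets; by Lindelof's theorem countably many suffice.\<close>

lemma supported_in_AE_zero:
  assumes "u \<in> supported_in c r" "0 < r"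
  shows "AE y in weighted c. r < y \<longrightarrow> u y = 0"
proof -
  define \<F> where "\<F> = {U :: real set. open U \<and> (AE y in weighted c. y \<in> U \<longrightarrow> u y = 0)}"
  obtain \<G> where \<G>: "\<G> \<subseteq> \<F>" "countable \<G>" "\<Union>\<G> = \<Union>\<F>"
    using Lindelof[of \<F>] by (auto simp: \<F>_def)
  have "AE y in weighted c. \<forall>U\<in>\<G>. y \<in> U \<longrightarrow> u y = 0"
    using \<G>(1,2) by (subst AE_ball_countable) (auto simp: \<F>_def)
  then show ?thesis
  proof eventually_elim
    fix y assume *: "\<forall>U\<in>\<G>. y \<in> U \<longrightarrow> u y = 0"
    show "r < y \<longrightarrow> u y = 0"
    proof
      assume "r < y"
      then have "y \<notin> ess_supp c u" using assms(1) by (auto simp: supported_in_def)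
      then have "y \<in> \<Union>\<F>" using \<open>r < y\<close> assms(2) by (auto simp: ess_supp_def \<F>_def)
      with \<G>(3) * show "u y = 0" by blast
    qed
  qed
qed

lemma kernel_weight_integrable:
  assumes c: "c > -1" and r: "r > 0"
  shows "integrable (weighted c) (\<lambda>y. indicator {0<..<r} y * (1\<^sup>2 * kernel_weight c y))"
proof -
  show ?thesis
  proof (cases "c < 3")
    case True
    have "indicator {0<..} y *\<^sub>R (y powr c *\<^sub>R (indicator {0<..<r} y * (1\<^sup>2 * kernel_weight c y))) = indicator {0<..<r} y *\<^sub>R y powr c" for y
      using True by (auto simp: indicator_def kernel_weight_def)
    then show ?thesis
      using powr_Ioo_integral(1)[OF c less_imp_le[OF r]] by (simp only: integrable_weighted set_integrable_def)
  next
    case False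
    show ?thesis
      unfolding integrable_weighted set_integrable_def
    proof (rule Bochner_Integration.integrable_bound)
      show "integrable lborel (\<lambda>y. (r ^ 3 * (2 + r) + r\<^sup>2) * indicator {0<..<r} y)"
        by (intro integrable_mult_right integrable_real_indicator) (use r in auto)
      have "(\<lambda>y. kernel_weight c y) \<in> borel_measurable borel"
        unfolding kernel_weight_def by measurable
      then show "(\<lambda>y. indicator {0<..} y *\<^sub>R (y powr c *\<^sub>R (indicator {0<..<r} y * (1\<^sup>2 * kernel_weight c y)))) \<in> borel_measurable lborel"
        by measurable
      show "AE y in lborel. norm (indicator {0<..} y *\<^sub>R (y powr c *\<^sub>R (indicator {0<..<r} y * (1\<^sup>2 * kernel_weight c y)))) \<le>
         norm ((r ^ 3 * (2 + r) + r\<^sup>2) * indicator {0<..<r} y)"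
      proof (rule AE_I2)
        fix y
        have "y powr c * kernel_weight c y \<le> r ^ 3 * (2 + r) + r\<^sup>2" if y: "0 < y" "y < r"
        proof -
          have y3: "y ^ 3 \<le> r ^ 3" "y ^ 2 \<le> r ^ 2" "y powr 3 = y ^ 3" using y by (auto intro: power_mono simp: powr_numeral)
          have r3: "0 \<le> r ^ 3" "0 \<le> r ^ 3 * r" "0 \<le> r\<^sup>2" using r by auto
          show ?thesis
          proof (cases "c = 3")
            case True
            have "ln y \<le> y" using ln_le_minus_one[OF y(1)] by linarith
            moreover have "- ln y \<le> 1 / y"
              using ln_le_minus_one[of "1 / y"] y by (simp add: ln_div)
            moreover have "0 < 1 / y" using y by simp
            ultimately have "\<bar>ln y\<bar> \<le> y + 1 / y" using y by linarith
            then have "y ^ 3 * (1 + \<bar>ln y\<bar>) \<le> y ^ 3 * (1 + (y + 1 / y))" using y by (intro mult_left_mono) auto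
            also have "\<dots> = y ^ 3 * (1 + y) + y\<^sup>2" using y by (simp add: field_simps power2_eq_square power3_eq_cube)
            also have "\<dots> \<le> r ^ 3 * (1 + r) + r\<^sup>2" using y y3 by (intro add_mono mult_mono) auto
            finally have "y ^ 3 * (1 + \<bar>ln y\<bar>) \<le> r ^ 3 * (1 + r) + r\<^sup>2" .
            moreover have "r ^ 3 * (1 + r) \<le> r ^ 3 * (2 + r)" using r by (intro mult_left_mono) auto
            moreover have "y powr c * kernel_weight c y = y ^ 3 * (1 + \<bar>ln y\<bar>)"
              using True y3(3) by (simp add: kernel_weight_def)
            ultimately show ?thesis by linarith
          next
            case c3: False
            have "y powr c * kernel_weight c y = y ^ 3"
              using False c3 y3(3) by (simp add: kernel_weight_def powr_add[symmetric])
            then show ?thesis using y3(1) r3 unfolding distrib_left by linarith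
          qed
        qed
        then show "norm (indicator {0<..} y *\<^sub>R (y powr c *\<^sub>R (indicator {0<..<r} y * (1\<^sup>2 * kernel_weight c y)))) \<le>
         norm ((r ^ 3 * (2 + r) + r\<^sup>2) * indicator {0<..<r} y)"
          using kernel_weight_nonneg[of c y] by (auto simp: indicator_def abs_mult)
      qed
    qed
  qed
qed

text \<open>The three cases of the hypothesis on \<open>V\<close> in one formula.\<close>

locale admissible_potential = potential +
  assumes V_admissible: "\<And>r. r > 0 \<Longrightarrow> integrable (weighted c) (\<lambda>y. indicator {0<..<r} y * ((V y)\<^sup>2 * kernel_weight c y))"
begin

lemma relative_bound:
  assumes "r > 0"
  obtains C where "C \<ge> 0"
    "\<And>V' u g. \<lbrakk>potential c V'; is_BV c V' u g; AE y in weighted c. r < y \<longrightarrow> u y = 0\<rbrakk> \<Longrightarrow>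
       (\<lambda>y. complex_of_real (V y) * u y) \<in> L2 c \<and> L2_norm c (\<lambda>y. complex_of_real (V y) * u y) \<le> C * L2_norm c g"
  using multiplier_bound[OF c assms V_measurable V_admissible[OF assms]] by blast

lemma Poincare_bound:
  assumes "r > 0"
  obtains C where "C \<ge> 0"
    "\<And>V' u g. \<lbrakk>potential c V'; is_BV c V' u g; AE y in weighted c. r < y \<longrightarrow> u y = 0\<rbrakk> \<Longrightarrow> L2_norm c u \<le> C * L2_norm c g"
proof -
  have "(\<lambda>_. 1 :: real) \<in> borel_measurable (weighted c)" by (rule measurable_weightedI) simp
  from multiplier_bound[OF c assms this kernel_weight_integrable[OF c assms]]
  show ?thesis using that by auto
qed

lemma self_potential: "potential c V" ..

lemma dom_BV_supported_eq:
  assumes r: "r > 0"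
  shows "dom_BV c V \<inter> supported_in c r = dom_BV c (\<lambda>_. 0) \<inter> supported_in c r"
proof (intro set_eqI iffI)
  obtain C where C: "\<And>V' u g. \<lbrakk>potential c V'; is_BV c V' u g; AE y in weighted c. r < y \<longrightarrow> u y = 0\<rbrakk> \<Longrightarrow>
       (\<lambda>y. complex_of_real (V y) * u y) \<in> L2 c \<and> L2_norm c (\<lambda>y. complex_of_real (V y) * u y) \<le> C * L2_norm c g"
    by (rule relative_bound[OF r]) (rule that; assumption)
  fix u
  show "u \<in> dom_BV c (\<lambda>_. 0) \<inter> supported_in c r" if u: "u \<in> dom_BV c V \<inter> supported_in c r"
  proof -
    obtain g where g: "is_BV c V u g" using u by (auto simp: dom_BV_def)
    have s: "AE y in weighted c. r < y \<longrightarrow> u y = 0" using supported_in_AE_zero[OF _ r] u by auto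
    have "is_BV c (\<lambda>_. 0) u (\<lambda>y. g y + complex_of_real (V y) * u y)"
      by (rule remove_potential(1)[OF g r s]) (use C[OF self_potential g s] in blast)
    with u show ?thesis by (auto simp: dom_BV_def)
  qed
  show "u \<in> dom_BV c V \<inter> supported_in c r" if u: "u \<in> dom_BV c (\<lambda>_. 0) \<inter> supported_in c r"
  proof -
    obtain f where f: "is_BV c (\<lambda>_. 0) u f" using u by (auto simp: dom_BV_def)
    have s: "AE y in weighted c. r < y \<longrightarrow> u y = 0" using supported_in_AE_zero[OF _ r] u by auto
    have "is_BV c V u (\<lambda>y. f y - complex_of_real (V y) * u y)"
      by (rule add_potential[OF f]) (use C[OF zero_potential f s] in blast)
    with u show ?thesis by (auto simp: dom_BV_def)
  qed
qed

lemma graph_norms_equivalent: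
  assumes r: "r > 0"
  shows "\<exists>K>0. \<forall>u\<in>dom_BV c (\<lambda>_. 0) \<inter> supported_in c r.
               graph_norm c V u \<le> K * graph_norm c (\<lambda>_. 0) u \<and>
               graph_norm c (\<lambda>_. 0) u \<le> K * graph_norm c V u"
proof -
  interpret Z: potential c "\<lambda>_. 0" by (rule zero_potential)
  obtain C where C0: "C \<ge> 0" and C: "\<And>V' u g. \<lbrakk>potential c V'; is_BV c V' u g; AE y in weighted c. r < y \<longrightarrow> u y = 0\<rbrakk> \<Longrightarrow>
       (\<lambda>y. complex_of_real (V y) * u y) \<in> L2 c \<and> L2_norm c (\<lambda>y. complex_of_real (V y) * u y) \<le> C * L2_norm c g"
    by (rule relative_bound[OF r]) (rule that; assumption)
  show ?thesis
  proof (intro exI[of _ "1 + C"] conjI ballI)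
    show "0 < 1 + C" using C0 by simp
    fix u assume u: "u \<in> dom_BV c (\<lambda>_. 0) \<inter> supported_in c r"
    obtain f where f: "is_BV c (\<lambda>_. 0) u f" using u by (auto simp: dom_BV_def)
    have s: "AE y in weighted c. r < y \<longrightarrow> u y = 0" using supported_in_AE_zero[OF _ r] u by auto
    let ?Vu = "\<lambda>y. complex_of_real (V y) * u y" and ?g = "\<lambda>y. f y - complex_of_real (V y) * u y"
    have Vu: "?Vu \<in> L2 c" "L2_norm c ?Vu \<le> C * L2_norm c f" using C[OF zero_potential f s] by auto
    have g: "is_BV c V u ?g" by (rule add_potential[OF f Vu(1)])
    have Vu': "L2_norm c ?Vu \<le> C * L2_norm c ?g" using C[OF self_potential g s] by auto
    have fL: "f \<in> L2 c" by (rule Z.is_BV_D(3)[OF f])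
    have gL: "?g \<in> L2 c" by (rule is_BV_D(3)[OF g])
    note gn = graph_norm_eq[OF g] Z.graph_norm_eq[OF f]
    have u0: "L2_norm c u \<le> (1 + C) * L2_norm c u" using mult_right_mono[of 1 "1 + C" "L2_norm c u"] C0 by simp
    have "L2_norm c ?g \<le> L2_norm c f + L2_norm c ?Vu" by (rule L2_norm_triangle_diff[OF fL Vu(1)])
    also have "\<dots> \<le> (1 + C) * L2_norm c f" using Vu(2) by (simp add: distrib_right)
    finally show "graph_norm c V u \<le> (1 + C) * graph_norm c (\<lambda>_. 0) u"
      unfolding gn distrib_left using u0 by linarith
    have "L2_norm c f = L2_norm c (\<lambda>y. ?g y + ?Vu y)" by simp
    also have "\<dots> \<le> L2_norm c ?g + L2_norm c ?Vu" by (rule L2_norm_triangle[OF gL Vu(1)])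
    also have "\<dots> \<le> (1 + C) * L2_norm c ?g" using Vu' by (simp add: distrib_right)
    finally show "graph_norm c (\<lambda>_. 0) u \<le> (1 + C) * graph_norm c V u"
      unfolding gn distrib_left using u0 by linarith
  qed
qed

lemma core_functions_subset: "core_functions \<subseteq> dom_BV c V"
proof
  fix v assume "v \<in> core_functions"
  then obtain f R where f: "is_BV c (\<lambda>_. 0) v f" and R: "R > 0" "\<And>y. R < y \<Longrightarrow> v y = 0"
    by (rule core_function_is_BV_zero[OF c]) (rule that; assumption)
  have s: "AE y in weighted c. R < y \<longrightarrow> v y = 0" using R(2) by (intro AE_I2) auto
  obtain C where C: "\<And>V' u g. \<lbrakk>potential c V'; is_BV c V' u g; AE y in weighted c. R < y \<longrightarrow> u y = 0\<rbrakk> \<Longrightarrow>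
       (\<lambda>y. complex_of_real (V y) * u y) \<in> L2 c \<and> L2_norm c (\<lambda>y. complex_of_real (V y) * u y) \<le> C * L2_norm c g"
    by (rule relative_bound[OF R(1)]) (rule that; assumption)
  have "is_BV c V v (\<lambda>y. f y - complex_of_real (V y) * v y)"
    by (rule add_potential[OF f]) (use C[OF zero_potential f s] in blast)
  then show "v \<in> dom_BV c V" by (auto simp: dom_BV_def)
qed

end

text \<open>The mean of an approximating test function is small because the mean of \<open>f\<close> is zero; it is removed by subtracting a
  small multiple of a fixed bump function \<open>\<beta>\<close>.\<close>

lemma mean_zero_approximation:
  assumes c: "c > -1" and r: "r > 0" and f: "f \<in> L2 c" "\<And>y. r \<le> y \<Longrightarrow> f y = 0"
    and zero: "(LBINT y:{0<..<r}. complex_of_real (y powr c) * f y) = 0" and \<epsilon>: "\<epsilon> > 0"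
  obtains \<phi> where "\<phi> \<in> Cc_infty {0<..}" "\<And>y. r \<le> y \<Longrightarrow> \<phi> y = 0" "L2_norm c (\<lambda>y. f y - \<phi> y) < \<epsilon>"
    "(LBINT y:{0<..}. complex_of_real (y powr c) * \<phi> y) = 0"
proof -
  have pw: "smooth_on {0<..} (\<lambda>y. complex_of_real (y powr b))" for b by (rule smooth_on_powr)
  have ti: "set_integrable lborel {0<..} \<psi>" if "\<psi> \<in> Cc_infty {0<..}" for \<psi>
    using integrable_mult_test[OF locally_integrable_continuous that, of "\<lambda>_. 1"] by simp
  define \<beta> where "\<beta> y = complex_of_real (y powr (-c)) * complex_of_real (bump (r/3) (2*r/3) 0 y)" for y
  have \<beta>: "\<beta> \<in> Cc_infty {0<..}"
    unfolding \<beta>_def using r by (intro Cc_infty_mult_smooth[OF pw] bump_Cc_infty) simp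
  have \<beta>0: "\<beta> y = 0" if "r \<le> y" for y
    using that r bump_outside[of y "r/3" "2*r/3" 0] by (simp add: \<beta>_def)
  define J where "J = (LBINT y:{0<..}. complex_of_real (y powr c) * \<beta> y)"
  have "J = (LBINT y:{0<..}. complex_of_real (bump (r/3) (2*r/3) 0 y))"
    unfolding J_def \<beta>_def
    by (intro set_lebesgue_integral_cong) (auto simp: powr_minus field_simps)
  then have J: "J \<noteq> 0" using bump_integral_nonzero[of "r/3" "2*r/3" 0] r by simp
  define k0 where "k0 = sqrt (r powr (c + 1) / (c + 1))"
  have k0: "k0 \<ge> 0" using c by (simp add: k0_def)
  \<comment> \<open>By Cauchy-Schwarz the mean of a function on \<open>(0,r)\<close> is at most \<open>k0\<close> times its norm, so that the correction enlarges the error by the factor \<open>T\<close>.\<close>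
  define T where "T = 1 + k0 / norm J * L2_norm c \<beta>"
  have T: "T > 0" unfolding T_def using k0 by (intro add_pos_nonneg mult_nonneg_nonneg divide_nonneg_nonneg) auto
  have "f \<in> approximable c r" by (rule L2_approximable[OF c r f])
  then obtain \<psi> where \<psi>: "\<psi> \<in> Cc_infty {0<..}" "\<And>y. r \<le> y \<Longrightarrow> \<psi> y = 0" "L2_norm c (\<lambda>y. f y - \<psi> y) < \<epsilon> / T"
    unfolding approximable_def using divide_pos_pos[OF \<epsilon> T] by blast
  have L: "\<psi> \<in> L2 c" "\<beta> \<in> L2 c" by (intro Cc_infty_L2[OF c] \<psi> \<beta>)+
  have dL: "(\<lambda>y. f y - \<psi> y) \<in> L2 c" by (rule L2_diff[OF f(1) L(1)])
  define m where "m = (LBINT y:{0<..}. complex_of_real (y powr c) * \<psi> y)"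
  have m_le: "norm m \<le> L2_norm c (\<lambda>y. f y - \<psi> y) * k0"
  proof -
    have i: "set_integrable lborel {0<..<r} (\<lambda>y. complex_of_real (y powr c) * h y)" if "h \<in> L2 c" for h
      using L2_integral_near_0(1)[OF that c less_imp_le[OF r]] by (simp only: scaleR_conv_of_real)
    have "m = (LBINT y:{0<..<r}. complex_of_real (y powr c) * \<psi> y)"
      unfolding m_def set_lebesgue_integral_def
      by (intro Bochner_Integration.integral_cong refl) (use \<psi>(2) in \<open>auto simp: indicator_def\<close>)
    also have "\<dots> = - ((LBINT y:{0<..<r}. complex_of_real (y powr c) * f y) - (LBINT y:{0<..<r}. complex_of_real (y powr c) * \<psi> y))"
      using zero by simp
    also have "\<dots> = - (LBINT y:{0<..<r}. complex_of_real (y powr c) * (f y - \<psi> y))"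
      unfolding right_diff_distrib by (simp only: set_integral_diff(2)[OF i[OF f(1)] i[OF L(1)]])
    finally have "norm m = norm (LBINT y:{0<..<r}. y powr c *\<^sub>R (f y - \<psi> y))" by (simp add: scaleR_conv_of_real)
    also have "\<dots> \<le> (LBINT y:{0<..<r}. norm (y powr c *\<^sub>R (f y - \<psi> y)))"
      by (rule set_integral_norm_bound[OF L2_integral_near_0(1)[OF dL c less_imp_le[OF r]]])
    also have "\<dots> \<le> L2_norm c (\<lambda>y. f y - \<psi> y) * k0"
      unfolding k0_def by (rule L2_integral_near_0(2)[OF dL c less_imp_le[OF r]])
    finally show ?thesis .
  qed
  define \<phi> where "\<phi> y = \<psi> y - (m / J) * \<beta> y" for y
  have \<phi>: "\<phi> \<in> Cc_infty {0<..}" unfolding \<phi>_def by (rule Cc_infty_diff_cmult[OF \<psi>(1) \<beta>])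
  show ?thesis
  proof (rule that[OF \<phi>])
    show "\<phi> y = 0" if "r \<le> y" for y using \<psi>(2)[OF that] \<beta>0[OF that] by (simp add: \<phi>_def)
    have "L2_norm c (\<lambda>y. f y - \<phi> y) = L2_norm c (\<lambda>y. (f y - \<psi> y) + (m / J) * \<beta> y)"
      by (intro arg_cong[where f = "L2_norm c"] ext) (simp add: \<phi>_def)
    also have "\<dots> \<le> L2_norm c (\<lambda>y. f y - \<psi> y) + norm (m / J) * L2_norm c \<beta>"
      using L2_norm_triangle[OF dL L2_cmult(1)[OF L(2)], of "m / J"] by (simp only: L2_cmult(2)[OF L(2)])
    also have "\<dots> \<le> L2_norm c (\<lambda>y. f y - \<psi> y) + (L2_norm c (\<lambda>y. f y - \<psi> y) * k0 / norm J) * L2_norm c \<beta>"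
      unfolding norm_divide using m_le by (intro add_left_mono mult_right_mono divide_right_mono) auto
    also have "\<dots> = L2_norm c (\<lambda>y. f y - \<psi> y) * T" by (simp add: T_def algebra_simps)
    also have "\<dots> < \<epsilon>" using \<psi>(3) T by (simp add: less_divide_eq)
    finally show "L2_norm c (\<lambda>y. f y - \<phi> y) < \<epsilon>" .
    have i: "set_integrable lborel {0<..} (\<lambda>y. complex_of_real (y powr c) * h y)" if "h \<in> Cc_infty {0<..}" for h
      by (rule ti[OF Cc_infty_mult_smooth[OF pw that]])
    have "(LBINT y:{0<..}. complex_of_real (y powr c) * \<phi> y) =
       (LBINT y:{0<..}. complex_of_real (y powr c) * \<psi> y - (m / J) * (complex_of_real (y powr c) * \<beta> y))"
      by (intro set_lebesgue_integral_cong) (auto simp: \<phi>_def algebra_simps)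
    also have "\<dots> = m - (m / J) * J"
      by (subst set_integral_diff(2)[OF i[OF \<psi>(1)] set_integrable_mult_right[OF i[OF \<beta>]]])
         (simp only: set_integral_mult_right m_def J_def)
    finally show "(LBINT y:{0<..}. complex_of_real (y powr c) * \<phi> y) = 0" using J by simp
  qed
qed

text \<open>Integrate twice: \<open>z(y) = y\<^sup>-\<^sup>c \<integral>\<^sub>0\<^sup>y \<phi>(s) s\<^sup>c ds\<close> vanishes near \<open>0\<close> because \<open>\<phi>\<close> does, and beyond \<open>r\<close>
  because \<open>\<phi>\<close> has mean zero.  A primitive \<open>U\<close> of \<open>z\<close> is then constant on both ends, and the constant is normalized to be \<open>0\<close> beyond \<open>r\<close>.\<close>

lemma core_function_with_source:
  assumes c: "c > -1" and r: "r > 0" and \<phi>: "\<phi> \<in> Cc_infty {0<..}" "\<And>y. r \<le> y \<Longrightarrow> \<phi> y = 0"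
    and zero: "(LBINT y:{0<..}. complex_of_real (y powr c) * \<phi> y) = 0"
  obtains U where "U \<in> core_functions" "is_BV c (\<lambda>_. 0) U \<phi>" "\<And>y. r < y \<Longrightarrow> U y = 0"
proof -
  define q where "q y = complex_of_real (y powr c) * \<phi> y" for y
  have q: "q \<in> Cc_infty {0<..}" unfolding q_def by (rule Cc_infty_mult_smooth[OF smooth_on_powr \<phi>(1)])
  define P where "P y = (LBINT t:{0<..<y}. q t)" for y
  have q_zero: "(LBINT y:{0<..}. q y) = 0" using zero by (simp add: q_def)
  have P: "P \<in> Cc_infty {0<..}" "\<And>x. 0 < x \<Longrightarrow> (P has_vector_derivative q x) (at x)"
    unfolding P_def using Cc_infty_antiderivative[OF q q_zero] by auto
  have Pr: "P y = 0" if "r \<le> y" for y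
  proof -
    have "indicator {0<..<y} x *\<^sub>R q x = indicator {0<..} x *\<^sub>R q x" for x
      using \<phi>(2)[of x] that by (cases "x < r") (auto simp: indicator_def q_def)
    then have "P y = (LBINT t:{0<..}. q t)"
      unfolding P_def set_lebesgue_integral_def by (simp only:)
    then show ?thesis using q_zero by simp
  qed
  define z where "z y = complex_of_real (y powr (-c)) * P y" for y
  have z: "z \<in> Cc_infty {0<..}" unfolding z_def by (rule Cc_infty_mult_smooth[OF smooth_on_powr P(1)])
  have zr: "z y = 0" if "r \<le> y" for y using Pr[OF that] by (simp add: z_def)
  have zc: "continuous_on {0<..} z" by (rule Cc_infty_continuous[OF z])
  obtain a0 where a0: "0 < a0" "\<And>x. 0 < x \<Longrightarrow> x \<le> a0 \<Longrightarrow> z x = 0"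
    by (rule test_function_derivative[OF z]) auto
  obtain a1 where a1: "0 < a1" "\<And>x. 0 < x \<Longrightarrow> x \<le> a1 \<Longrightarrow> \<phi> x = 0"
    by (rule test_function_derivative[OF \<phi>(1)]) auto
  define a where "a = min (min a0 a1) (r / 2)"
  have a: "0 < a" "a < r" "\<And>x. 0 < x \<Longrightarrow> x \<le> a \<Longrightarrow> z x = 0" "\<And>x. 0 < x \<Longrightarrow> x \<le> a \<Longrightarrow> \<phi> x = 0"
    using a0 a1 r by (auto simp: a_def)
  obtain v where v: "is_primitive v z" using primitive_exists[OF locally_integrable_continuous[OF zc]] .
  have vconst: "v t = v s" if "0 < s" "s < t" "\<And>x. s < x \<Longrightarrow> x < t \<Longrightarrow> z x = 0" for s t
  proof -
    have "v t - v s = (LBINT x:{s<..<t}. z x)" using v that by (simp add: is_primitive_def)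
    also have "\<dots> = (LBINT x:{s<..<t}. 0)" by (intro set_lebesgue_integral_cong) (use that in auto)
    finally show ?thesis by simp
  qed
  have va: "v y = v (a/2)" if "0 < y" "y \<le> a" for y
    using vconst[of y "a/2"] vconst[of "a/2" y] that a by (cases y "a/2" rule: linorder_cases) auto
  define U where "U y = (if 0 < y then v y else v (a/2)) - v r" for y
  define Z where "Z y = (if 0 < y then z y else 0)" for y
  have Ua: "U y = v (a/2) - v r" if "y \<le> a" for y
  proof (cases "0 < y")
    case True
    from va[OF this that] True show ?thesis by (simp add: U_def)
  qed (simp add: U_def)
  have UZ: "(U has_vector_derivative Z y) (at y)" for y
  proof (cases "y < a")
    case True
    have "(U has_vector_derivative 0) (at y)"
      by (rule has_vector_derivative_transform_within_open[of "\<lambda>_. v (a/2) - v r" _ _ "{..<a}"]) (use True Ua in auto)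
    moreover have "Z y = 0" using a(3)[of y] True by (auto simp: Z_def)
    ultimately show ?thesis by simp
  next
    case False
    then have y: "0 < y" using a by linarith
    have "((\<lambda>y. v y - v r) has_vector_derivative z y) (at y)"
      using has_vector_derivative_diff[OF primitive_has_derivative[OF v zc y] has_vector_derivative_const] by simp
    then have "(U has_vector_derivative z y) (at y)"
      by (rule has_vector_derivative_transform_within_open[of _ _ _ "{0<..}"]) (use y in \<open>auto simp: U_def\<close>)
    with y show ?thesis by (simp add: Z_def)
  qed
  have "smooth_on UNIV Z"
    unfolding Z_def by (rule smooth_on_extend_zero[OF _ a(1)]) (use z a(3) in \<open>auto simp: Cc_infty_iff\<close>)
  then have "smooth_on UNIV U" by (rule smooth_on_primitive) (use UZ in auto)
  then have Us: "smooth_on {0..} U" by (rule smooth_on_subset) simp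
  have Ur: "U y = 0" if "r \<le> y" for y
    using vconst[of r y] zr that r by (cases "y = r") (auto simp: U_def)
  show ?thesis
  proof (rule that[of U])
    have "U \<in> Cc_infty {0..}"
      unfolding Cc_infty_iff using Us Ur by (intro conjI exI[of _ "{0..r}"]) auto
    moreover have "\<forall>y\<in>{0..<a}. U y = U 0" using Ua a(1) by simp
    ultimately show "U \<in> core_functions" unfolding core_functions_def using a(1) by blast
    show "is_BV c (\<lambda>_. 0) U \<phi>"
    proof (rule classical_is_BV_zero[OF c a(1,2)])
      show "(U has_vector_derivative z y) (at y)" if "0 < y" for y using UZ[of y] that by (simp add: Z_def)
      show "((\<lambda>y. complex_of_real (y powr c) * z y) has_vector_derivative complex_of_real (y powr c) * \<phi> y) (at y)" if "0 < y" for y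
        unfolding q_def[symmetric]
        by (rule has_vector_derivative_transform_within_open[OF P(2)[OF that], of "{0<..}"])
           (use that in \<open>auto simp: z_def powr_minus field_simps\<close>)
      show "continuous_on {0<..} \<phi>" by (rule Cc_infty_continuous[OF \<phi>(1)])
    qed (use zc a zr Ur \<phi>(2) in auto)
  qed (use Ur in auto)
qed

context admissible_potential
begin

text \<open>Subtracting the core function \<open>U\<close> with source \<open>\<phi>\<close> close to \<open>f\<close> leaves a function with bounded support and small
  source \<open>f - \<phi>\<close>; the function itself and its product with \<open>V\<close> are then small by the multiplier bounds.\<close>

lemma core_approximation:
  assumes w: "is_BV c V w h" and r: "r > 0" and supp: "\<And>y. r < y \<Longrightarrow> w y = 0" and \<epsilon>: "\<epsilon> > 0"
  obtains U h' where "U \<in> core_functions" "is_BV c V U h'"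
    "L2_norm c (\<lambda>y. w y - U y) + L2_norm c (\<lambda>y. h y - h' y) < \<epsilon>"
proof -
  interpret Z: potential c "\<lambda>_. 0" by (rule zero_potential)
  obtain C where C0: "C \<ge> 0" and C: "\<And>V' u g. \<lbrakk>potential c V'; is_BV c V' u g; AE y in weighted c. r < y \<longrightarrow> u y = 0\<rbrakk> \<Longrightarrow>
       (\<lambda>y. complex_of_real (V y) * u y) \<in> L2 c \<and> L2_norm c (\<lambda>y. complex_of_real (V y) * u y) \<le> C * L2_norm c g"
    by (rule relative_bound[OF r]) (rule that; assumption)
  obtain C1 where C10: "C1 \<ge> 0" and C1: "\<And>V' u g. \<lbrakk>potential c V'; is_BV c V' u g; AE y in weighted c. r < y \<longrightarrow> u y = 0\<rbrakk> \<Longrightarrow> L2_norm c u \<le> C1 * L2_norm c g"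
    by (rule Poincare_bound[OF r]) (rule that; assumption)
  have ws: "AE y in weighted c. r < y \<longrightarrow> w y = 0" using supp by (intro AE_I2) auto
  let ?Vw = "\<lambda>y. complex_of_real (V y) * w y"
  have Vw: "?Vw \<in> L2 c" using C[OF self_potential w ws] by auto
  define f where "f y = h y + complex_of_real (V y) * w y" for y
  note rp = remove_potential[OF w r ws Vw]
  have f: "is_BV c (\<lambda>_. 0) w f" using rp(1) by (simp only: f_def[abs_def])
  have fL: "f \<in> L2 c" by (rule Z.is_BV_D(3)[OF f])
  \<comment> \<open>A representative of \<open>f\<close> that vanishes everywhere beyond \<open>r\<close>.\<close>
  define f1 where "f1 y = (if y < r then f y else 0)" for y
  have ae: "AE y in weighted c. f y = f1 y"
  proof -
    have "AE y in weighted c. y \<noteq> r" unfolding AE_weighted using AE_lborel_singleton[of r] by eventually_elim simp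
    moreover have "AE y in weighted c. r < y \<longrightarrow> f y = 0" using rp(2) by (simp only: f_def)
    ultimately show ?thesis by eventually_elim (auto simp: f1_def)
  qed
  have f1L: "f1 \<in> L2 c"
  proof (rule L2_cong_AE[OF fL _ ae])
    have "(\<lambda>y. indicator {..<r} y :: complex) \<in> borel_measurable (weighted c)" by (rule measurable_weightedI) simp
    then have "(\<lambda>y. indicator {..<r} y * f y) \<in> borel_measurable (weighted c)"
      by (rule borel_measurable_times[OF _ L2_measurable[OF fL]])
    moreover have "(\<lambda>y. indicator {..<r} y * f y) = f1" by (auto simp: f1_def indicator_def)
    ultimately show "f1 \<in> borel_measurable (weighted c)" by simp
  qed
  have tot: "(LBINT y:{0<..<r}. complex_of_real (y powr c) * f1 y) = 0"
  proof -
    have "(LBINT y:{0<..<r}. complex_of_real (y powr c) * f1 y) = (LBINT y:{0<..<r}. complex_of_real (y powr c) * f y)"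
      by (intro set_lebesgue_integral_cong) (auto simp: f1_def)
    then show ?thesis using rp(3) by (simp only: f_def)
  qed
  \<comment> \<open>The bounds \<open>C1\<close> for \<open>w - U\<close> and \<open>1 + C\<close> for its image add up to \<open>T\<close>.\<close>
  define T where "T = C1 + (1 + C)"
  have T: "T > 0" using C0 C10 by (simp add: T_def)
  obtain \<phi> where \<phi>: "\<phi> \<in> Cc_infty {0<..}" "\<And>y. r \<le> y \<Longrightarrow> \<phi> y = 0" "L2_norm c (\<lambda>y. f1 y - \<phi> y) < \<epsilon> / T"
    "(LBINT y:{0<..}. complex_of_real (y powr c) * \<phi> y) = 0"
    by (rule mean_zero_approximation[OF c r f1L _ tot divide_pos_pos[OF \<epsilon> T]]) (auto simp: f1_def intro: that)
  obtain U where U: "U \<in> core_functions" "is_BV c (\<lambda>_. 0) U \<phi>" "\<And>y. r < y \<Longrightarrow> U y = 0"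
    by (rule core_function_with_source[OF c r \<phi>(1,2,4)], assumption) (rule that; assumption)
  have \<phi>L: "\<phi> \<in> L2 c" by (rule Cc_infty_L2[OF c \<phi>(1)])
  have Us: "AE y in weighted c. r < y \<longrightarrow> U y = 0" using U(3) by (intro AE_I2) auto
  have ds: "AE y in weighted c. r < y \<longrightarrow> w y - U y = 0" using U(3) supp by (intro AE_I2) auto
  have d: "is_BV c (\<lambda>_. 0) (\<lambda>y. w y - U y) (\<lambda>y. f y - \<phi> y)" by (rule Z.is_BV_diff[OF f U(2)])
  have VU: "(\<lambda>y. complex_of_real (V y) * U y) \<in> L2 c" using C[OF zero_potential U(2) Us] by auto
  define h' where "h' y = \<phi> y - complex_of_real (V y) * U y" for y
  have h': "is_BV c V U h'" unfolding h'_def by (rule add_potential[OF U(2) VU])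
  have fd: "L2_norm c (\<lambda>y. f y - \<phi> y) < \<epsilon> / T"
  proof -
    have "L2_norm c (\<lambda>y. f y - \<phi> y) = L2_norm c (\<lambda>y. f1 y - \<phi> y)"
      by (rule L2_norm_cong_AE[OF L2_diff[OF fL \<phi>L] L2_diff[OF f1L \<phi>L]])
         (use ae in eventually_elim, simp)
    with \<phi>(3) show ?thesis by simp
  qed
  have "L2_norm c (\<lambda>y. h y - h' y) = L2_norm c (\<lambda>y. (f y - \<phi> y) - complex_of_real (V y) * (w y - U y))"
    by (intro arg_cong[where f = "L2_norm c"] ext) (simp add: f_def h'_def algebra_simps)
  also have "\<dots> \<le> L2_norm c (\<lambda>y. f y - \<phi> y) + L2_norm c (\<lambda>y. complex_of_real (V y) * (w y - U y))"
    by (rule L2_norm_triangle_diff[OF L2_diff[OF fL \<phi>L]]) (use C[OF zero_potential d ds] in blast)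
  also have "\<dots> \<le> (1 + C) * L2_norm c (\<lambda>y. f y - \<phi> y)"
    using C[OF zero_potential d ds] by (simp add: distrib_right)
  finally have "L2_norm c (\<lambda>y. w y - U y) + L2_norm c (\<lambda>y. h y - h' y) \<le> T * L2_norm c (\<lambda>y. f y - \<phi> y)"
    using C1[OF zero_potential d ds] unfolding T_def distrib_right[of C1] by linarith
  also have "\<dots> < \<epsilon>" using fd T by (simp add: less_divide_eq mult.commute)
  finally show ?thesis using that[OF U(1) h'] by blast
qed

lemma core_functions_core: "is_core_BV c V core_functions"
  unfolding is_core_BV_def
proof (intro conjI ballI allI impI core_functions_subset)
  fix u and \<epsilon> :: real assume "u \<in> dom_BV c V" and \<epsilon>: "\<epsilon> > 0"
  then obtain g where g: "is_BV c V u g" by (auto simp: dom_BV_def)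
  have \<epsilon>2: "\<epsilon> / 2 > 0" using \<epsilon> by simp
  obtain R w h where R: "R > 0" and w: "is_BV c V w h" "\<And>y. R < y \<Longrightarrow> w y = 0"
    and uw: "L2_norm c (\<lambda>y. u y - w y) + L2_norm c (\<lambda>y. g y - h y) < \<epsilon> / 2"
    by (rule cutoff_dense[OF g \<epsilon>2]) (rule that; assumption)
  obtain U h' where U: "U \<in> core_functions" "is_BV c V U h'"
    and wU: "L2_norm c (\<lambda>y. w y - U y) + L2_norm c (\<lambda>y. h y - h' y) < \<epsilon> / 2"
    by (rule core_approximation[OF w(1) R w(2) \<epsilon>2], assumption) (rule that; assumption)
  have tri: "L2_norm c (\<lambda>y. p y - s y) \<le> L2_norm c (\<lambda>y. p y - q y) + L2_norm c (\<lambda>y. q y - s y)"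
    if "p \<in> L2 c" "q \<in> L2 c" "s \<in> L2 c" for p q s
    using L2_norm_triangle[OF L2_diff[OF that(1,2)] L2_diff[OF that(2,3)]] by simp
  have "graph_norm c V (\<lambda>y. u y - U y) = L2_norm c (\<lambda>y. u y - U y) + L2_norm c (\<lambda>y. g y - h' y)"
    by (rule graph_norm_eq[OF is_BV_diff[OF g U(2)]])
  also have "\<dots> < \<epsilon>"
    using tri[OF is_BV_D(4)[OF g] is_BV_D(4)[OF w(1)] is_BV_D(4)[OF U(2)]]
      tri[OF is_BV_D(3)[OF g] is_BV_D(3)[OF w(1)] is_BV_D(3)[OF U(2)]] uw wU by linarith
  finally show "\<exists>v\<in>core_functions. graph_norm c V (\<lambda>y. u y - v y) < \<epsilon>" using U(1) by blast
qed

end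

section \<open>The three cases of the hypothesis\<close>

lemma Lq_locD:
  fixes W :: "real \<Rightarrow> real"
  assumes "W \<in> Lq_loc q c" "0 < b"
  shows "set_borel_measurable lborel {0<..b} W" "integrable (weighted c) (\<lambda>y. indicator {0<..b} y * \<bar>W y\<bar> powr q)"
proof -
  have S: "{0..b} \<inter> space (weighted c) \<in> sets (weighted c)"
    by (simp add: weighted_def sets_restrict_space_iff)
  have "W \<in> borel_measurable (restrict_space (weighted c) {0..b})"
    and i: "integrable (restrict_space (weighted c) {0..b}) (\<lambda>y. norm (W y) powr q)"
    using assms by (auto simp: Lq_loc_def Lq_def)
  then have "(\<lambda>y. indicator {0..b} y *\<^sub>R W y) \<in> borel_measurable (weighted c)"
    by (simp only: borel_measurable_restrict_space_iff[OF S])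
  moreover have "(\<lambda>y. indicator {0<..} y *\<^sub>R (indicator {0..b} y *\<^sub>R W y)) = (\<lambda>y. indicator {0<..b} y *\<^sub>R W y)"
    by (auto simp: indicator_def fun_eq_iff)
  ultimately show "set_borel_measurable lborel {0<..b} W"
    by (simp only: borel_measurable_weighted set_borel_measurable_def)
  have "integrable (weighted c) (\<lambda>y. indicator {0..b} y *\<^sub>R norm (W y) powr q)"
    using i by (simp only: integrable_restrict_space[OF S])
  then show "integrable (weighted c) (\<lambda>y. indicator {0<..b} y * \<bar>W y\<bar> powr q)"
    by (rule Bochner_Integration.integrable_cong[THEN iffD1, rotated 2]) (auto simp: indicator_def)
qed

lemma Lq_loc_measurable:
  fixes W :: "real \<Rightarrow> real"
  assumes "W \<in> Lq_loc q c"
  shows "W \<in> borel_measurable (weighted c)"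
  unfolding borel_measurable_weighted set_borel_measurable_def
proof (rule borel_measurable_LIMSEQ_metric)
  show "(\<lambda>y. indicator {0<..real (Suc n)} y *\<^sub>R W y) \<in> borel_measurable lborel" for n
    using Lq_locD(1)[OF assms, of "real (Suc n)"] by (simp add: set_borel_measurable_def)
  fix y
  obtain n0 :: nat where n0: "y < real n0" using reals_Archimedean2 by blast
  have "eventually (\<lambda>n. indicator {0<..real (Suc n)} y *\<^sub>R W y = indicator {0<..} y *\<^sub>R W y) sequentially"
    using eventually_ge_at_top[of n0] by (rule eventually_mono) (use n0 in \<open>auto simp: indicator_def\<close>)
  then show "(\<lambda>n. indicator {0<..real (Suc n)} y *\<^sub>R W y) \<longlonglongrightarrow> indicator {0<..} y *\<^sub>R W y"
    by (rule tendsto_eventually)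
qed

lemma potential_Lq_loc:
  assumes "c > -1" "AE y in weighted c. 0 \<le> V y" "V \<in> Lq_loc 1 c"
  shows "potential c V"
proof
  show m: "V \<in> borel_measurable (weighted c)" by (rule Lq_loc_measurable[OF assms(3)])
  fix R :: real assume R: "0 < R"
  from Lq_locD(2)[OF assms(3) R] show "integrable (weighted c) (\<lambda>y. indicator {0<..R} y * V y)"
  proof (rule Bochner_Integration.integrable_bound)
    have "(\<lambda>y. indicator {0<..R} y :: real) \<in> borel_measurable (weighted c)" by (rule measurable_weightedI) simp
    then show "(\<lambda>y. indicator {0<..R} y * V y) \<in> borel_measurable (weighted c)" using m by (rule borel_measurable_times)
  qed (auto simp: indicator_def)
qed fact+

lemma square_integrable_below:
  assumes "W \<in> Lq_loc 2 c" "r > 0"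
  shows "integrable (weighted c) (\<lambda>y. indicator {0<..<r} y * (W y :: real)\<^sup>2)"
proof (rule Bochner_Integration.integrable_bound[OF Lq_locD(2)[OF assms]])
  have "(\<lambda>y. indicator {0<..<r} y :: real) \<in> borel_measurable (weighted c)" by (rule measurable_weightedI) simp
  then show "(\<lambda>y. indicator {0<..<r} y * (W y)\<^sup>2) \<in> borel_measurable (weighted c)"
    using Lq_loc_measurable[OF assms(1)] by measurable
qed (auto simp: indicator_def)

theorem proposition5p12:
  fixes c :: real and V :: "real \<Rightarrow> real"
  assumes "c + 1 > 0"
    and "AE y in weighted c. 0 \<le> V y"
    and "V \<in> Lq_loc 1 c"
    and "(c < 3 \<and> V \<in> Lq_loc 2 c) \<or>
         (c = 3 \<and> V \<in> Lq_loc 2 c \<and> (\<lambda>y. V y * \<bar>ln y\<bar> powr (1/2)) \<in> Lq_loc 2 c) \<or>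
         (c > 3 \<and> (\<lambda>y. V y * y powr ((3 - c) / 2)) \<in> Lq_loc 2 c)"
  shows "(\<forall>r>0.
            dom_BV c V \<inter> supported_in c r = dom_BV c (\<lambda>_. 0) \<inter> supported_in c r \<and>
            (\<exists>K>0. \<forall>u \<in> dom_BV c (\<lambda>_. 0) \<inter> supported_in c r.
               graph_norm c V u \<le> K * graph_norm c (\<lambda>_. 0) u \<and>
               graph_norm c (\<lambda>_. 0) u \<le> K * graph_norm c V u)) \<and>
         is_core_BV c V core_functions"
proof -
  interpret potential c V
    by (rule potential_Lq_loc) (use assms in auto)
  interpret admissible_potential c V
  proof
    fix r :: real assume r: "r > 0"
    from assms(4) consider "c < 3" "V \<in> Lq_loc 2 c"
      | "c = 3" "V \<in> Lq_loc 2 c" "(\<lambda>y. V y * \<bar>ln y\<bar> powr (1/2)) \<in> Lq_loc 2 c"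
      | "c > 3" "(\<lambda>y. V y * y powr ((3 - c) / 2)) \<in> Lq_loc 2 c" by blast
    then show "integrable (weighted c) (\<lambda>y. indicator {0<..<r} y * ((V y)\<^sup>2 * kernel_weight c y))"
    proof cases
      case 1
      then show ?thesis using square_integrable_below[OF _ r] by (simp add: kernel_weight_def)
    next
      case 2
      have "integrable (weighted c) (\<lambda>y. indicator {0<..<r} y * (V y)\<^sup>2 + indicator {0<..<r} y * (V y * \<bar>ln y\<bar> powr (1/2))\<^sup>2)"
        by (intro Bochner_Integration.integrable_add square_integrable_below r 2)
      moreover have "indicator {0<..<r} y * (V y)\<^sup>2 + indicator {0<..<r} y * (V y * \<bar>ln y\<bar> powr (1/2))\<^sup>2 =
          indicator {0<..<r} y * ((V y)\<^sup>2 * kernel_weight c y)" for y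
        using 2(1) by (simp add: kernel_weight_def power_mult_distrib powr_half_sqrt algebra_simps)
      ultimately show ?thesis by (simp only:)
    next
      case 3
      have "indicator {0<..<r} y * (V y * y powr ((3 - c) / 2))\<^sup>2 = indicator {0<..<r} y * ((V y)\<^sup>2 * kernel_weight c y)" for y
      proof -
        have "(y powr ((3 - c) / 2))\<^sup>2 = y powr (3 - c)"
          by (simp add: power2_eq_square powr_add[symmetric])
        with 3(1) show ?thesis by (simp add: kernel_weight_def power_mult_distrib)
      qed
      then show ?thesis using square_integrable_below[OF 3(2) r] by (simp only:)
    qed
  qed
  show ?thesis
    using dom_BV_supported_eq graph_norms_equivalent core_functions_core by blast
qed

end
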